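(* Let $G=(V,E)$ be a directed graph (loops allowed, no multiedges) with $n$ nodes and $m$ edges, and let $s,t\in V$. There exist algorithms that, in $O(m+n)$ time, compute all maximal safe walks with respect to the set of all $s$-$t$ paths of $G$, and all maximal safe walks with respect to the set of all $s$-$t$ trails of $G$. Likewise, the maximal safe node sequences ($V$-visible versions) with respect to the set of all $s$-$t$ paths, and with respect to the set of all $s$-$t$ trails, can be computed in $O(m+n)$ time.
   Context: A walk is an alternating sequence $(v_1,e_1,v_2,\dots,e_k,v_{k+1})$ of nodes and edges with $e_i=(v_i,v_{i+1})$; it is an $s$-$t$ walk if $v_1=s$, $v_{k+1}=t$. A trail is a walk repeating no edge; a path is a trail repeating no node (except possibly first = last). Given a set $\mathcal W$ of $s$-$t$ walks (the candidate set), a walk $W$ is safe with respect to $\mathcal W$ if $W$ is a subwalk (contiguous substring, as alternating sequence) of every walk in $\mathcal W$; it is maximal safe if it cannot be extended to the left or right while remaining safe. The node sequence of a walk is the sequence of its nodes in order; a sequence of nodes is safe ($V$-visible version) with respect to $\mathcal W$ if it is a substring of the node sequence of every walk in $\mathcal W$, and maximal safe if it cannot be extended on either side while remaining safe.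
   Formalization: If G has no s-t path (equivalently no s-t trail), every walk is vacuously safe and the maximal safe walks can be exponentially many; in that case the algorithm is only required to halt in O(m+n) time and output nothing. *)

theory Defs
  imports "Graph_Theory.Pair_Digraph" "HOL-Library.Sublist"
begin

section \<open>Walks as alternating sequences\<close>

datatype 'v item = Node 'v | Edge "'v \<times> 'v"

primrec walk_seq :: "'v \<Rightarrow> ('v \<times> 'v) awalk \<Rightarrow> 'v item list" where
  "walk_seq u [] = [Node u]"
| "walk_seq u (e # p) = Node u # Edge e # walk_seq (snd e) p"

definition is_walk :: "'v pair_pre_digraph \<Rightarrow> 'v item list \<Rightarrow> bool" where
  "is_walk G W \<longleftrightarrow> (\<exists>u p v. pre_digraph.awalk (with_proj G) u p v \<and> W = walk_seq u p)"

definition st_trails :: "'v pair_pre_digraph \<Rightarrow> 'v \<Rightarrow> 'v \<Rightarrow> 'v item list set" where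
  "st_trails G s t = {walk_seq s p | p. pre_digraph.trail (with_proj G) s p t}"

text \<open>
  The library's \<^const>\<open>pre_digraph.apath\<close> forbids every node repetition; here the first and the
  last node of a path may coincide.
\<close>

definition st_paths :: "'v pair_pre_digraph \<Rightarrow> 'v \<Rightarrow> 'v \<Rightarrow> 'v item list set" where
  "st_paths G s t = {walk_seq s p | p. pre_digraph.trail (with_proj G) s p t \<and>
     (let vs = pre_digraph.awalk_verts (with_proj G) s p
      in distinct vs \<or> (hd vs = last vs \<and> distinct (tl vs)))}"

primrec node_seq :: "'v item list \<Rightarrow> 'v list" where
  "node_seq [] = []"
| "node_seq (x # W) = (case x of Node v \<Rightarrow> v # node_seq W | Edge e \<Rightarrow> node_seq W)"


section \<open>Safety\<close>

definition safe_walk :: "'v pair_pre_digraph \<Rightarrow> 'v item list set \<Rightarrow> 'v item list \<Rightarrow> bool" where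
  "safe_walk G \<W> W \<longleftrightarrow> is_walk G W \<and> (\<forall>P\<in>\<W>. sublist W P)"

definition maximal_safe_walks :: "'v pair_pre_digraph \<Rightarrow> 'v item list set \<Rightarrow> 'v item list set" where
  "maximal_safe_walks G \<W> = {W. safe_walk G \<W> W \<and>
     (\<forall>X Y. safe_walk G \<W> (X @ W @ Y) \<longrightarrow> X = [] \<and> Y = [])}"

definition safe_node_seq :: "'v pair_pre_digraph \<Rightarrow> 'v item list set \<Rightarrow> 'v list \<Rightarrow> bool" where
  "safe_node_seq G \<W> vs \<longleftrightarrow> set vs \<subseteq> pverts G \<and> (\<forall>P\<in>\<W>. sublist vs (node_seq P))"

definition maximal_safe_node_seqs :: "'v pair_pre_digraph \<Rightarrow> 'v item list set \<Rightarrow> 'v list set" where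
  "maximal_safe_node_seqs G \<W> = {vs. safe_node_seq G \<W> vs \<and>
     (\<forall>xs ys. safe_node_seq G \<W> (xs @ vs @ ys) \<longrightarrow> xs = [] \<and> ys = [])}"


section \<open>Machine model\<close>

text \<open>
  A word RAM, programmed in a while language. A program mentions finitely many scalar variables and
  finitely many arrays (interleaving the arrays in one memory gives the usual random access
  machine with constant overhead). Every operator, memory access and test costs one time unit.
  The parameter \<open>w\<close> of the execution relation is the largest storable number: an execution that
  would store a larger one is stuck, so arithmetic on unboundedly large numbers is not available
  at unit cost.
\<close>

datatype aexp =
    Const nat
  | Var string
  | Arr string aexp
  | Plus aexp aexp
  | Minus aexp aexp

datatype bexp =
    Less aexp aexp
  | Equal aexp aexp
  | Neg bexp
  | Conj bexp bexp

datatype com =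
    Skip
  | Assign string aexp
  | Store string aexp aexp
  | Seq com com
  | Cond bexp com com
  | While bexp com

record state =
  var :: "string \<Rightarrow> nat"
  arr :: "string \<Rightarrow> nat \<Rightarrow> nat"

primrec aval :: "aexp \<Rightarrow> state \<Rightarrow> nat" where
  "aval (Const k) \<sigma> = k"
| "aval (Var x) \<sigma> = var \<sigma> x"
| "aval (Arr a i) \<sigma> = arr \<sigma> a (aval i \<sigma>)"
| "aval (Plus e f) \<sigma> = aval e \<sigma> + aval f \<sigma>"
| "aval (Minus e f) \<sigma> = aval e \<sigma> - aval f \<sigma>"

primrec acost :: "aexp \<Rightarrow> nat" where
  "acost (Const k) = 1"
| "acost (Var x) = 1"
| "acost (Arr a i) = 1 + acost i"
| "acost (Plus e f) = 1 + acost e + acost f"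
| "acost (Minus e f) = 1 + acost e + acost f"

primrec bval :: "bexp \<Rightarrow> state \<Rightarrow> bool" where
  "bval (Less e f) \<sigma> = (aval e \<sigma> < aval f \<sigma>)"
| "bval (Equal e f) \<sigma> = (aval e \<sigma> = aval f \<sigma>)"
| "bval (Neg b) \<sigma> = (\<not> bval b \<sigma>)"
| "bval (Conj b c) \<sigma> = (bval b \<sigma> \<and> bval c \<sigma>)"

primrec bcost :: "bexp \<Rightarrow> nat" where
  "bcost (Less e f) = 1 + acost e + acost f"
| "bcost (Equal e f) = 1 + acost e + acost f"
| "bcost (Neg b) = 1 + bcost b"
| "bcost (Conj b c) = 1 + bcost b + bcost c"

text \<open>\<open>exec w c \<sigma> k \<tau>\<close>: started in \<open>\<sigma>\<close>, program \<open>c\<close> halts in \<open>\<tau>\<close> after exactly \<open>k\<close> time units.\<close>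

inductive exec :: "nat \<Rightarrow> com \<Rightarrow> state \<Rightarrow> nat \<Rightarrow> state \<Rightarrow> bool" for w :: nat where
  Skip: "exec w Skip \<sigma> 1 \<sigma>"
| Assign: "aval e \<sigma> \<le> w \<Longrightarrow>
    exec w (Assign x e) \<sigma> (1 + acost e) (\<sigma>\<lparr>var := (var \<sigma>)(x := aval e \<sigma>)\<rparr>)"
| Store: "aval e \<sigma> \<le> w \<Longrightarrow>
    exec w (Store a i e) \<sigma> (1 + acost i + acost e)
      (\<sigma>\<lparr>arr := (arr \<sigma>)(a := (arr \<sigma> a)(aval i \<sigma> := aval e \<sigma>))\<rparr>)"
| Seq: "exec w c \<sigma> k \<sigma>' \<Longrightarrow> exec w d \<sigma>' l \<tau> \<Longrightarrow> exec w (Seq c d) \<sigma> (k + l) \<tau>"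
| CondTrue: "bval b \<sigma> \<Longrightarrow> exec w c \<sigma> k \<tau> \<Longrightarrow> exec w (Cond b c d) \<sigma> (1 + bcost b + k) \<tau>"
| CondFalse: "\<not> bval b \<sigma> \<Longrightarrow> exec w d \<sigma> k \<tau> \<Longrightarrow> exec w (Cond b c d) \<sigma> (1 + bcost b + k) \<tau>"
| WhileFalse: "\<not> bval b \<sigma> \<Longrightarrow> exec w (While b c) \<sigma> (1 + bcost b) \<sigma>"
| WhileTrue: "bval b \<sigma> \<Longrightarrow> exec w c \<sigma> k \<sigma>' \<Longrightarrow> exec w (While b c) \<sigma>' l \<tau> \<Longrightarrow>
    exec w (While b c) \<sigma> (1 + bcost b + k + l) \<tau>"

inductive_cases SkipE: "exec w Skip \<sigma> k \<tau>"
inductive_cases AssignE: "exec w (Assign x e) \<sigma> k \<tau>"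
inductive_cases StoreE: "exec w (Store a i e) \<sigma> k \<tau>"
inductive_cases SeqE: "exec w (Seq c d) \<sigma> k \<tau>"
inductive_cases CondE: "exec w (Cond b c d) \<sigma> k \<tau>"
inductive_cases WhileE: "exec w (While b c) \<sigma> k \<tau>"

lemma exec_deterministic:
  "exec w c \<sigma> k \<tau> \<Longrightarrow> exec w c \<sigma> k' \<tau>' \<Longrightarrow> k' = k \<and> \<tau>' = \<tau>"
proof (induction arbitrary: k' \<tau>' rule: exec.induct)
  case (Skip \<sigma>)
  then show ?case by (rule SkipE) simp
next
  case (Assign e \<sigma> x)
  from Assign.prems show ?case by (rule AssignE) simp
next
  case (Store e \<sigma> a i)
  from Store.prems show ?case by (rule StoreE) simp
next
  case (Seq c \<sigma> k \<sigma>' d l \<tau>)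
  from Seq.prems show ?case
  proof (rule SeqE)
    fix k1 \<sigma>1 l1
    assume *: "k' = k1 + l1" "exec w c \<sigma> k1 \<sigma>1" "exec w d \<sigma>1 l1 \<tau>'"
    have "k1 = k" "\<sigma>1 = \<sigma>'" using Seq.IH(1)[OF *(2)] by blast+
    with * Seq.IH(2)[of l1 \<tau>'] show ?thesis by simp
  qed
next
  case (CondTrue b \<sigma> c k \<tau> d)
  from CondTrue.prems show ?case by (rule CondE) (use CondTrue.hyps in \<open>auto dest: CondTrue.IH\<close>)
next
  case (CondFalse b \<sigma> d k \<tau> c)
  from CondFalse.prems show ?case by (rule CondE) (use CondFalse.hyps in \<open>auto dest: CondFalse.IH\<close>)
next
  case (WhileFalse b \<sigma> c)
  from WhileFalse.prems show ?case by (rule WhileE) (use WhileFalse.hyps in auto)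
next
  case (WhileTrue b \<sigma> c k \<sigma>' l \<tau>)
  from WhileTrue.prems obtain k1 \<sigma>1 l1 where
    *: "k' = 1 + bcost b + k1 + l1" "exec w c \<sigma> k1 \<sigma>1" "exec w (While b c) \<sigma>1 l1 \<tau>'"
    by (rule WhileE) (use WhileTrue.hyps(1) in \<open>auto intro: that\<close>)
  have "k1 = k" "\<sigma>1 = \<sigma>'" using WhileTrue.IH(1)[OF *(2)] by blast+
  with * WhileTrue.IH(2)[of l1 \<tau>'] show ?case by simp
qed


section \<open>Input, output and linear-time listing\<close>

text \<open>
  The nodes of the input graph are \<open>0, \<dots>, n - 1\<close>; its edges are given as a list in arbitrary order,
  stored in the arrays \<open>src\<close> and \<open>dst\<close>.
\<close>

definition represents :: "nat \<Rightarrow> (nat \<times> nat) list \<Rightarrow> nat pair_pre_digraph \<Rightarrow> bool" where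
  "represents n es G \<longleftrightarrow> pverts G = {..<n} \<and> distinct es \<and> set es = parcs G"

definition input_state :: "nat \<Rightarrow> (nat \<times> nat) list \<Rightarrow> nat \<Rightarrow> nat \<Rightarrow> state" where
  "input_state n es s t =
     \<lparr>var = (\<lambda>_. 0)(''n'' := n, ''m'' := length es, ''s'' := s, ''t'' := t),
      arr = (\<lambda>_ _. 0)(''src'' := (\<lambda>i. if i < length es then fst (es ! i) else 0),
                     ''dst'' := (\<lambda>i. if i < length es then snd (es ! i) else 0))\<rparr>"

text \<open>
  The output is a list of \<open>count\<close> words, stored one after the other in the array \<open>out\<close>;
  word \<open>i\<close> occupies the cells from \<open>off[i]\<close> to \<open>off[i+1] - 1\<close>.
\<close>

definition output_words :: "state \<Rightarrow> nat list list" where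
  "output_words \<sigma> = map (\<lambda>i. map (arr \<sigma> ''out'') [arr \<sigma> ''off'' i ..< arr \<sigma> ''off'' (Suc i)])
     [0..<var \<sigma> ''count'']"

text \<open>
  A walk is written as the word \<open>v\<^sub>1, e\<^sub>1, v\<^sub>2, \<dots>, e\<^sub>k, v\<^sub>k\<^sub>+\<^sub>1\<close> in which an edge is given by its position
  in the input list. Nodes sit at even, edges at odd positions, so the word determines the walk.
\<close>

definition encode_walk :: "(nat \<times> nat) list \<Rightarrow> nat item list \<Rightarrow> nat list" where
  "encode_walk es = map (\<lambda>x. case x of
      Node v \<Rightarrow> v
    | Edge e \<Rightarrow> (THE j. j < length es \<and> es ! j = e))"

definition encode_node_seq :: "(nat \<times> nat) list \<Rightarrow> nat list \<Rightarrow> nat list" where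
  "encode_node_seq es vs = vs"

text \<open>
  One program lists, for every input, the set \<open>sol G (cand G s t)\<close> without repetitions in time
  \<open>O(m + n)\<close>, on words of \<open>O(log (m + n))\<close> bits. If there is no candidate at all, then everything is
  vacuously safe, and the maximal safe walks can be exponentially many; in this case the program
  has to report that there is no candidate, by producing no word. This is unambiguous: as soon as
  there is a candidate, some maximal safe walk contains \<open>s\<close>.
\<close>

definition lists_in_linear_time ::
  "(nat pair_pre_digraph \<Rightarrow> nat \<Rightarrow> nat \<Rightarrow> nat item list set) \<Rightarrow>
   (nat pair_pre_digraph \<Rightarrow> nat item list set \<Rightarrow> 'a set) \<Rightarrow>
   ((nat \<times> nat) list \<Rightarrow> 'a \<Rightarrow> nat list) \<Rightarrow> com \<Rightarrow> bool" where
  "lists_in_linear_time cand sol encode prog \<longleftrightarrow>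
     (\<exists>C. \<forall>G n es s t.
        pair_fin_digraph G \<longrightarrow> represents n es G \<longrightarrow> s \<in> pverts G \<longrightarrow> t \<in> pverts G \<longrightarrow>
        (let m = card (parcs G) in
         \<exists>k \<tau>. exec (C * (m + n)) prog (input_state n es s t) k \<tau> \<and> k \<le> C * (m + n) \<and>
           (if cand G s t = {} then output_words \<tau> = []
            else distinct (output_words \<tau>) \<and>
                 set (output_words \<tau>) = encode es ` sol G (cand G s t))))"

end

theory Submission
  imports Defs
begin

text \<open>
  Fix one \<open>s\<close>-\<open>t\<close> path \<open>p\<^sub>k, \<dots>, p\<^sub>n\<close>. Every safe walk is a segment of it, so only the safety of segments
  has to be decided. A detour leaves the path at some \<open>p\<^sub>a\<close>, avoids its arcs and nodes, and comes back at some
  \<open>p\<^sub>b\<close>; let \<open>F i\<close> be the largest such \<open>b\<close> over all \<open>a \<le> i\<close>. Everything reachable by detours from \<open>p\<^sub>k, \<dots>, p\<^sub>i\<close> can be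
  left only by the arc to \<open>p\<^sub>i\<^sub>+\<^sub>1\<close> or by a detour that returns beyond \<open>p\<^sub>i\<close>. Hence \<open>p\<^sub>i\<close> lies on every \<open>s\<close>-\<open>t\<close> walk iff
  \<open>F (i - 1) \<le> i\<close>, and its outgoing path arc does iff \<open>F i \<le> i\<close>. A segment of at least one arc is safe for
  paths iff all its arcs are such bridges. For trails it is moreover necessary that no detour from an inner
  node \<open>p\<^sub>i\<close> returns to \<open>p\<^sub>i\<close>, that is \<open>F i < i\<close>: such a detour is a closed trail that can be inserted between
  the two bridges at \<open>p\<^sub>i\<close>, and without it a trail, which uses the preceding bridge only once, cannot pause at \<open>p\<^sub>i\<close>.
  The values \<open>F\<close> are found by searching from \<open>p\<^sub>k, \<dots>, p\<^sub>n\<close> in turn without visiting any node twice.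
\<close>

section \<open>Timed execution\<close>

definition runs :: "nat \<Rightarrow> com \<Rightarrow> state \<Rightarrow> nat \<Rightarrow> (state \<Rightarrow> bool) \<Rightarrow> bool" where
  "runs w c \<sigma> T Q \<longleftrightarrow> (\<exists>k \<tau>. exec w c \<sigma> k \<tau> \<and> k \<le> T \<and> Q \<tau>)"

lemma runs_weaken:
  "runs w c \<sigma> T Q \<Longrightarrow> T \<le> T' \<Longrightarrow> (\<And>\<tau>. Q \<tau> \<Longrightarrow> Q' \<tau>) \<Longrightarrow> runs w c \<sigma> T' Q'"
  unfolding runs_def by (meson le_trans)

lemma runs_Seq:
  assumes "runs w c \<sigma> T Q" "\<And>\<sigma>'. Q \<sigma>' \<Longrightarrow> runs w d \<sigma>' U R"
  shows "runs w (Seq c d) \<sigma> (T + U) R"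
  using assms unfolding runs_def by (meson add_mono exec.Seq)

lemma runs_While:
  assumes inv: "I \<sigma>"
    and step: "\<And>\<sigma>. I \<sigma> \<Longrightarrow> bval b \<sigma> \<Longrightarrow> runs w c \<sigma> K (\<lambda>\<tau>. I \<tau> \<and> \<mu> \<tau> < (\<mu> \<sigma> :: nat))"
  shows "runs w (While b c) \<sigma> ((1 + bcost b + K) * \<mu> \<sigma> + 1 + bcost b) (\<lambda>\<tau>. I \<tau> \<and> \<not> bval b \<tau>)"
  using inv
proof (induction "\<mu> \<sigma>" arbitrary: \<sigma> rule: less_induct)
  case less
  show ?case
  proof (cases "bval b \<sigma>")
    case False
    then show ?thesis using less.prems exec.WhileFalse[of b \<sigma> w c] unfolding runs_def by fastforce
  next
    case True
    from step[OF less.prems True] obtain k \<sigma>' where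
      1: "exec w c \<sigma> k \<sigma>'" "k \<le> K" "I \<sigma>'" "\<mu> \<sigma>' < \<mu> \<sigma>" by (auto simp: runs_def)
    from less.hyps[OF 1(4,3)] obtain l \<tau> where
      2: "exec w (While b c) \<sigma>' l \<tau>" "l \<le> (1 + bcost b + K) * \<mu> \<sigma>' + 1 + bcost b" "I \<tau>" "\<not> bval b \<tau>"
      by (auto simp: runs_def)
    have "(1 + bcost b + K) * Suc (\<mu> \<sigma>') \<le> (1 + bcost b + K) * \<mu> \<sigma>"
      using 1(4) by (intro mult_le_mono2) simp
    then have "1 + bcost b + k + l \<le> (1 + bcost b + K) * \<mu> \<sigma> + 1 + bcost b"
      using 1(2) 2(2) by simp
    with exec.WhileTrue[OF True 1(1) 2(1)] 2 show ?thesis unfolding runs_def by blast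
  qed
qed

primrec wp :: "nat \<Rightarrow> com \<Rightarrow> (state \<Rightarrow> bool) \<Rightarrow> state \<Rightarrow> bool" where
  "wp w Skip Q \<sigma> = Q \<sigma>"
| "wp w (Assign x e) Q \<sigma> = (aval e \<sigma> \<le> w \<and> Q (\<sigma>\<lparr>var := (var \<sigma>)(x := aval e \<sigma>)\<rparr>))"
| "wp w (Store a i e) Q \<sigma> =
     (aval e \<sigma> \<le> w \<and> Q (\<sigma>\<lparr>arr := (arr \<sigma>)(a := (arr \<sigma> a)(aval i \<sigma> := aval e \<sigma>))\<rparr>))"
| "wp w (Seq c d) Q \<sigma> = wp w c (wp w d Q) \<sigma>"
| "wp w (Cond b c d) Q \<sigma> = ((bval b \<sigma> \<longrightarrow> wp w c Q \<sigma>) \<and> (\<not> bval b \<sigma> \<longrightarrow> wp w d Q \<sigma>))"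
| "wp w (While b c) Q \<sigma> = False"

primrec cost :: "com \<Rightarrow> nat" where
  "cost Skip = 1"
| "cost (Assign x e) = 1 + acost e"
| "cost (Store a i e) = 1 + acost i + acost e"
| "cost (Seq c d) = cost c + cost d"
| "cost (Cond b c d) = 1 + bcost b + cost c + cost d"
| "cost (While b c) = 0"

lemma runs_wp: "wp w c Q \<sigma> \<Longrightarrow> runs w c \<sigma> (cost c) Q"
proof (induction c arbitrary: Q \<sigma>)
  case (Seq c d)
  from Seq.prems have "wp w c (wp w d Q) \<sigma>" by simp
  from runs_Seq[OF Seq.IH(1)[OF this] Seq.IH(2)] show ?case by simp
next
  case (Cond b c d)
  show ?case
  proof (cases "bval b \<sigma>")
    case True
    with Cond.prems Cond.IH(1) obtain k \<tau> where "exec w c \<sigma> k \<tau>" "k \<le> cost c" "Q \<tau>"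
      by (fastforce simp: runs_def)
    with exec.CondTrue[OF True] show ?thesis unfolding runs_def by fastforce
  next
    case False
    with Cond.prems Cond.IH(2) obtain k \<tau> where "exec w d \<sigma> k \<tau>" "k \<le> cost d" "Q \<tau>"
      by (fastforce simp: runs_def)
    with exec.CondFalse[OF False] show ?thesis unfolding runs_def by fastforce
  qed
next
  case Skip
  then show ?case using exec.Skip[of w \<sigma>] unfolding runs_def by fastforce
next
  case (Assign x e)
  then show ?case using exec.Assign[of e \<sigma> w x] unfolding runs_def by fastforce
next
  case (Store a i e)
  then show ?case using exec.Store[of e \<sigma> w a i] unfolding runs_def by fastforce
qed simp

lemma runs_Cond:
  assumes "bval b \<sigma> \<Longrightarrow> runs w c \<sigma> T Q" "\<not> bval b \<sigma> \<Longrightarrow> runs w d \<sigma> T Q"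
  shows "runs w (Cond b c d) \<sigma> (1 + bcost b + T) Q"
proof (cases "bval b \<sigma>")
  case True
  with assms(1) obtain k \<tau> where "exec w c \<sigma> k \<tau>" "k \<le> T" "Q \<tau>" by (auto simp: runs_def)
  with exec.CondTrue[OF True] show ?thesis unfolding runs_def by fastforce
next
  case False
  with assms(2) obtain k \<tau> where "exec w d \<sigma> k \<tau>" "k \<le> T" "Q \<tau>" by (auto simp: runs_def)
  with exec.CondFalse[OF False] show ?thesis unfolding runs_def by fastforce
qed

primrec assigned_vars :: "com \<Rightarrow> string set" where
  "assigned_vars Skip = {}"
| "assigned_vars (Assign x e) = {x}"
| "assigned_vars (Store a i e) = {}"
| "assigned_vars (Seq c d) = assigned_vars c \<union> assigned_vars d"
| "assigned_vars (Cond b c d) = assigned_vars c \<union> assigned_vars d"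
| "assigned_vars (While b c) = assigned_vars c"

primrec stored_arrays :: "com \<Rightarrow> string set" where
  "stored_arrays Skip = {}"
| "stored_arrays (Assign x e) = {}"
| "stored_arrays (Store a i e) = {a}"
| "stored_arrays (Seq c d) = stored_arrays c \<union> stored_arrays d"
| "stored_arrays (Cond b c d) = stored_arrays c \<union> stored_arrays d"
| "stored_arrays (While b c) = stored_arrays c"

lemma exec_frame:
  assumes "exec w c \<sigma> k \<tau>"
  shows "(x \<notin> assigned_vars c \<longrightarrow> var \<tau> x = var \<sigma> x) \<and> (a \<notin> stored_arrays c \<longrightarrow> arr \<tau> a = arr \<sigma> a)"
  using assms by induction auto

lemma runs_frame:
  assumes "runs w c \<sigma> T Q"
  shows "runs w c \<sigma> T (\<lambda>\<tau>. Q \<tau> \<and> (\<forall>x. x \<notin> assigned_vars c \<longrightarrow> var \<tau> x = var \<sigma> x) \<and>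
     (\<forall>a. a \<notin> stored_arrays c \<longrightarrow> arr \<tau> a = arr \<sigma> a))"
  using assms exec_frame unfolding runs_def by meson


section \<open>Walks, arc lists and node sequences\<close>

lemma prefix_walk_seq_iff: "prefix (walk_seq u q) (walk_seq v r) \<longleftrightarrow> u = v \<and> prefix q r"
proof (induction q arbitrary: u v r)
  case Nil
  show ?case by (cases r) auto
next
  case (Cons e q)
  show ?case by (cases r) (auto simp: Cons.IH)
qed

lemma sublist_walk_seq_iff:
  "sublist (walk_seq u q) (walk_seq v r) \<longleftrightarrow>
     (\<exists>xs ys. r = xs @ q @ ys \<and> u = last (v # map snd xs))"
proof (induction r arbitrary: v)
  case Nil
  show ?case by (cases q) (auto simp: sublist_Cons_right)
next
  case (Cons e r)
  have "sublist (walk_seq u q) (walk_seq v (e # r)) \<longleftrightarrow>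
      prefix (walk_seq u q) (walk_seq v (e # r)) \<or> sublist (walk_seq u q) (walk_seq (snd e) r)"
    by (cases q) (auto simp: sublist_Cons_right)
  also have "\<dots> \<longleftrightarrow> u = v \<and> prefix q (e # r) \<or>
      (\<exists>xs ys. r = xs @ q @ ys \<and> u = last (snd e # map snd xs))"
    by (simp only: prefix_walk_seq_iff Cons.IH)
  also have "\<dots> \<longleftrightarrow> (\<exists>xs ys. e # r = xs @ q @ ys \<and> u = last (v # map snd xs))" (is "?L \<longleftrightarrow> ?R")
  proof
    assume ?L
    then show ?R
    proof
      assume "u = v \<and> prefix q (e # r)"
      then obtain ys where "e # r = [] @ q @ ys" "u = last (v # map snd [])" by (auto simp: prefix_def)
      then show ?R by (intro exI[of _ "[]"] exI[of _ ys]) simp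
    next
      assume "\<exists>xs ys. r = xs @ q @ ys \<and> u = last (snd e # map snd xs)"
      then obtain xs ys where "r = xs @ q @ ys" "u = last (snd e # map snd xs)" by blast
      then show ?R by (intro exI[of _ "e # xs"] exI[of _ ys]) auto
    qed
  next
    assume ?R
    then obtain xs ys where *: "e # r = xs @ q @ ys" "u = last (v # map snd xs)" by blast
    show ?L
    proof (cases xs)
      case Nil
      with * show ?thesis by (auto simp: prefix_def)
    next
      case (Cons x xs')
      with * show ?thesis by auto
    qed
  qed
  finally show ?case .
qed

lemma walk_seq_append: "walk_seq u (q @ e # r) = walk_seq u q @ Edge e # walk_seq (snd e) r"
  by (induction q arbitrary: u) auto

lemma node_seq_append: "node_seq (X @ Y) = node_seq X @ node_seq Y"
  by (induction X) (auto split: item.split)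

lemma node_seq_walk_seq: "node_seq (walk_seq u q) = u # map snd q"
  by (induction q arbitrary: u) auto

fun walk_of :: "'v list \<Rightarrow> 'v item list" where
  "walk_of [] = []"
| "walk_of [v] = [Node v]"
| "walk_of (v # w # vs) = Node v # Edge (v, w) # walk_of (w # vs)"

lemma node_seq_walk_of: "node_seq (walk_of vs) = vs"
  by (induction vs rule: walk_of.induct) auto

lemma walk_seq_eq_walk_of: "pcas u q v \<Longrightarrow> walk_seq u q = walk_of (u # map snd q)"
  by (induction u q v rule: pcas.induct) auto

lemma walk_of_append: 
  "vs \<noteq> [] \<Longrightarrow> \<exists>X Y. walk_of (xs @ vs @ ys) = X @ walk_of vs @ Y"
proof -
  assume vs: "vs \<noteq> []"
  have 1: "\<exists>Y. walk_of (vs @ ys) = walk_of vs @ Y" using vs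
  proof (induction vs rule: walk_of.induct)
    case (2 v)
    then show ?case by (cases ys) auto
  qed auto
  have 2: "\<exists>X. walk_of (xs @ us) = X @ walk_of us" if "us \<noteq> []" for us :: "'a list"
  proof (induction xs)
    case (Cons x xs)
    show ?case
    proof (cases "xs @ us")
      case Nil
      then show ?thesis using that by simp
    next
      case (Cons z zs)
      from Cons.IH obtain X where "walk_of (xs @ us) = X @ walk_of us" by blast
      with Cons have "walk_of ((x # xs) @ us) = (Node x # Edge (x, z) # X) @ walk_of us" by simp
      then show ?thesis by blast
    qed
  qed simp
  from 1 2[of "vs @ ys"] vs show ?thesis by (metis append_is_Nil_conv)
qed

lemma sublist_walk_of: "vs \<noteq> [] \<Longrightarrow> sublist vs vs' \<Longrightarrow> sublist (walk_of vs) (walk_of vs')"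
  by (metis sublist_def walk_of_append)

lemma sublist_node_seq: "sublist W P \<Longrightarrow> sublist (node_seq W) (node_seq P)"
  unfolding sublist_def by (metis node_seq_append)

context pair_wf_digraph
begin

lemma is_walk_iff: "is_walk G W \<longleftrightarrow> (\<exists>u q v. awalk u q v \<and> W = walk_seq u q)"
  by (simp add: is_walk_def)

lemma is_walk_eq_walk_of: "is_walk G W \<Longrightarrow> node_seq W \<noteq> [] \<and> W = walk_of (node_seq W)"
  by (auto simp: is_walk_iff node_seq_walk_seq walk_seq_eq_walk_of[symmetric] awalk_def)

lemma is_walk_sublist:
  assumes "is_walk G P" "vs \<noteq> []" "sublist vs (node_seq P)"
  shows "is_walk G (walk_of vs)"
proof -
  from assms(1) obtain u q v where P: "awalk u q v" "P = walk_seq u q" by (auto simp: is_walk_iff)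
  from assms(3) obtain xs ys where eq: "u # map snd q = xs @ vs @ ys"
    by (auto simp: P node_seq_walk_seq sublist_def)
  have len: "length vs + length xs + length ys = Suc (length q)"
    using arg_cong[OF eq, of length] by simp
  define q1 q2 where "q1 = take (length xs) q" and "q2 = drop (length xs) q"
  define r where "r = take (length vs - 1) q2"
  have q: "q = q1 @ r @ drop (length vs - 1) q2" by (simp only: q1_def q2_def r_def append_take_drop_id)
  define x where "x = awlast u q1"
  define y where "y = awlast x r"
  have "awalk u (q1 @ r @ drop (length vs - 1) q2) v" using P(1) q by simp
  then have r: "awalk u q1 x" "awalk x r y" by (auto simp: x_def y_def)
  have "x # map snd r = vs"
  proof -
    have x: "x = last (u # map snd q1)"
      using r(1) by (cases q1 rule: rev_cases) (auto simp: awalk_verts_conv x_def)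
    have "(u # map snd q1) @ map snd r @ map snd (drop (length vs - 1) q2) = u # map snd q"
      using q by (metis append_Cons map_append)
    also have "\<dots> = (xs @ [hd vs]) @ tl vs @ ys" using eq assms(2) by simp
    finally have *: "(u # map snd q1) @ map snd r @ map snd (drop (length vs - 1) q2)
      = (xs @ [hd vs]) @ tl vs @ ys" .
    have "length xs \<le> length q" "length vs - 1 \<le> length q - length xs"
      using len assms(2) by (cases vs; simp)+
    then have l: "length (u # map snd q1) = length (xs @ [hd vs])"
      "length (map snd r) = length (tl vs)"
      by (auto simp: q1_def r_def q2_def min_absorb2)
    from * l have "u # map snd q1 = xs @ [hd vs]" "map snd r = tl vs"
      by (metis append_eq_append_conv)+
    with x assms(2) show ?thesis by (metis last_snoc list.collapse)
  qed
  moreover have "walk_seq x r = walk_of (x # map snd r)"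
    using r(2) by (intro walk_seq_eq_walk_of) (auto simp: awalk_def)
  ultimately show ?thesis using r(2) by (metis is_walk_iff)
qed

theorem maximal_safe_node_seqs_eq:
  assumes C: "\<W> \<noteq> {}" "\<And>P. P \<in> \<W> \<Longrightarrow> is_walk G P" and s: "\<And>P. P \<in> \<W> \<Longrightarrow> hd (node_seq P) = s"
  shows "maximal_safe_node_seqs G \<W> = node_seq ` maximal_safe_walks G \<W>"
proof -
  have safe1: "safe_walk G \<W> (walk_of vs)" if "safe_node_seq G \<W> vs" "vs \<noteq> []" for vs
  proof -
    from C(1) obtain P where "P \<in> \<W>" by blast
    then have "is_walk G (walk_of vs)" using that C(2) is_walk_sublist[of P vs]
      by (auto simp: safe_node_seq_def)
    moreover have "sublist (walk_of vs) P" if "P \<in> \<W>" for P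
      using that \<open>safe_node_seq G \<W> vs\<close> \<open>vs \<noteq> []\<close> sublist_walk_of[of vs "node_seq P"]
        is_walk_eq_walk_of[OF C(2)[OF that]] by (auto simp: safe_node_seq_def)
    ultimately show ?thesis by (auto simp: safe_walk_def)
  qed
  have safe2: "safe_node_seq G \<W> (node_seq W)" if "safe_walk G \<W> W" for W
  proof -
    from that obtain u q v where W: "awalk u q v" "W = walk_seq u q"
      by (auto simp: safe_walk_def is_walk_iff)
    then have "set (node_seq W) \<subseteq> pverts G" by (auto simp: node_seq_walk_seq awalk_def)
        (metis arc_snd_in_verts snd_conv subsetD)
    then show ?thesis using that by (auto simp: safe_walk_def safe_node_seq_def sublist_node_seq)
  qed
  have ends: "X = []" "Y = []" if "is_walk G (X @ W @ Y)" "is_walk G W" "node_seq X = []" "node_seq Y = []"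
    for X W Y
  proof -
    from that(1) obtain u q v where W: "X @ W @ Y = walk_seq u q" by (auto simp: is_walk_iff)
    have h: "hd (walk_seq u q) = Node u" by (cases q) auto
    have l: "\<exists>x. last (walk_seq u q) = Node x"
      by (cases q rule: rev_cases) (auto simp: walk_seq_append)
    show "X = []"
      using that(3) h unfolding W[symmetric] by (cases X) (auto split: item.splits)
    show "Y = []"
    proof (rule ccontr)
      assume "Y \<noteq> []"
      then obtain Y' x where Y: "Y = Y' @ [x]" by (metis rev_exhaust)
      with W have "last (walk_seq u q) = x" by (metis append_assoc last_snoc)
      with l Y that(4) show False by (auto simp: node_seq_append)
    qed
  qed
  show ?thesis
  proof (intro equalityI subsetI)
    fix vs assume vs: "vs \<in> maximal_safe_node_seqs G \<W>"
    then have safe: "safe_node_seq G \<W> vs" and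
      max: "\<And>xs ys. safe_node_seq G \<W> (xs @ vs @ ys) \<Longrightarrow> xs = [] \<and> ys = []"
      by (auto simp: maximal_safe_node_seqs_def)
    have "vs \<noteq> []"
    proof
      assume "vs = []"
      have "safe_walk G \<W> [Node s]"
      proof -
        have "sublist [Node s] P \<and> s \<in> pverts G" if "P \<in> \<W>" for P
        proof -
          from C(2)[OF that] obtain u q v where "awalk u q v" "P = walk_seq u q"
            by (auto simp: is_walk_iff)
          with s[OF that] have "awalk s q v" "P = walk_seq s q" by (auto simp: node_seq_walk_seq)
          then show ?thesis by (cases q) (auto simp: awalk_def)
        qed
        then show ?thesis using C(1) by (auto simp: safe_walk_def is_walk_iff awalk_Nil_iff intro!: exI[of _ s] exI[of _ "[]"])
      qed
      from max[of "[s]" "[]"] safe2[OF this] \<open>vs = []\<close> show False by simp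
    qed
    have "walk_of vs \<in> maximal_safe_walks G \<W>"
      unfolding maximal_safe_walks_def
    proof (intro CollectI conjI allI impI)
      show "safe_walk G \<W> (walk_of vs)" using safe1 safe \<open>vs \<noteq> []\<close> by blast
      fix X Y assume a: "safe_walk G \<W> (X @ walk_of vs @ Y)"
      from safe2[OF a] have "node_seq X = []" "node_seq Y = []"
        using max by (auto simp: node_seq_append node_seq_walk_of)
      moreover have "is_walk G (walk_of vs)" using safe1[OF safe \<open>vs \<noteq> []\<close>] by (simp add: safe_walk_def)
      ultimately show "X = []" "Y = []" using ends[of X "walk_of vs" Y] a by (auto simp: safe_walk_def)
    qed
    then show "vs \<in> node_seq ` maximal_safe_walks G \<W>"
      by (metis imageI node_seq_walk_of)
  next
    fix vs assume "vs \<in> node_seq ` maximal_safe_walks G \<W>"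
    then obtain W where W: "vs = node_seq W" "safe_walk G \<W> W"
      and max: "\<And>X Y. safe_walk G \<W> (X @ W @ Y) \<Longrightarrow> X = [] \<and> Y = []"
      by (auto simp: maximal_safe_walks_def)
    have vs: "vs \<noteq> []" "W = walk_of vs"
      using W is_walk_eq_walk_of by (auto simp: safe_walk_def)
    show "vs \<in> maximal_safe_node_seqs G \<W>"
      unfolding maximal_safe_node_seqs_def
    proof (intro CollectI conjI allI impI)
      show "safe_node_seq G \<W> vs" using safe2 W by simp
      fix xs ys assume a: "safe_node_seq G \<W> (xs @ vs @ ys)"
      obtain X Y where XY: "walk_of (xs @ vs @ ys) = X @ W @ Y" using walk_of_append vs by metis
      with safe1[OF a] vs(1) max have "X = []" "Y = []" by auto
      then have "xs @ vs @ ys = vs" using XY vs by (metis append_Nil append_Nil2 node_seq_walk_of)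
      then have "length (xs @ vs @ ys) = length vs" by (rule arg_cong)
      then show "xs = []" "ys = []" by auto
    qed
  qed
qed

end


section \<open>Safe segments of a path\<close>

lemma (in pair_wf_digraph) awalk_first_exit:
  assumes "awalk u q v" "u \<in> S" "v \<notin> S"
  shows "\<exists>xs x y ys. q = xs @ (x, y) # ys \<and> awalk u xs x \<and> fst ` set xs \<subseteq> S \<and> x \<in> S \<and> y \<notin> S"
  using assms
proof (induction q arbitrary: u)
  case Nil
  then show ?case by (auto simp: awalk_Nil_iff)
next
  case (Cons e q)
  then have e: "e \<in> parcs G" "u = fst e" "awalk (snd e) q v" by (auto simp: awalk_Cons_iff)
  show ?case
  proof (cases "snd e \<in> S")
    case True
    from Cons.IH[OF e(3) this Cons.prems(3)] obtain xs x y ys where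
      *: "q = xs @ (x, y) # ys" "awalk (snd e) xs x" "fst ` set xs \<subseteq> S" "x \<in> S" "y \<notin> S" by blast
    with e Cons.prems(2) have "e # q = (e # xs) @ (x, y) # ys" "awalk u (e # xs) x"
      "fst ` set (e # xs) \<subseteq> S" by (auto simp: awalk_Cons_iff)
    with * show ?thesis by blast
  next
    case False
    have "u \<in> pverts G" using e arc_fst_in_verts by auto
    with e have "e # q = [] @ (u, snd e) # q" "awalk u [] u" by (auto simp: awalk_Nil_iff)
    with False Cons.prems(2) show ?thesis by (metis empty_subsetI image_empty list.set(1))
  qed
qed

lemma (in pair_wf_digraph) awalk_stays:
  assumes "awalk u q v" "u \<in> S" "\<And>x y. (x, y) \<in> set q \<Longrightarrow> x \<in> S \<Longrightarrow> y \<in> S"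
  shows "fst ` set q \<subseteq> S"
  using assms
proof (induction q arbitrary: u)
  case (Cons e q)
  have "snd e \<in> S" using Cons.prems by (cases e) (auto simp: awalk_Cons_iff)
  with Cons show ?case by (auto simp: awalk_Cons_iff)
qed simp

lemma sublist_pair_distinct:
  assumes "distinct (X @ x # c # Y)" "sublist [x, y] (X @ x # c # Y)"
  shows "c = y"
proof -
  define r where "r = X @ x # c # Y"
  from assms(2) obtain X' Y' where eq: "r = X' @ x # y # Y'" by (auto simp: sublist_def r_def)
  have "r ! length X = r ! length X'" by (simp add: r_def) (metis eq nth_append_length r_def)
  moreover have "length X < length r" by (simp add: r_def)
  moreover have "length X' < length r" by (simp add: eq)
  ultimately have "length X = length X'" using assms(1) nth_eq_iff_index_eq[of r "length X" "length X'"]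
    unfolding r_def by blast
  then show ?thesis using eq by (auto simp: r_def append_eq_append_conv)
qed

text \<open>
  A path \<open>p\<^sub>k, \<dots>, p\<^sub>l\<close>, and the \<^emph>\<open>detours\<close> with respect to it: a detour leaves the path at some \<open>p\<^sub>a\<close>,
  uses no arc of the path, and its inner nodes are off the path.
\<close>

locale indexed_path = pair_wf_digraph G for G :: "'v pair_pre_digraph" +
  fixes p :: "nat \<Rightarrow> 'v" and k l :: nat
  assumes k_pos: "0 < k" and k_le_l: "k \<le> l" and inj_p: "inj_on p {k..l}"
    and start_in_verts: "p k \<in> pverts G"
    and path_arc_in_arcs: "\<And>a. k \<le> a \<Longrightarrow> a < l \<Longrightarrow> (p a, p (Suc a)) \<in> parcs G"
begin

definition path_arc :: "nat \<Rightarrow> 'v \<times> 'v" where "path_arc a = (p a, p (Suc a))"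

definition path_arcs :: "('v \<times> 'v) set" where "path_arcs = path_arc ` {k..<l}"

definition off_path :: "('v \<times> 'v) set" where
  "off_path = {(u, v) \<in> parcs G - path_arcs. v \<notin> p ` {k..l}}"

definition detour_ends :: "nat \<Rightarrow> nat set" where
  "detour_ends i = {b \<in> {k..l}. \<exists>a u. k \<le> a \<and> a < i \<and> (p a, u) \<in> off_path\<^sup>* \<and>
     (u, p b) \<in> parcs G - path_arcs}"

definition detour_region :: "nat \<Rightarrow> 'v set" where
  "detour_region i = {v. \<exists>a. k \<le> a \<and> a < i \<and> (p a, v) \<in> off_path\<^sup>*}"

definition articulation :: "nat \<Rightarrow> bool" where
  "articulation i \<longleftrightarrow> (\<forall>b\<in>detour_ends i. b \<le> i)"

definition bridge :: "nat \<Rightarrow> bool" where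
  "bridge i \<longleftrightarrow> (\<forall>b\<in>detour_ends (Suc i). b \<le> i)"

definition returning :: "nat \<Rightarrow> bool" where
  "returning i \<longleftrightarrow> i \<in> detour_ends (Suc i)"

definition segment_arcs :: "nat \<Rightarrow> nat \<Rightarrow> ('v \<times> 'v) list" where
  "segment_arcs a b = map path_arc [a..<b]"

definition segment :: "nat \<Rightarrow> nat \<Rightarrow> 'v item list" where
  "segment a b = walk_seq (p a) (segment_arcs a b)"

lemma p_eq_iff: "k \<le> a \<Longrightarrow> a \<le> l \<Longrightarrow> k \<le> b \<Longrightarrow> b \<le> l \<Longrightarrow> p a = p b \<longleftrightarrow> a = b"
  using inj_p by (auto simp: inj_on_def)

lemma p_in_verts: "k \<le> a \<Longrightarrow> a \<le> l \<Longrightarrow> p a \<in> pverts G"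
proof (cases "a = k")
  case False
  assume "k \<le> a" "a \<le> l"
  with False obtain b where "a = Suc b" "k \<le> b" "b < l" by (cases a) auto
  then show ?thesis using path_arc_in_arcs in_arcsD2 by blast
qed (use start_in_verts in simp)

lemma path_arc_eq_iff: "k \<le> a \<Longrightarrow> a < l \<Longrightarrow> k \<le> b \<Longrightarrow> b < l \<Longrightarrow> path_arc a = path_arc b \<longleftrightarrow> a = b"
  by (auto simp: path_arc_def p_eq_iff)

lemma awalk_segment_arcs:
  assumes "k \<le> a" "a \<le> b" "b \<le> l" shows "awalk (p a) (segment_arcs a b) (p b)"
  using assms(2,3)
proof (induction b rule: dec_induct)
  case base
  then show ?case using assms p_in_verts by (auto simp: segment_arcs_def awalk_Nil_iff)
next
  case (step b)
  then have "awalk (p a) (segment_arcs a b) (p b)" by simp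
  moreover have "awalk (p b) [path_arc b] (p (Suc b))"
    using step assms by (auto simp: awalk_simps path_arc_def path_arc_in_arcs p_in_verts)
  ultimately have "awalk (p a) (segment_arcs a b @ [path_arc b]) (p (Suc b))"
    by (rule awalk_appendI)
  then show ?case using step by (simp add: segment_arcs_def)
qed

lemma segment_arcs_append:
  assumes "a \<le> b" "b \<le> c" shows "segment_arcs a b @ segment_arcs b c = segment_arcs a c"
proof -
  have "[a..<b] @ [b..<c] = [a..<c]" using assms upt_add_eq_append[of a b "c - b"] by simp
  then show ?thesis unfolding segment_arcs_def by (metis map_append)
qed

lemma segment_arcs_Cons: "a < b \<Longrightarrow> segment_arcs a b = path_arc a # segment_arcs (Suc a) b"
  by (simp add: segment_arcs_def upt_conv_Cons)

lemma set_segment_arcs: "set (segment_arcs a b) = path_arc ` {a..<b}"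
  by (auto simp: segment_arcs_def)

lemma map_snd_segment_arcs:
  assumes "a \<le> b" shows "p a # map snd (segment_arcs a b) = map p [a..<Suc b]"
proof -
  have "map snd (segment_arcs a b) = map p (map Suc [a..<b])"
    by (simp add: segment_arcs_def path_arc_def)
  also have "\<dots> = map p [Suc a..<Suc b]" by (simp only: map_Suc_upt)
  finally show ?thesis using assms by (simp add: upt_conv_Cons del: upt_Suc)
qed

lemma distinct_segment_arcs: "k \<le> a \<Longrightarrow> b \<le> l \<Longrightarrow> distinct (segment_arcs a b)"
  by (auto simp: segment_arcs_def distinct_map inj_on_def path_arc_eq_iff)

lemma apath_segment_arcs:
  assumes "k \<le> a" "a \<le> b" "b \<le> l" shows "apath (p a) (segment_arcs a b) (p b)"
proof -
  have w: "awalk (p a) (segment_arcs a b) (p b)" by (rule awalk_segment_arcs[OF assms])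
  then have cas: "pcas (p a) (segment_arcs a b) (p b)" by (auto simp: awalk_def)
  have "pawalk_verts (p a) (segment_arcs a b) = p a # map snd (segment_arcs a b)"
    using awalk_verts_conv'[OF cas] cas by (cases "segment_arcs a b") auto
  also have "\<dots> = map p [a..<Suc b]" using assms by (simp only: map_snd_segment_arcs)
  also have "distinct \<dots>" using assms by (auto simp: distinct_map p_eq_iff inj_on_def)
  finally show ?thesis using w by (simp add: apath_def)
qed

lemma off_path_from_path:
  assumes "(p a, p b) \<in> off_path\<^sup>*" "k \<le> b" "b \<le> l"
  shows "p a = p b"
  using assms(1) by (rule rtranclE) (use assms(2,3) in \<open>auto simp: off_path_def\<close>)

lemma path_in_detour_region: "k \<le> a \<Longrightarrow> a < i \<Longrightarrow> p a \<in> detour_region i"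
  by (auto simp: detour_region_def)

lemma path_notin_detour_region: "i \<le> b \<Longrightarrow> b \<le> l \<Longrightarrow> p b \<notin> detour_region i"
proof
  assume b: "i \<le> b" "b \<le> l" and "p b \<in> detour_region i"
  then obtain a where a: "k \<le> a" "a < i" "(p a, p b) \<in> off_path\<^sup>*" by (auto simp: detour_region_def)
  then have "p a = p b" using b by (intro off_path_from_path) auto
  then show False using a b by (simp add: p_eq_iff)
qed

lemma detour_region_exit:
  assumes "(u, v) \<in> parcs G" "u \<in> detour_region i" "v \<notin> detour_region i" "i \<le> Suc l"
  shows "(\<exists>b \<in> detour_ends i. i \<le> b \<and> v = p b) \<or> (k < i \<and> i \<le> l \<and> (u, v) = path_arc (i - 1))"
proof (cases "(u, v) \<in> path_arcs")
  case True
  then obtain a where a: "k \<le> a" "a < l" "u = p a" "v = p (Suc a)"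
    by (auto simp: path_arcs_def path_arc_def)
  have "a < i" using assms(2) path_notin_detour_region[of i a] a by (meson not_le less_imp_le_nat)
  moreover have "\<not> Suc a < i" using assms(3) path_in_detour_region[of "Suc a" i] a by auto
  ultimately have "i = Suc a" by simp
  then show ?thesis using a by (auto simp: path_arc_def)
next
  case False
  from assms(2) obtain a where a: "k \<le> a" "a < i" "(p a, u) \<in> off_path\<^sup>*"
    by (auto simp: detour_region_def)
  have "v \<in> p ` {k..l}"
  proof (rule ccontr)
    assume "v \<notin> p ` {k..l}"
    then have "(u, v) \<in> off_path" using False assms(1) by (auto simp: off_path_def)
    then have "(p a, v) \<in> off_path\<^sup>*" using a(3) by (rule rtrancl_into_rtrancl[rotated])
    then show False using a assms(3) by (auto simp: detour_region_def)
  qed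
  then obtain b where b: "k \<le> b" "b \<le> l" "v = p b" by auto
  have "b \<in> detour_ends i" using a b False assms(1) by (auto simp: detour_ends_def)
  moreover have "i \<le> b" using assms(3) b path_in_detour_region[of b i] by (meson not_le)
  ultimately show ?thesis using b by blast
qed

lemma articulation_on_walk:
  assumes "articulation i" "k \<le> i" "i \<le> l" "awalk (p k) q (p l)"
  shows "p i \<in> set (pawalk_verts (p k) q)"
proof (cases "i = k")
  case True
  then show ?thesis using assms hd_in_awalk_verts by auto
next
  case False
  then have "p k \<in> detour_region i" "p l \<notin> detour_region i"
    using assms False path_in_detour_region[of k i] path_notin_detour_region[of i l] by auto
  from awalk_first_exit[OF assms(4) this] obtain xs x y ys where
    *: "q = xs @ (x, y) # ys" "x \<in> detour_region i" "y \<notin> detour_region i" by blast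
  have "(x, y) \<in> parcs G" using * assms(4) by (auto simp: awalk_def)
  from detour_region_exit[OF this *(2,3)] assms have "y = p i"
    by (auto simp: articulation_def path_arc_def)
  moreover have "y \<in> set (pawalk_verts (p k) q)"
    using awalk_verts_arc2[OF assms(4), of "(x, y)"] * by auto
  ultimately show ?thesis by simp
qed

lemma bridge_exit:
  assumes "bridge i" "k \<le> i" "i < l" "(x, y) \<in> parcs G"
    "x \<in> detour_region (Suc i)" "y \<notin> detour_region (Suc i)"
  shows "(x, y) = path_arc i"
  using detour_region_exit[OF assms(4-6)] assms(1-3) by (auto simp: bridge_def)

lemma bridge_on_walk:
  assumes "bridge i" "k \<le> i" "i < l" "awalk (p k) q (p l)"
  shows "\<exists>xs ys. q = xs @ path_arc i # ys \<and> awalk (p k) xs (p i) \<and> fst ` set xs \<subseteq> detour_region (Suc i)"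
proof -
  have "p k \<in> detour_region (Suc i)" "p l \<notin> detour_region (Suc i)"
    using assms path_in_detour_region[of k "Suc i"] path_notin_detour_region[of "Suc i" l] by auto
  from awalk_first_exit[OF assms(4) this] obtain xs x y ys where
    *: "q = xs @ (x, y) # ys" "awalk (p k) xs x" "fst ` set xs \<subseteq> detour_region (Suc i)"
      "x \<in> detour_region (Suc i)" "y \<notin> detour_region (Suc i)" by blast
  have "(x, y) \<in> parcs G" using * assms(4) by (auto simp: awalk_def)
  from bridge_exit[OF assms(1-3) this *(4,5)] * show ?thesis by (auto simp: path_arc_def)
qed

lemma walk_ends_with_segment:
  assumes "awalk (p k) xs (p i)" "fst ` set xs \<subseteq> detour_region (Suc i)" "distinct xs"
    "k \<le> a" "a \<le> i" "i \<le> l"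
    "\<And>j. a \<le> j \<Longrightarrow> j < i \<Longrightarrow> bridge j"
    "\<And>j u. a < j \<Longrightarrow> j \<le> i \<Longrightarrow> (u, p j) \<in> set xs \<Longrightarrow> u \<in> detour_region (Suc j) \<Longrightarrow> u = p (j - 1)"
  shows "\<exists>xs'. xs = xs' @ segment_arcs a i"
  using assms(5,1-4,6-)
proof (induction i arbitrary: xs rule: dec_induct)
  case base
  then show ?case by (auto simp: segment_arcs_def)
next
  case (step i)
  have "p k \<noteq> p (Suc i)" using step by (subst p_eq_iff) auto
  with step.prems(1) have "xs \<noteq> []" by (auto simp: awalk_Nil_iff)
  then obtain ys x y where xs: "xs = ys @ [(x, y)]" by (metis rev_exhaust surj_pair)
  from step.prems(1) have y: "y = p (Suc i)" and "awalk (p k) ys x"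
    by (auto simp: xs awalk_simps)
  have "x = p i" using step.prems(7)[of "Suc i" x] step.prems(2) step.hyps y by (auto simp: xs)
  with y xs \<open>awalk (p k) ys x\<close> have xs: "xs = ys @ [path_arc i]" and ys: "awalk (p k) ys (p i)"
    by (auto simp: path_arc_def)
  have "fst ` set ys \<subseteq> detour_region (Suc i)"
  proof (rule awalk_stays[OF ys])
    show "p k \<in> detour_region (Suc i)" using step by (intro path_in_detour_region) auto
    fix u v assume uv: "(u, v) \<in> set ys" "u \<in> detour_region (Suc i)"
    then have "(u, v) \<in> parcs G" using ys by (auto simp: awalk_def)
    moreover have "(u, v) \<noteq> path_arc i" using uv step.prems(3) by (auto simp: xs)
    ultimately show "v \<in> detour_region (Suc i)"
      using bridge_exit[of i u v] step.prems step.hyps uv by auto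
  qed
  then have "\<exists>ys'. ys = ys' @ segment_arcs a i"
    using step.prems step.hyps ys by (intro step.IH) (auto simp: xs)
  then show ?case using step.hyps by (auto simp: xs segment_arcs_def)
qed

lemma segment_sublist_walk:
  assumes "awalk (p k) q (p l)" "distinct q" "k \<le> a" "a < b" "b \<le> l"
    "\<And>j. a \<le> j \<Longrightarrow> j < b \<Longrightarrow> bridge j"
    "\<And>j u. a < j \<Longrightarrow> j < b \<Longrightarrow> (u, p j) \<in> set q \<Longrightarrow> u \<in> detour_region (Suc j) \<Longrightarrow> u = p (j - 1)"
  shows "sublist (segment_arcs a b) q"
proof -
  define i where "i = b - 1"
  have i: "a \<le> i" "i < l" "b = Suc i" using assms by (auto simp: i_def)
  obtain xs ys where q: "q = xs @ path_arc i # ys" "awalk (p k) xs (p i)"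
    "fst ` set xs \<subseteq> detour_region (Suc i)"
    using bridge_on_walk[of i q] assms i by auto
  have "\<exists>xs'. xs = xs' @ segment_arcs a i"
    by (rule walk_ends_with_segment[OF q(2,3)]) (use assms i q in auto)
  then obtain xs' where "xs = xs' @ segment_arcs a i" by blast
  then have "q = xs' @ segment_arcs a b @ ys" using q i by (simp add: segment_arcs_def)
  then show ?thesis by (auto simp: sublist_def)
qed

lemma detour:
  assumes "b \<in> detour_ends i" "i \<le> Suc l"
  shows "\<exists>a u q. k \<le> a \<and> a < i \<and> apath (p a) q u \<and> set q \<subseteq> off_path \<and> (u, p b) \<in> parcs G - path_arcs"
proof -
  from assms(1) obtain a u where a: "k \<le> a" "a < i" "(p a, u) \<in> off_path\<^sup>*"
    "(u, p b) \<in> parcs G - path_arcs"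
    unfolding detour_ends_def by (elim CollectE conjE exE) (rule that)
  from a(3) have "\<exists>q. awalk (p a) q u \<and> set q \<subseteq> off_path"
  proof (induction rule: rtrancl_induct)
    case base
    show ?case using a assms by (intro exI[of _ "[]"]) (auto simp: awalk_Nil_iff p_in_verts)
  next
    case (step v w)
    then obtain q where q: "awalk (p a) q v" "set q \<subseteq> off_path" by blast
    have "awalk v [(v, w)] w"
      using step(2) by (auto simp: awalk_simps off_path_def in_arcsD2)
    from awalk_appendI[OF q(1) this] q step(2) show ?case by (intro exI[of _ "q @ [(v, w)]"]) auto
  qed
  then obtain q where "awalk (p a) q u" "set q \<subseteq> off_path" by blast
  then have "apath (p a) (awalk_to_apath q) u" "set (awalk_to_apath q) \<subseteq> off_path"
    using apath_awalk_to_apath awalk_to_apath_subset by blast+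
  then show ?thesis using a by (intro exI conjI)
qed

lemma detour_path:
  assumes "b \<in> detour_ends i" "i \<le> Suc l"
  shows "\<exists>a q. k \<le> a \<and> a < i \<and> apath (p k) q (p l) \<and>
    set q \<subseteq> path_arc ` {k..<a} \<union> off_path \<union> ((UNIV \<times> {p b}) - path_arcs) \<union> path_arc ` {b..<l}"
proof -
  obtain a u q where a: "k \<le> a" "a < i" "apath (p a) q u" "set q \<subseteq> off_path"
    "(u, p b) \<in> parcs G - path_arcs" using detour[OF assms] by (elim exE conjE) (rule that)
  have b: "k \<le> b" "b \<le> l" using assms by (auto simp: detour_ends_def)
  define r where "r = segment_arcs k a @ q @ [(u, p b)] @ segment_arcs b l"
  have "awalk (p k) r (p l)" unfolding r_def
  proof (intro awalk_appendI)
    show "awalk (p k) (segment_arcs k a) (p a)" using a assms by (intro awalk_segment_arcs) auto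
    show "awalk (p a) q u" using a by (simp add: apath_def)
    show "awalk u [(u, p b)] (p b)" using a b by (auto simp: awalk_simps p_in_verts)
    show "awalk (p b) (segment_arcs b l) (p l)" using b by (intro awalk_segment_arcs) auto
  qed
  then have "apath (p k) (awalk_to_apath r) (p l)" "set (awalk_to_apath r) \<subseteq> set r"
    by (auto simp: apath_awalk_to_apath awalk_to_apath_subset dest: awalk_to_apath_subset)
  moreover have "set r \<subseteq> path_arc ` {k..<a} \<union> off_path \<union> ((UNIV \<times> {p b}) - path_arcs) \<union> path_arc ` {b..<l}"
    using a by (auto simp: r_def set_segment_arcs)
  ultimately show ?thesis using a(1,2) by (meson subset_trans)
qed

lemma not_articulation_path:
  assumes "\<not> articulation i" "k \<le> i" "i \<le> l"
  shows "\<exists>q. apath (p k) q (p l) \<and> p i \<notin> set (pawalk_verts (p k) q)"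
proof -
  from assms(1) obtain b where b: "b \<in> detour_ends i" "i < b" by (auto simp: articulation_def not_le)
  then have "b \<le> l" by (auto simp: detour_ends_def)
  obtain a q where q: "k \<le> a" "a < i" "apath (p k) q (p l)"
    "set q \<subseteq> path_arc ` {k..<a} \<union> off_path \<union> ((UNIV \<times> {p b}) - path_arcs) \<union> path_arc ` {b..<l}"
    using detour_path[OF b(1)] assms by auto
  have "p i \<noteq> snd e" if "e \<in> set q" for e
    using subsetD[OF q(4) that] q b \<open>b \<le> l\<close> assms
    by (auto simp: off_path_def path_arc_def p_eq_iff)
  moreover have "p i \<noteq> p k" using q assms by (subst p_eq_iff) auto
  moreover have "set (pawalk_verts (p k) q) \<subseteq> insert (p k) (snd ` set q)"
  proof -
    have "pcas (p k) q (p l)" using q(3) by (auto simp: apath_def awalk_def)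
    from awalk_verts_conv'[OF this] show ?thesis by (cases q) (use \<open>pcas (p k) q (p l)\<close> in auto)
  qed
  ultimately show ?thesis using q(3) by blast
qed

lemma not_bridge_path:
  assumes "\<not> bridge i" "k \<le> i" "i < l"
  shows "\<exists>q. apath (p k) q (p l) \<and> path_arc i \<notin> set q"
proof -
  from assms(1) obtain b where b: "b \<in> detour_ends (Suc i)" "i < b" by (auto simp: bridge_def not_le)
  then have "b \<le> l" by (auto simp: detour_ends_def)
  obtain a q where q: "k \<le> a" "a < Suc i" "apath (p k) q (p l)"
    "set q \<subseteq> path_arc ` {k..<a} \<union> off_path \<union> ((UNIV \<times> {p b}) - path_arcs) \<union> path_arc ` {b..<l}"
    using detour_path[OF b(1)] assms by auto
  have "path_arc i \<in> path_arcs" using assms by (auto simp: path_arcs_def)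
  moreover have "path_arc i \<notin> path_arc ` {k..<a}" "path_arc i \<notin> path_arc ` {b..<l}"
    using q b assms \<open>b \<le> l\<close> by (auto simp: path_arc_eq_iff)
  ultimately have "path_arc i \<notin> set q" using q(4) by (auto simp: off_path_def)
  then show ?thesis using q(3) by blast
qed

lemma returning_trail:
  assumes "returning i" "bridge (i - 1)" "k < i" "i < l"
  shows "\<exists>q. trail (p k) q (p l) \<and> \<not> sublist [path_arc (i - 1), path_arc i] q"
proof -
  obtain a u q where a: "k \<le> a" "a \<le> i" "apath (p a) q u" "set q \<subseteq> off_path"
    "(u, p i) \<in> parcs G - path_arcs" 
    using detour[of i "Suc i"] assms by (auto simp: returning_def less_Suc_eq_le)
  have "a = i"
  proof (rule ccontr)
    assume "a \<noteq> i"
    have "(x, u) \<in> off_path\<^sup>*" if "awalk x q u" for x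
      using that a(4)
      by (induction q arbitrary: x) (auto simp: awalk_simps intro: converse_rtrancl_into_rtrancl)
    then have "(p a, u) \<in> off_path\<^sup>*" using a by (simp add: apath_def)
    then have "i \<in> detour_ends i" using a \<open>a \<noteq> i\<close> assms by (auto simp: detour_ends_def intro!: exI[of _ a] exI[of _ u])
    then show False using assms by (auto simp: bridge_def)
  qed
  define c where "c = q @ [(u, p i)]"
  define r where "r = segment_arcs k i @ c @ segment_arcs i l"
  have "awalk (p k) r (p l)" unfolding r_def c_def
  proof (intro awalk_appendI)
    show "awalk (p k) (segment_arcs k i) (p i)" using assms by (intro awalk_segment_arcs) auto
    show "awalk (p i) q u" using a \<open>a = i\<close> by (simp add: apath_def)
    show "awalk u [(u, p i)] (p i)" using a assms by (auto simp: awalk_simps p_in_verts)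
    show "awalk (p i) (segment_arcs i l) (p l)" using assms by (intro awalk_segment_arcs) auto
  qed
  moreover have c: "set c \<inter> path_arcs = {}" using a by (auto simp: c_def off_path_def)
  have "distinct r"
  proof -
    have "distinct q" using a(3) distinct_verts_imp_distinct by (auto simp: apath_def)
    moreover have "(u, p i) \<notin> set q" using a(4) assms by (auto simp: off_path_def)
    ultimately have "distinct c" by (simp add: c_def)
    moreover have "distinct (segment_arcs k i @ segment_arcs i l)"
    proof -
      have "segment_arcs k i @ segment_arcs i l = segment_arcs k l"
        using assms by (intro segment_arcs_append) auto
      then show ?thesis using distinct_segment_arcs[of k l] by simp
    qed
    moreover have "set (segment_arcs k i) \<subseteq> path_arcs" "set (segment_arcs i l) \<subseteq> path_arcs"
      using assms by (auto simp: set_segment_arcs path_arcs_def)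
    ultimately show ?thesis using c by (auto simp: r_def)
  qed
  moreover have "\<not> sublist [path_arc (i - 1), path_arc i] r"
  proof
    assume s: "sublist [path_arc (i - 1), path_arc i] r"
    have "[k..<i] = [k..<i-1] @ [i - 1]" using assms upt_Suc_append[of k "i - 1"] by auto
    then have 1: "segment_arcs k i = segment_arcs k (i - 1) @ [path_arc (i - 1)]"
      by (simp add: segment_arcs_def)
    obtain x c' where 2: "c = x # c'" by (cases c) (auto simp: c_def)
    have r: "r = segment_arcs k (i - 1) @ path_arc (i - 1) # x # (c' @ segment_arcs i l)"
      by (simp add: r_def 1 2)
    have "x = path_arc i" using sublist_pair_distinct s \<open>distinct r\<close> unfolding r by metis
    moreover have "path_arc i \<in> path_arcs" using assms by (auto simp: path_arcs_def)
    ultimately show False using c 2 by auto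
  qed
  ultimately show ?thesis by (auto simp: trail_def)
qed


definition candidates :: "bool \<Rightarrow> 'v item list set" where
  "candidates tr = (if tr then st_trails else st_paths) G (p k) (p l)"

definition safe_segment :: "bool \<Rightarrow> nat \<Rightarrow> nat \<Rightarrow> bool" where
  "safe_segment tr a b \<longleftrightarrow> k \<le> a \<and> a \<le> b \<and> b \<le> l \<and>
     (if a = b then articulation a
      else (\<forall>i\<in>{a..<b}. bridge i) \<and> (tr \<longrightarrow> (\<forall>i\<in>{a<..<b}. \<not> returning i)))"

lemma candidateD:
  assumes "P \<in> candidates tr"
  obtains q where "P = walk_seq (p k) q" "trail (p k) q (p l)"
    "\<not> tr \<Longrightarrow> k < l \<Longrightarrow> distinct (pawalk_verts (p k) q)"
proof -
  from assms obtain q where q: "P = walk_seq (p k) q" "trail (p k) q (p l)"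
    "\<not> tr \<Longrightarrow> distinct (pawalk_verts (p k) q) \<or>
      hd (pawalk_verts (p k) q) = last (pawalk_verts (p k) q)"
    by (cases tr) (auto simp: candidates_def st_trails_def st_paths_def Let_def)
  moreover have "hd (pawalk_verts (p k) q) \<noteq> last (pawalk_verts (p k) q)" if "k < l"
  proof -
    have "awalk (p k) q (p l)" using q(2) by (simp add: trail_def)
    then have "hd (pawalk_verts (p k) q) = p k" "last (pawalk_verts (p k) q) = p l" by auto
    moreover have "p k \<noteq> p l" using that by (subst p_eq_iff) auto
    ultimately show ?thesis by simp
  qed
  ultimately show ?thesis using that by blast
qed

lemma apath_candidate: "apath (p k) q (p l) \<Longrightarrow> walk_seq (p k) q \<in> candidates tr"
  using distinct_verts_imp_distinct
  by (auto simp: candidates_def st_trails_def st_paths_def apath_def trail_def)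

lemma segment_candidate: "segment k l \<in> candidates tr"
  unfolding segment_def using k_le_l by (intro apath_candidate apath_segment_arcs) auto

lemma is_walk_segment: "k \<le> a \<Longrightarrow> a \<le> b \<Longrightarrow> b \<le> l \<Longrightarrow> is_walk G (segment a b)"
  unfolding is_walk_iff segment_def using awalk_segment_arcs by blast

lemma sublist_segment_iff:
  assumes "awalk u q v" "k \<le> a" "a < b" "b \<le> l"
  shows "sublist (segment a b) (walk_seq u q) \<longleftrightarrow> sublist (segment_arcs a b) q"
proof
  assume "sublist (segment a b) (walk_seq u q)"
  then show "sublist (segment_arcs a b) q"
    unfolding segment_def sublist_walk_seq_iff by (auto simp: sublist_def)
next
  assume "sublist (segment_arcs a b) q"
  then obtain xs ys where q: "q = xs @ segment_arcs a b @ ys" by (auto simp: sublist_def)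
  from q assms(1) segment_arcs_Cons[OF assms(3)] have "pcas (last (u # map snd xs)) (path_arc a # segment_arcs (Suc a) b @ ys) v"
    by (cases xs rule: rev_cases) (auto simp: awalk_def awalk_verts_conv)
  then have "p a = last (u # map snd xs)" by (simp add: path_arc_def)
  then show "sublist (segment a b) (walk_seq u q)" using q by (auto simp: segment_def sublist_walk_seq_iff)
qed

lemma sublist_node_iff:
  assumes "awalk u q v"
  shows "sublist [Node x] (walk_seq u q) \<longleftrightarrow> x \<in> set (pawalk_verts u q)"
proof -
  have "pcas u q v" using assms by (auto simp: awalk_def)
  then have "set (pawalk_verts u q) = insert u (snd ` set q)"
    using awalk_verts_conv'[of u q v] by (cases q) auto
  moreover have "sublist [Node x] (walk_seq u q) \<longleftrightarrow> x \<in> insert u (snd ` set q)"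
  proof -
    have "sublist [Node x] W \<longleftrightarrow> Node x \<in> set W" for W :: "'v item list"
      by (auto simp: sublist_def in_set_conv_decomp)
    moreover have "Node x \<in> set (walk_seq u q) \<longleftrightarrow> x \<in> insert u (snd ` set q)"
      by (induction q arbitrary: u) auto
    ultimately show ?thesis by simp
  qed
  ultimately show ?thesis by simp
qed

lemma sublist_segment:
  assumes "is_walk G W" "sublist W (segment k l)"
  shows "\<exists>a b. k \<le> a \<and> a \<le> b \<and> b \<le> l \<and> W = segment a b"
proof -
  from assms obtain u q xs ys where W: "W = walk_seq u q"
    and eq: "segment_arcs k l = xs @ q @ ys" and u: "u = last (p k # map snd xs)"
    by (auto simp: is_walk_iff segment_def sublist_walk_seq_iff)
  define a b where "a = k + length xs" and "b = a + length q"
  have len: "l - k = length xs + length q + length ys"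
    using arg_cong[OF eq, of length] by (simp add: segment_arcs_def)
  then have ab: "k \<le> a" "a \<le> b" "b \<le> l" using k_le_l by (auto simp: a_def b_def)
  have split: "segment_arcs k l = segment_arcs k a @ segment_arcs a b @ segment_arcs b l"
    using ab by (simp add: segment_arcs_append)
  have "length (segment_arcs k a) = length xs" "length (segment_arcs a b) = length q"
    by (auto simp: segment_arcs_def a_def b_def)
  with eq split have xs: "xs = segment_arcs k a" and q: "q = segment_arcs a b"
    by (metis append_eq_append_conv)+
  have "u = p a"
    unfolding u xs using map_snd_segment_arcs[of k a] ab by (simp del: upt_Suc) simp
  then have "W = segment a b" by (simp add: W q segment_def)
  with ab show ?thesis by blast
qed

lemma node_seq_segment: "a \<le> b \<Longrightarrow> node_seq (segment a b) = map p [a..<Suc b]"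
  by (simp only: segment_def node_seq_walk_seq map_snd_segment_arcs)

lemma safe_segment_iff:
  assumes ab: "k \<le> a" "a \<le> b" "b \<le> l"
  shows "safe_walk G (candidates tr) (segment a b) \<longleftrightarrow> safe_segment tr a b"
proof (cases "a = b")
  case True
  have "(\<forall>P\<in>candidates tr. sublist [Node (p a)] P) \<longleftrightarrow> articulation a"
  proof
    assume *: "\<forall>P\<in>candidates tr. sublist [Node (p a)] P"
    show "articulation a"
    proof (rule ccontr)
      assume "\<not> articulation a"
      then obtain q where q: "apath (p k) q (p l)" "p a \<notin> set (pawalk_verts (p k) q)"
        using not_articulation_path[of a] ab True by auto
      then have "sublist [Node (p a)] (walk_seq (p k) q)" using * apath_candidate by blast
      then show False using q sublist_node_iff[of "p k" q "p l"] by (simp add: apath_def)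
    qed
  next
    assume art: "articulation a"
    show "\<forall>P\<in>candidates tr. sublist [Node (p a)] P"
    proof
      fix P assume "P \<in> candidates tr"
      then obtain q where q: "P = walk_seq (p k) q" "trail (p k) q (p l)" by (rule candidateD)
      then show "sublist [Node (p a)] P"
        using sublist_node_iff[of "p k" q "p l"] articulation_on_walk[OF art] ab True
        by (simp add: trail_def)
    qed
  qed
  then show ?thesis using True ab is_walk_segment[of a a]
    by (simp add: safe_walk_def safe_segment_def segment_def segment_arcs_def)
next
  case False
  then have "a < b" "k < l" using ab by auto
  show ?thesis
  proof
    assume "safe_walk G (candidates tr) (segment a b)"
    then have *: "sublist (segment a b) P" if "P \<in> candidates tr" for P
      using that by (simp add: safe_walk_def)
    have sub: "sublist (segment_arcs a b) q" if "walk_seq (p k) q \<in> candidates tr" "awalk (p k) q (p l)" for q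
      using *[OF that(1)] sublist_segment_iff[OF that(2) ab(1) \<open>a < b\<close> ab(3)] by simp
    have br: "bridge i" if i: "a \<le> i" "i < b" for i
    proof (rule ccontr)
      assume "\<not> bridge i"
      then obtain q where q: "apath (p k) q (p l)" "path_arc i \<notin> set q"
        using not_bridge_path[of i] ab i by auto
      then have "sublist (segment_arcs a b) q"
        using sub[OF apath_candidate] by (simp add: apath_def)
      then have "set (segment_arcs a b) \<subseteq> set q" by (rule set_mono_sublist)
      moreover have "path_arc i \<in> path_arc ` {a..<b}" using i by simp
      ultimately show False using q by (auto simp: set_segment_arcs)
    qed
    moreover have "\<not> returning i" if i: tr "a < i" "i < b" for i
    proof
      assume "returning i"
      moreover have "bridge (i - 1)" using br[of "i - 1"] i by auto
      ultimately obtain q where q: "trail (p k) q (p l)" "\<not> sublist [path_arc (i - 1), path_arc i] q"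
        using returning_trail[of i] ab i by auto
      then have "sublist (segment_arcs a b) q" using i(1)
        by (intro sub) (auto simp: candidates_def st_trails_def trail_def)
      moreover have "sublist [path_arc (i - 1), path_arc i] (segment_arcs a b)"
      proof -
        have "segment_arcs a b = segment_arcs a (i - 1) @ segment_arcs (i - 1) b"
          using i by (subst segment_arcs_append) auto
        also have "segment_arcs (i - 1) b = path_arc (i - 1) # path_arc i # segment_arcs (Suc i) b"
          using i by (subst segment_arcs_Cons, simp, subst segment_arcs_Cons) auto
        finally have "segment_arcs a b =
          segment_arcs a (i - 1) @ [path_arc (i - 1), path_arc i] @ segment_arcs (Suc i) b" by simp
        then show ?thesis by (auto simp: sublist_def)
      qed
      ultimately show False using q by (meson sublist_order.order_trans)
    qed
    ultimately show "safe_segment tr a b" using \<open>a < b\<close> ab by (auto simp: safe_segment_def)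
  next
    assume safe: "safe_segment tr a b"
    then have br: "\<And>i. a \<le> i \<Longrightarrow> i < b \<Longrightarrow> bridge i" and
      nr: "\<And>i. tr \<Longrightarrow> a < i \<Longrightarrow> i < b \<Longrightarrow> \<not> returning i"
      using \<open>a < b\<close> by (auto simp: safe_segment_def)
    have "sublist (segment a b) P" if "P \<in> candidates tr" for P
    proof -
      from that obtain q where q: "P = walk_seq (p k) q" "trail (p k) q (p l)"
        "\<not> tr \<Longrightarrow> distinct (pawalk_verts (p k) q)"
        using \<open>k < l\<close> by (auto elim: candidateD)
      have w: "awalk (p k) q (p l)" "distinct q" using q(2) by (auto simp: trail_def)
      have "sublist (segment_arcs a b) q"
      proof (rule segment_sublist_walk[OF w ab(1) \<open>a < b\<close> ab(3) br])
        fix j u assume j: "a < j" "j < b" "(u, p j) \<in> set q" "u \<in> detour_region (Suc j)"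
        show "u = p (j - 1)"
        proof (cases tr)
          case True
          have "(u, p j) \<in> path_arcs"
          proof (rule ccontr)
            assume "(u, p j) \<notin> path_arcs"
            then have "j \<in> detour_ends (Suc j)"
              using j w ab by (auto simp: detour_ends_def detour_region_def awalk_def)
            then show False using nr[OF True, of j] j by (auto simp: returning_def)
          qed
          then obtain i where "k \<le> i" "i < l" "u = p i" "p j = p (Suc i)"
            by (auto simp: path_arcs_def path_arc_def)
          moreover from this have "j = Suc i" using j ab by (simp add: p_eq_iff)
          ultimately show ?thesis by simp
        next
          case False
          have "bridge (j - 1)" "k \<le> j - 1" "j - 1 < l" using br[of "j - 1"] j ab by auto
          from bridge_on_walk[OF this w(1)] have "path_arc (j - 1) \<in> set q" by auto
          then have "(p (j - 1), p j) \<in> set q" using j by (simp add: path_arc_def)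
          moreover have "inj_on snd (set q)"
          proof -
            have "pcas (p k) q (p l)" using w by (auto simp: awalk_def)
            from awalk_verts_conv'[OF this] q(3)[OF False] have "distinct (map snd q)"
              by (cases q) auto
            then show ?thesis by (simp add: distinct_map)
          qed
          ultimately show ?thesis using j(3) inj_onD[of snd "set q" "(u, p j)" "(p (j - 1), p j)"] by simp
        qed
      qed auto
      then show ?thesis using sublist_segment_iff[OF w(1) ab(1) \<open>a < b\<close> ab(3)] q(1) by simp
    qed
    then show "safe_walk G (candidates tr) (segment a b)"
      using is_walk_segment[OF ab] by (auto simp: safe_walk_def)
  qed
qed

lemma safe_walk_iff:
  "safe_walk G (candidates tr) W \<longleftrightarrow> (\<exists>a b. safe_segment tr a b \<and> W = segment a b)"
proof
  assume W: "safe_walk G (candidates tr) W"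
  then have "is_walk G W" "sublist W (segment k l)"
    using segment_candidate by (auto simp: safe_walk_def)
  then obtain a b where "k \<le> a" "a \<le> b" "b \<le> l" "W = segment a b" using sublist_segment by blast
  with W safe_segment_iff show "\<exists>a b. safe_segment tr a b \<and> W = segment a b" by blast
next
  assume "\<exists>a b. safe_segment tr a b \<and> W = segment a b"
  then obtain a b where "safe_segment tr a b" "W = segment a b" by blast
  moreover from this have "k \<le> a" "a \<le> b" "b \<le> l" by (auto simp: safe_segment_def)
  ultimately show "safe_walk G (candidates tr) W" using safe_segment_iff by blast
qed

lemma articulation_if_bridge:
  assumes "bridge i" shows "articulation i"
proof -
  have "detour_ends i \<subseteq> detour_ends (Suc i)" by (force simp: detour_ends_def)
  with assms show ?thesis by (auto simp: bridge_def articulation_def)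
qed

lemma articulation_Suc_if_bridge:
  assumes "bridge i" shows "articulation (Suc i)"
  using assms by (auto simp: bridge_def articulation_def)

lemma safe_segment_mono:
  assumes "safe_segment tr a b" "a \<le> a'" "a' \<le> b'" "b' \<le> b"
  shows "safe_segment tr a' b'"
proof (cases "a' = b'")
  case False
  then show ?thesis using assms by (auto simp: safe_segment_def split: if_splits)
next
  case True
  have "articulation a'"
  proof (cases "a = b")
    case False
    then have br: "\<And>i. a \<le> i \<Longrightarrow> i < b \<Longrightarrow> bridge i" using assms by (auto simp: safe_segment_def)
    show ?thesis
    proof (cases "a' < b")
      case True
      then show ?thesis using br assms articulation_if_bridge by auto
    next
      case f: False
      then have "a' = Suc (b - 1)" "bridge (b - 1)" using False br[of "b - 1"] assms by (auto simp: safe_segment_def)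
      then show ?thesis using articulation_Suc_if_bridge by metis
    qed
  qed (use assms True in \<open>auto simp: safe_segment_def\<close>)
  then show ?thesis using True assms by (auto simp: safe_segment_def)
qed

definition maximal_segment :: "bool \<Rightarrow> nat \<Rightarrow> nat \<Rightarrow> bool" where
  "maximal_segment tr a b \<longleftrightarrow>
     safe_segment tr a b \<and> \<not> safe_segment tr (a - 1) b \<and> \<not> safe_segment tr a (Suc b)"

theorem maximal_safe_walks_eq:
  "maximal_safe_walks G (candidates tr) = {segment a b | a b. maximal_segment tr a b}"
proof (intro equalityI subsetI)
  fix W assume "W \<in> maximal_safe_walks G (candidates tr)"
  then have W: "safe_walk G (candidates tr) W"
    and max: "\<And>X Y. safe_walk G (candidates tr) (X @ W @ Y) \<Longrightarrow> X = [] \<and> Y = []"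
    by (auto simp: maximal_safe_walks_def)
  from W obtain a b where ab: "safe_segment tr a b" "W = segment a b" by (auto simp: safe_walk_iff)
  then have "a \<le> b" "k \<le> a" by (auto simp: safe_segment_def)
  have "\<not> safe_segment tr (a - 1) b"
  proof
    assume s: "safe_segment tr (a - 1) b"
    have "segment (a - 1) b = [Node (p (a - 1)), Edge (path_arc (a - 1))] @ segment a b @ []"
    proof -
      have "[a-1..<b] = (a-1) # [a..<b]"
        using \<open>a \<le> b\<close> \<open>k \<le> a\<close> k_pos by (subst upt_conv_Cons) auto
      then show ?thesis
        using \<open>k \<le> a\<close> k_pos by (simp add: segment_def segment_arcs_def path_arc_def)
    qed
    with max[of "[Node (p (a - 1)), Edge (path_arc (a - 1))]" "[]"] s ab(2) show False
      unfolding safe_walk_iff by (metis list.distinct(1))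
  qed
  moreover have "\<not> safe_segment tr a (Suc b)"
  proof
    assume s: "safe_segment tr a (Suc b)"
    have "segment a (Suc b) = [] @ segment a b @ [Edge (path_arc b), Node (p (Suc b))]"
      using \<open>a \<le> b\<close> by (simp add: segment_def segment_arcs_def walk_seq_append path_arc_def)
    with max[of "[]" "[Edge (path_arc b), Node (p (Suc b))]"] s ab(2) show False
      unfolding safe_walk_iff by (metis list.distinct(1))
  qed
  ultimately show "W \<in> {segment a b | a b. maximal_segment tr a b}"
    using ab by (auto simp: maximal_segment_def)
next
  fix W assume "W \<in> {segment a b | a b. maximal_segment tr a b}"
  then obtain a b where ab: "maximal_segment tr a b" "W = segment a b" by blast
  then have le: "k \<le> a" "a \<le> b" "b \<le> l" by (auto simp: maximal_segment_def safe_segment_def)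
  show "W \<in> maximal_safe_walks G (candidates tr)"
    unfolding maximal_safe_walks_def
  proof (intro CollectI conjI allI impI)
    show "safe_walk G (candidates tr) W" using ab by (auto simp: maximal_segment_def safe_walk_iff)
    fix X Y assume "safe_walk G (candidates tr) (X @ W @ Y)"
    then obtain a' b' where ab': "safe_segment tr a' b'" "X @ W @ Y = segment a' b'"
      by (auto simp: safe_walk_iff)
    then have le': "k \<le> a'" "a' \<le> b'" "b' \<le> l" by (auto simp: safe_segment_def)
    have "node_seq X @ map p [a..<Suc b] @ node_seq Y = map p [a'..<Suc b']"
      using ab'(2) ab(2) le le' node_seq_segment by (metis node_seq_append)
    then have "set (map p [a..<Suc b]) \<subseteq> set (map p [a'..<Suc b'])" by (metis Un_iff set_append subsetI)
    then have "p a \<in> p ` {a'..b'}" "p b \<in> p ` {a'..b'}" using le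
      unfolding set_map set_upt atLeastLessThanSuc_atLeastAtMost by auto
    then have sub: "a' \<le> a" "b \<le> b'" using le le' by (auto simp: p_eq_iff)
    have "a' = a"
    proof (rule ccontr)
      assume "a' \<noteq> a"
      then have "safe_segment tr (a - 1) b" using sub le by (intro safe_segment_mono[OF ab'(1)]) auto
      with ab show False by (simp add: maximal_segment_def)
    qed
    moreover have "b' = b"
    proof (rule ccontr)
      assume "b' \<noteq> b"
      then have "safe_segment tr a (Suc b)" using sub le by (intro safe_segment_mono[OF ab'(1)]) auto
      with ab show False by (simp add: maximal_segment_def)
    qed
    ultimately have "length (X @ W @ Y) = length W" using ab' ab by simp
    then show "X = []" "Y = []" by auto
  qed
qed

theorem maximal_safe_node_seqs_segments:
  "maximal_safe_node_seqs G (candidates tr) = {map p [a..<Suc b] | a b. maximal_segment tr a b}"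
proof -
  have "maximal_safe_node_seqs G (candidates tr) = node_seq ` maximal_safe_walks G (candidates tr)"
  proof (rule maximal_safe_node_seqs_eq)
    show "candidates tr \<noteq> {}" using segment_candidate by blast
    fix P assume "P \<in> candidates tr"
    then obtain q where "P = walk_seq (p k) q" "trail (p k) q (p l)" by (rule candidateD)
    then show "is_walk G P" "hd (node_seq P) = p k"
      by (auto simp: is_walk_iff trail_def node_seq_walk_seq)
  qed
  also have "\<dots> = {map p [a..<Suc b] | a b. maximal_segment tr a b}"
  proof -
    have "node_seq (segment a b) = map p [a..<Suc b]" if "maximal_segment tr a b" for a b
      using that by (intro node_seq_segment) (auto simp: maximal_segment_def safe_segment_def)
    then show ?thesis unfolding maximal_safe_walks_eq by (auto simp del: upt_Suc) (metis (mono_tags, lifting) image_eqI mem_Collect_eq)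
  qed
  finally show ?thesis .
qed

end


section \<open>Searching for detours\<close>

text \<open>
  Adjacency lists in arrays: an arc \<open>j\<close> is referred to by the pointer \<open>j + 1\<close>, and \<open>0\<close> is the end of the
  list. As arcs are inserted in increasing order, the pointer to the list of the arcs \<open>< j\<close> out of \<open>u\<close>
  is \<open>last_out src u j\<close>.
\<close>

primrec last_out :: "(nat \<Rightarrow> nat) \<Rightarrow> nat \<Rightarrow> nat \<Rightarrow> nat" where
  "last_out src u 0 = 0"
| "last_out src u (Suc j) = (if src j = u then Suc j else last_out src u j)"

lemma last_out_le: "last_out src u j \<le> j"
  by (induction j) auto

lemma last_out_src: "0 < last_out src u j \<Longrightarrow> src (last_out src u j - 1) = u"
  by (induction j) (auto split: if_splits)

lemma last_out_gap: "last_out src u j \<le> i \<Longrightarrow> i < j \<Longrightarrow> src i \<noteq> u"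
  by (induction j) (auto split: if_splits simp: less_Suc_eq)

text \<open>
  The path is stored with its end at index \<open>n\<close>, so that all its indices are positive and \<open>pos v = 0\<close>
  says that \<open>v\<close> is off the path; \<open>mark\<close> is nonzero on its arcs. The stamp \<open>st\<close> marks visited nodes, so that
  a second search needs no clearing.
\<close>

locale detour_search =
  fixes n m :: nat and src dst :: "nat \<Rightarrow> nat" and k :: nat and p pos mark :: "nat \<Rightarrow> nat" and st :: nat
  assumes k: "0 < k" "k \<le> n" and src_less: "\<And>j. j < m \<Longrightarrow> src j < n" and dst_less: "\<And>j. j < m \<Longrightarrow> dst j < n"
    and p_less: "\<And>a. k \<le> a \<Longrightarrow> a \<le> n \<Longrightarrow> p a < n"
    and pos_p: "\<And>a. k \<le> a \<Longrightarrow> a \<le> n \<Longrightarrow> pos (p a) = a"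
    and pos_D: "\<And>v. pos v \<noteq> 0 \<Longrightarrow> \<exists>a. k \<le> a \<and> a \<le> n \<and> v = p a"
begin

definition off :: "(nat \<times> nat) set" where
  "off = {(src j, dst j) | j. j < m \<and> mark j = 0 \<and> pos (dst j) = 0}"

definition hits :: "nat \<Rightarrow> nat set" where
  "hits i = {pos (dst j) | j a. k \<le> a \<and> a < i \<and> a \<le> n \<and> (p a, src j) \<in> off\<^sup>* \<and>
     j < m \<and> mark j = 0 \<and> pos (dst j) \<noteq> 0}"

definition max_hit :: "nat \<Rightarrow> nat \<Rightarrow> bool" where
  "max_hit i x \<longleftrightarrow> (x = 0 \<or> x \<in> hits i) \<and> (\<forall>b\<in>hits i. b \<le> x)"

definition pending :: "(nat \<Rightarrow> nat) \<Rightarrow> nat \<Rightarrow> nat \<Rightarrow> nat set" where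
  "pending Q f e = {j. j < m \<and> (src j \<notin> Q ` {..<f} \<or> (src j = Q (f - 1) \<and> j < e))}"

text \<open>
  \<open>Q\<close> is a queue of the \<open>r\<close> nodes visited so far, the first \<open>f\<close> of which have been taken out; \<open>e\<close> points to
  the unscanned arcs of the last of these. The parents \<open>par\<close> occur earlier in \<open>Q\<close>, which makes
  tracing back terminate with a path.
\<close>

definition queue_inv :: "nat \<Rightarrow> nat \<Rightarrow> nat \<Rightarrow> nat \<Rightarrow> nat \<Rightarrow> (nat \<Rightarrow> nat) \<Rightarrow> (nat \<Rightarrow> nat) \<Rightarrow> (nat \<Rightarrow> nat) \<Rightarrow> (nat \<Rightarrow> nat) \<Rightarrow> bool" where
  "queue_inv e f r i far Q vis par F \<longleftrightarrow>
     f \<le> r \<and> inj_on Q {..<r} \<and> Q ` {..<r} \<subseteq> {..<n} \<and> k - 1 \<le> i \<and> i \<le> Suc n \<and>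
     (\<forall>v. v \<in> Q ` {..<r} \<longleftrightarrow> vis v = st) \<and>
     (\<forall>a. k \<le> a \<and> a \<le> n \<longrightarrow> (p a \<in> Q ` {..<r} \<longleftrightarrow> a \<le> i)) \<and>
     (\<forall>v\<in>Q ` {..<r}. \<exists>a. k \<le> a \<and> a \<le> i \<and> a \<le> n \<and> (p a, v) \<in> off\<^sup>*) \<and>
     (0 < e \<longrightarrow> 0 < f \<and> e \<le> m \<and> src (e - 1) = Q (f - 1)) \<and>
     (\<forall>j<m. j \<notin> pending Q f e \<and> mark j = 0 \<longrightarrow>
        (if pos (dst j) = 0 then dst j \<in> Q ` {..<r} else pos (dst j) \<le> far)) \<and>
     (far = 0 \<or> far \<in> hits (Suc i)) \<and>
     (\<forall>i'. k - 1 \<le> i' \<and> i' < i \<longrightarrow> max_hit (Suc i') (F i')) \<and>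
     (\<forall>x<r. pos (Q x) = 0 \<longrightarrow> 0 < par (Q x) \<and> par (Q x) \<le> m \<and> dst (par (Q x) - 1) = Q x \<and>
        (\<exists>y<x. src (par (Q x) - 1) = Q y)) \<and>
     (n < i \<longrightarrow> e = 0 \<and> f = r)"

lemma queue_invD:
  assumes "queue_inv e f r i far Q vis par F"
  shows "f \<le> r" "inj_on Q {..<r}" "Q ` {..<r} \<subseteq> {..<n}" "k - 1 \<le> i" "i \<le> Suc n"
    "\<forall>v. v \<in> Q ` {..<r} \<longleftrightarrow> vis v = st"
    "\<forall>a. k \<le> a \<and> a \<le> n \<longrightarrow> (p a \<in> Q ` {..<r} \<longleftrightarrow> a \<le> i)"
    "\<forall>v\<in>Q ` {..<r}. \<exists>a. k \<le> a \<and> a \<le> i \<and> a \<le> n \<and> (p a, v) \<in> off\<^sup>*"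
    "0 < e \<longrightarrow> 0 < f \<and> e \<le> m \<and> src (e - 1) = Q (f - 1)"
    "\<forall>j<m. j \<notin> pending Q f e \<and> mark j = 0 \<longrightarrow>
        (if pos (dst j) = 0 then dst j \<in> Q ` {..<r} else pos (dst j) \<le> far)"
    "far = 0 \<or> far \<in> hits (Suc i)"
    "\<forall>i'. k - 1 \<le> i' \<and> i' < i \<longrightarrow> max_hit (Suc i') (F i')"
    "\<forall>x<r. pos (Q x) = 0 \<longrightarrow> 0 < par (Q x) \<and> par (Q x) \<le> m \<and> dst (par (Q x) - 1) = Q x \<and>
        (\<exists>y<x. src (par (Q x) - 1) = Q y)"
    "n < i \<longrightarrow> e = 0 \<and> f = r"
  using assms unfolding queue_inv_def by - (elim conjE, assumption)+

lemma hits_mono: "i \<le> i' \<Longrightarrow> hits i \<subseteq> hits i'"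
  by (force simp: hits_def)

lemma hits_le: "b \<in> hits i \<Longrightarrow> b \<le> n"
proof -
  assume "b \<in> hits i"
  then obtain j where "b = pos (dst j)" "pos (dst j) \<noteq> 0" by (auto simp: hits_def)
  moreover from this obtain a where "k \<le> a" "a \<le> n" "dst j = p a" using pos_D by blast
  ultimately show ?thesis using pos_p[of a] by simp
qed

lemma queue_inv_bounds:
  assumes "queue_inv e f r i far Q vis par F"
  shows "e \<le> m" "r \<le> n" "far \<le> n" "f \<le> n" "i \<le> Suc n"
proof -
  note I = queue_invD[OF assms, rule_format]
  show "e \<le> m" using I(9) by (cases "e = 0") auto
  have "card (Q ` {..<r}) \<le> card {..<n}" using I(3) by (intro card_mono) auto
  then show "r \<le> n" using I(2) by (simp add: card_image)
  then show "f \<le> n" "i \<le> Suc n" using I(1,5) by auto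
  show "far \<le> n" using I(11) hits_le[of far "Suc i"] by auto
qed

lemma queue_inv_init:
  assumes "\<And>v. vis v \<noteq> st"
  shows "queue_inv 0 0 0 (k - 1) 0 Q vis par F"
  using assms k unfolding queue_inv_def pending_def by auto

lemma queue_inv_far:
  assumes "queue_inv e f r i far Q vis par F" "far \<le> x" "x \<in> hits (Suc i)"
  shows "queue_inv e f r i x Q vis par F"
proof -
  note J = queue_invD[OF assms(1)] and I = queue_invD[OF assms(1), rule_format]
  have "if pos (dst j) = 0 then dst j \<in> Q ` {..<r} else pos (dst j) \<le> x"
    if "j < m" "j \<notin> pending Q f e" "mark j = 0" for j
    using I(10)[OF that(1) conjI[OF that(2,3)]] assms(2) by (simp split: if_splits)
  then have "\<forall>j<m. j \<notin> pending Q f e \<and> mark j = 0 \<longrightarrow>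
      (if pos (dst j) = 0 then dst j \<in> Q ` {..<r} else pos (dst j) \<le> x)" by simp
  then show ?thesis unfolding queue_inv_def using J(1-9,12-14) assms(3) by (intro conjI disjI2)
qed

lemma queue_inv_hit:
  assumes "queue_inv e f r i far Q vis par F" "0 < e" "i \<le> n" "mark (e - 1) = 0" "0 < pos (dst (e - 1))"
  shows "pos (dst (e - 1)) \<in> hits (Suc i)"
proof -
  note J = queue_invD[OF assms(1)] and I = queue_invD[OF assms(1), rule_format]
  have e: "0 < f" "e \<le> m" "src (e - 1) = Q (f - 1)" using I(9) assms(2) by simp_all
  then have "src (e - 1) \<in> Q ` {..<r}" using I(1) by simp
  from I(8)[OF this] obtain a where "k \<le> a" "a \<le> i" "a \<le> n" "(p a, src (e - 1)) \<in> off\<^sup>*" by blast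
  then show ?thesis using e(2) assms(2-) unfolding hits_def
    by (intro CollectI exI[of _ "e - 1"] exI[of _ a]) simp
qed

lemma image_upd: "Q(r := v) ` {..<Suc r} = insert v (Q ` {..<r})" for Q :: "nat \<Rightarrow> nat"
  by (auto simp: lessThan_Suc)

lemma image_upd': "f \<le> r \<Longrightarrow> Q(r := v) ` {..<f} = Q ` {..<f}" for Q :: "nat \<Rightarrow> nat"
  by (intro image_cong) auto

lemma inj_upd: "inj_on Q {..<r} \<Longrightarrow> v \<notin> Q ` {..<r} \<Longrightarrow> inj_on (Q(r := v)) {..<Suc r}" for Q :: "nat \<Rightarrow> nat"
  by (simp add: lessThan_Suc inj_on_fun_updI)

lemma pending_upd:
  assumes "f \<le> r" "0 < e \<Longrightarrow> 0 < f"
  shows "pending (Q(r := v)) f e = pending Q f e"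
proof -
  have "(Q(r := v)) (f - 1) = Q (f - 1) \<or> f = 0" using assms by auto
  then show ?thesis by (cases "f = 0") (use assms in \<open>simp_all add: pending_def image_upd'\<close>)
qed

lemma queue_inv_push:
  assumes "queue_inv e f r i far Q vis par F" "0 < e" "i \<le> n" "mark (e - 1) = 0" "pos (dst (e - 1)) = 0"
    "vis (dst (e - 1)) \<noteq> st"
  shows "queue_inv e f (Suc r) i far (Q(r := dst (e - 1))) (vis(dst (e - 1) := st)) (par(dst (e - 1) := e)) F"
proof -
  note J = queue_invD[OF assms(1)] and I = queue_invD[OF assms(1), rule_format]
  define v where "v = dst (e - 1)"
  have e: "0 < f" "e \<le> m" "src (e - 1) = Q (f - 1)" using I(9) assms(2) by simp_all
  have v: "v \<notin> Q ` {..<r}" using assms(6) I(6) by (simp add: v_def)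
  have vn: "v < n" using e(2) assms(2) dst_less[of "e - 1"] by (simp add: v_def)
  have "Q (f - 1) \<in> Q ` {..<r}" using e(1) I(1) by simp
  from I(8)[OF this] obtain a where a: "k \<le> a" "a \<le> i" "a \<le> n" "(p a, Q (f - 1)) \<in> off\<^sup>*" by blast
  have "(Q (f - 1), v) \<in> off" unfolding off_def v_def
    by (intro CollectI exI[of _ "e - 1"]) (use assms(2,4,5) e in simp)
  with a(4) have av: "(p a, v) \<in> off\<^sup>*" by (rule rtrancl_into_rtrancl)
  have pv: "p b \<noteq> v" if "k \<le> b" "b \<le> n" for b
    using pos_p[OF that] that k assms(5) by (metis less_le_not_le v_def)
  have pu: "pending (Q(r := v)) f e = pending Q f e" using e(1) I(1) by (intro pending_upd) auto
  have parx: "0 < (par(v := e)) ((Q(r := v)) x) \<and> (par(v := e)) ((Q(r := v)) x) \<le> m \<and>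
      dst ((par(v := e)) ((Q(r := v)) x) - 1) = (Q(r := v)) x \<and>
      (\<exists>y<x. src ((par(v := e)) ((Q(r := v)) x) - 1) = (Q(r := v)) y)"
    if x: "x < Suc r" "pos ((Q(r := v)) x) = 0" for x
  proof (cases "x = r")
    case True
    have "f - 1 < r" using e(1) I(1) by simp
    then have "\<exists>y<r. src (e - 1) = (Q(r := v)) y" using e(3) by (intro exI[of _ "f - 1"]) simp
    then show ?thesis using True assms(2) e(2) by (simp add: v_def)
  next
    case False
    then have xr: "x < r" "Q x \<noteq> v" using x v by auto
    with I(13)[of x] x obtain y where y: "0 < par (Q x)" "par (Q x) \<le> m" "dst (par (Q x) - 1) = Q x"
        "y < x" "src (par (Q x) - 1) = Q y" by auto
    have "y \<noteq> r" using y(4) xr by simp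
    then show ?thesis using y xr by (intro conjI exI[of _ y]) auto
  qed
  have reach: "\<exists>a. k \<le> a \<and> a \<le> i \<and> a \<le> n \<and> (p a, x) \<in> off\<^sup>*" if "x \<in> insert v (Q ` {..<r})" for x
    using that I(8) a av by blast
  have clos: "if pos (dst j) = 0 then dst j \<in> insert v (Q ` {..<r}) else pos (dst j) \<le> far"
    if "j < m" "j \<notin> pending Q f e" "mark j = 0" for j
    using I(10)[OF that(1) conjI[OF that(2,3)]] by (simp split: if_splits)
  note parx' = parx[THEN conjunct1] parx[THEN conjunct2, THEN conjunct1]
    parx[THEN conjunct2, THEN conjunct2, THEN conjunct1] parx[THEN conjunct2, THEN conjunct2, THEN conjunct2]
  show ?thesis
    unfolding queue_inv_def image_upd v_def[symmetric] pu
  proof (intro conjI allI ballI impI)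
    show "inj_on (Q(r := v)) {..<Suc r}" using I(2) v by (rule inj_upd)
    show "insert v (Q ` {..<r}) \<subseteq> {..<n}" using I(3) vn by simp
    show "x \<in> insert v (Q ` {..<r}) \<longleftrightarrow> (vis(v := st)) x = st" for x using I(6)[of x] by simp
    show "p a \<in> insert v (Q ` {..<r}) \<longleftrightarrow> a \<le> i" if "k \<le> a \<and> a \<le> n" for a
      using I(7)[of a] pv[of a] that by simp
    have "f - 1 \<noteq> r" using e(1) I(1) by simp
    then show "src (e - 1) = (Q(r := v)) (f - 1)" using e(3) by simp
    show "e = 0" "f = Suc r" if "n < i" using assms(3) that by auto
    show "f \<le> Suc r" using I(1) by simp
    show "max_hit (Suc i') (F i')" if "k - 1 \<le> i' \<and> i' < i" for i' using I(12) that by blast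
  qed (use reach clos e(1,2) I(4,5,11) in \<open>blast intro: parx'\<close>)+
qed

lemma queue_inv_advance:
  assumes "queue_inv e f r i far Q vis par F" "0 < e" "i \<le> n"
    "mark (e - 1) = 0 \<Longrightarrow> (if pos (dst (e - 1)) = 0 then vis (dst (e - 1)) = st else pos (dst (e - 1)) \<le> far)"
  shows "queue_inv (last_out src (src (e - 1)) (e - 1)) f r i far Q vis par F"
    and "card (pending Q f (last_out src (src (e - 1)) (e - 1))) < card (pending Q f e)"
proof -
  note J = queue_invD[OF assms(1)] and I = queue_invD[OF assms(1), rule_format]
  define u where "u = src (e - 1)"
  define e' where "e' = last_out src u (e - 1)"
  have e: "0 < f" "e \<le> m" "u = Q (f - 1)" using I(9) assms(2) by (simp_all add: u_def)
  have u: "u \<in> Q ` {..<f}" using e(1,3) by simp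
  have e': "e' < e" using last_out_le[of src u "e - 1"] assms(2) by (simp add: e'_def)
  have pend: "pending Q f e' = pending Q f e - {e - 1}"
  proof -
    have "src j \<noteq> u" if "e' \<le> j" "j < e" "j \<noteq> e - 1" for j
      using last_out_gap[of src u "e - 1" j] that by (auto simp: e'_def)
    then have "src j \<noteq> Q (f - 1) \<or> j < e'" if "j < e" "j \<noteq> e - 1" for j
      using that e by (metis not_le)
    moreover have "j < e" if "j < e'" for j using that e' by simp
    moreover have "\<not> e - 1 < e'" using last_out_le[of src u "e - 1"] by (simp add: e'_def)
    moreover have "src (e - 1) \<in> Q ` {..<f}" using u by (simp add: u_def)
    ultimately show ?thesis unfolding pending_def by blast
  qed
  have "e - 1 \<in> pending Q f e" using e assms(2) by (simp add: pending_def u_def)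
  moreover have "finite (pending Q f e)" by (rule finite_subset[of _ "{..<m}"]) (auto simp: pending_def)
  ultimately show "card (pending Q f (last_out src (src (e - 1)) (e - 1))) < card (pending Q f e)"
    unfolding u_def[symmetric] e'_def[symmetric] pend by (intro psubset_card_mono) auto
  have clos: "if pos (dst j) = 0 then dst j \<in> Q ` {..<r} else pos (dst j) \<le> far"
    if "j < m" "j \<notin> pending Q f e'" "mark j = 0" for j
  proof (cases "j = e - 1")
    case True
    then show ?thesis using assms(4) that(3) I(6) by (auto split: if_splits)
  next
    case False
    then show ?thesis using I(10)[of j] that unfolding pend by blast
  qed
  have ptr: "0 < f \<and> e' \<le> m \<and> src (e' - 1) = Q (f - 1)" if "0 < e'"
    using e e' last_out_src[of src u "e - 1"] that by (simp add: e'_def)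
  have "queue_inv e' f r i far Q vis par F" unfolding queue_inv_def
  proof (intro conjI)
    show "\<forall>j<m. j \<notin> pending Q f e' \<and> mark j = 0 \<longrightarrow>
      (if pos (dst j) = 0 then dst j \<in> Q ` {..<r} else pos (dst j) \<le> far)" using clos by simp
    show "0 < e' \<longrightarrow> 0 < f \<and> e' \<le> m \<and> src (e' - 1) = Q (f - 1)" using ptr by simp
    show "n < i \<longrightarrow> e' = 0 \<and> f = r" using assms(3) by simp
  qed (fact J)+
  then show "queue_inv (last_out src (src (e - 1)) (e - 1)) f r i far Q vis par F" by (simp add: e'_def u_def)
qed

lemma queue_inv_pop:
  assumes "queue_inv 0 f r i far Q vis par F" "f < r"
  shows "queue_inv (last_out src (Q f) m) (Suc f) r i far Q vis par F"
    and "card (pending Q (Suc f) (last_out src (Q f) m)) \<le> card (pending Q f 0)"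
proof -
  note J = queue_invD[OF assms(1)] and I = queue_invD[OF assms(1), rule_format]
  define e' where "e' = last_out src (Q f) m"
  have gap: "src j \<noteq> Q f" if "e' \<le> j" "j < m" for j
    using last_out_gap[of src "Q f" m j] that by (simp add: e'_def)
  have im: "Q ` {..<Suc f} = insert (Q f) (Q ` {..<f})" by (simp add: lessThan_Suc)
  have "Q f \<noteq> Q x" if "x < f" for x
    using I(2) inj_onD[of Q "{..<r}" f x] that assms(2) by auto
  then have notin: "Q f \<notin> Q ` {..<f}" by auto
  have "src j = Q f \<longrightarrow> j < e'" if "j < m" for j using gap[of j] that by (meson not_le)
  then have pend: "pending Q (Suc f) e' = pending Q f 0"
    unfolding pending_def im diff_Suc_1 using notin by (metis insert_iff not_less_zero)
  then show "card (pending Q (Suc f) (last_out src (Q f) m)) \<le> card (pending Q f 0)"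
    by (simp add: e'_def)
  have ptr: "0 < Suc f \<and> e' \<le> m \<and> src (e' - 1) = Q (Suc f - 1)" if "0 < e'"
    using last_out_le[of src "Q f" m] last_out_src[of src "Q f" m] that by (simp add: e'_def)
  have "\<not> n < i" using I(14) assms(2) by auto
  then have ni: "n < i \<longrightarrow> e' = 0 \<and> Suc f = r" by simp
  have "queue_inv e' (Suc f) r i far Q vis par F" unfolding queue_inv_def pend
  proof (intro conjI)
    show "0 < e' \<longrightarrow> 0 < Suc f \<and> e' \<le> m \<and> src (e' - 1) = Q (Suc f - 1)" using ptr by blast
    show "Suc f \<le> r" using assms(2) by simp
  qed (fact J ni)+
  then show "queue_inv (last_out src (Q f) m) (Suc f) r i far Q vis par F" by (simp add: e'_def)
qed

lemma queue_inv_closed: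
  assumes "queue_inv 0 r r i far Q vis par F"
  shows "k \<le> a \<Longrightarrow> a \<le> i \<Longrightarrow> a \<le> n \<Longrightarrow> (p a, v) \<in> off\<^sup>* \<Longrightarrow> v \<in> Q ` {..<r}"
    and "max_hit (Suc i) far"
proof -
  note J = queue_invD[OF assms(1)] and I = queue_invD[OF assms(1), rule_format]
  have cl: "if pos (dst j) = 0 then dst j \<in> Q ` {..<r} else pos (dst j) \<le> far"
    if "j < m" "mark j = 0" "src j \<in> Q ` {..<r}" for j
    using that I(10)[of j] by (auto simp: pending_def)
  have *: "v \<in> Q ` {..<r}" if "k \<le> a" "a \<le> i" "a \<le> n" "(p a, v) \<in> off\<^sup>*" for a v
    using that(4)
  proof (induction rule: rtrancl_induct)
    case base
    then show ?case using I(7)[of a] that by simp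
  next
    case (step y z)
    then obtain j where "y = src j" "z = dst j" "j < m" "mark j = 0" "pos (dst j) = 0"
      by (auto simp: off_def)
    with cl[of j] step show ?case by simp
  qed
  then show "k \<le> a \<Longrightarrow> a \<le> i \<Longrightarrow> a \<le> n \<Longrightarrow> (p a, v) \<in> off\<^sup>* \<Longrightarrow> v \<in> Q ` {..<r}" by blast
  have "b \<le> far" if "b \<in> hits (Suc i)" for b
  proof -
    from that obtain j a where "k \<le> a" "a \<le> i" "a \<le> n" "(p a, src j) \<in> off\<^sup>*" "j < m" "mark j = 0"
      "pos (dst j) \<noteq> 0" "b = pos (dst j)" unfolding hits_def less_Suc_eq_le by blast
    with cl[of j] * show ?thesis by auto
  qed
  then show "max_hit (Suc i) far" using I(11) by (auto simp: max_hit_def)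
qed

lemma queue_inv_next:
  assumes "queue_inv 0 r r i far Q vis par F" "i \<le> n"
  shows "i = n \<Longrightarrow> queue_inv 0 r r (Suc i) far Q vis par (F(i := far))"
    and "i < n \<Longrightarrow> queue_inv 0 r (Suc r) (Suc i) far (Q(r := p (Suc i))) (vis(p (Suc i) := st)) par (F(i := far))"
proof -
  note J = queue_invD[OF assms(1)] and I = queue_invD[OF assms(1), rule_format]
  have F: "max_hit (Suc i') ((F(i := far)) i')" if "k - 1 \<le> i'" "i' < Suc i" for i'
    using I(12)[of i'] queue_inv_closed(2)[OF assms(1)] that by (cases "i' = i") auto
  have far: "far = 0 \<or> far \<in> hits (Suc (Suc i))"
    using I(11) hits_mono[of "Suc i" "Suc (Suc i)"] by auto
  have k1: "k - 1 \<le> Suc i" "Suc i \<le> Suc n" using I(4) assms(2) by simp_all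
  have reach: "\<exists>a. k \<le> a \<and> a \<le> Suc i \<and> a \<le> n \<and> (p a, x) \<in> off\<^sup>*" if x: "x \<in> Q ` {..<r}" for x
    using I(8)[OF x] by (meson le_SucI)
  {
    assume "i = n"
    then have pa: "p a \<in> Q ` {..<r} \<longleftrightarrow> a \<le> Suc i" if "k \<le> a \<and> a \<le> n" for a
      using I(7)[of a] that by simp
    show "queue_inv 0 r r (Suc i) far Q vis par (F(i := far))"
      unfolding queue_inv_def
    proof (intro conjI)
      show "\<forall>a. k \<le> a \<and> a \<le> n \<longrightarrow> (p a \<in> Q ` {..<r} \<longleftrightarrow> a \<le> Suc i)" using pa by blast
      show "\<forall>v\<in>Q ` {..<r}. \<exists>a. k \<le> a \<and> a \<le> Suc i \<and> a \<le> n \<and> (p a, v) \<in> off\<^sup>*" using reach by blast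
      show "\<forall>i'. k - 1 \<le> i' \<and> i' < Suc i \<longrightarrow> max_hit (Suc i') ((F(i := far)) i')" using F by blast
      show "n < Suc i \<longrightarrow> (0 :: nat) = 0 \<and> r = r" by simp
      show "(0 :: nat) < 0 \<longrightarrow> 0 < r \<and> 0 \<le> m \<and> src (0 - 1) = Q (r - 1)" by simp
    qed (fact J k1 far)+
  }
  {
    assume "i < n"
    define v where "v = p (Suc i)"
    have ki: "k \<le> Suc i" using I(4) by simp
    have v: "v \<notin> Q ` {..<r}" using I(7)[of "Suc i"] ki \<open>i < n\<close> by (simp add: v_def)
    have vn: "v < n" using p_less[OF ki] \<open>i < n\<close> by (simp add: v_def)
    have pv: "p a = v \<longleftrightarrow> a = Suc i" if "k \<le> a" "a \<le> n" for a
      using pos_p[OF that] pos_p[of "Suc i"] ki \<open>i < n\<close> unfolding v_def by (metis Suc_leI)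
    have posv: "pos v \<noteq> 0" using pos_p[of "Suc i"] ki \<open>i < n\<close> by (simp add: v_def)
    have pu: "pending (Q(r := v)) r 0 = pending Q r 0" by (rule pending_upd) auto
    have reach': "\<exists>a. k \<le> a \<and> a \<le> Suc i \<and> a \<le> n \<and> (p a, x) \<in> off\<^sup>*" if "x \<in> insert v (Q ` {..<r})" for x
    proof (cases "x = v")
      case True
      then show ?thesis using ki \<open>i < n\<close> by (intro exI[of _ "Suc i"]) (simp add: v_def)
    next
      case False
      then show ?thesis using that reach by blast
    qed
    have parx: "0 < par ((Q(r := v)) x) \<and> par ((Q(r := v)) x) \<le> m \<and>
      dst (par ((Q(r := v)) x) - 1) = (Q(r := v)) x \<and>
      (\<exists>y<x. src (par ((Q(r := v)) x) - 1) = (Q(r := v)) y)"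
      if x: "x < Suc r" "pos ((Q(r := v)) x) = 0" for x
    proof -
      have "x \<noteq> r" using x posv by auto
      then have xr: "x < r" using x by simp
      with I(13)[of x] x \<open>x \<noteq> r\<close> obtain y where y: "0 < par (Q x)" "par (Q x) \<le> m" "dst (par (Q x) - 1) = Q x"
        "y < x" "src (par (Q x) - 1) = Q y" by auto
      have "y \<noteq> r" using y(4) xr by simp
      then show ?thesis using y xr by (intro conjI exI[of _ y]) auto
    qed
    have clos: "if pos (dst j) = 0 then dst j \<in> insert v (Q ` {..<r}) else pos (dst j) \<le> far"
      if "j < m" "j \<notin> pending Q r 0" "mark j = 0" for j
      using I(10)[OF that(1) conjI[OF that(2,3)]] by (simp split: if_splits)
    note parx' = parx[THEN conjunct1] parx[THEN conjunct2, THEN conjunct1]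
      parx[THEN conjunct2, THEN conjunct2, THEN conjunct1] parx[THEN conjunct2, THEN conjunct2, THEN conjunct2]
    show "queue_inv 0 r (Suc r) (Suc i) far (Q(r := p (Suc i))) (vis(p (Suc i) := st)) par (F(i := far))"
      unfolding queue_inv_def image_upd v_def[symmetric] pu
    proof (intro conjI allI ballI impI)
      show "inj_on (Q(r := v)) {..<Suc r}" using I(2) v by (rule inj_upd)
      show "insert v (Q ` {..<r}) \<subseteq> {..<n}" using I(3) vn by simp
      show "x \<in> insert v (Q ` {..<r}) \<longleftrightarrow> (vis(v := st)) x = st" for x using I(6)[of x] by simp
      show "p a \<in> insert v (Q ` {..<r}) \<longleftrightarrow> a \<le> Suc i" if "k \<le> a \<and> a \<le> n" for a
        using I(7)[of a] pv[of a] that by (auto simp: le_Suc_eq)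
      show "r = Suc r" if "n < Suc i" using \<open>i < n\<close> that by simp
      show "r \<le> Suc r" by simp
    qed (use k1 far F reach' clos in \<open>(simp; fail) | (blast intro: parx')\<close>)+
  }
qed

end


definition build_body :: com where
  "build_body =
     Seq (Store ''nxt'' (Var ''j'') (Arr ''head'' (Arr ''src'' (Var ''j''))))
    (Seq (Store ''head'' (Arr ''src'' (Var ''j'')) (Plus (Var ''j'') (Const 1)))
         (Assign ''j'' (Plus (Var ''j'') (Const 1))))"

definition build_prog :: com where
  "build_prog = While (Less (Var ''j'') (Var ''m'')) build_body"

lemma runs_build:
  assumes "var \<sigma> ''m'' = m" "var \<sigma> ''j'' = 0" "arr \<sigma> ''src'' = src" "arr \<sigma> ''head'' = (\<lambda>_. 0)" "m \<le> w"
  shows "runs w build_prog \<sigma> (21 * m + 4)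
    (\<lambda>\<tau>. arr \<tau> ''head'' = (\<lambda>u. last_out src u m) \<and> (\<forall>j<m. arr \<tau> ''nxt'' j = last_out src (src j) j))"
proof -
  define I where "I = (\<lambda>\<tau> :: state. var \<tau> ''m'' = m \<and> var \<tau> ''j'' \<le> m \<and> arr \<tau> ''src'' = src \<and>
    arr \<tau> ''head'' = (\<lambda>u. last_out src u (var \<tau> ''j'')) \<and>
    (\<forall>j<var \<tau> ''j''. arr \<tau> ''nxt'' j = last_out src (src j) j))"
  have "runs w build_prog \<sigma> ((1 + bcost (Less (Var ''j'') (Var ''m'')) + cost build_body) * (m - var \<sigma> ''j'')
      + 1 + bcost (Less (Var ''j'') (Var ''m'')))
    (\<lambda>\<tau>. I \<tau> \<and> \<not> bval (Less (Var ''j'') (Var ''m'')) \<tau>)"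
    unfolding build_prog_def
  proof (rule runs_While[where I = I and \<mu> = "\<lambda>\<tau>. m - var \<tau> ''j''"])
    show "I \<sigma>" using assms by (simp add: I_def)
    fix \<sigma> assume I: "I \<sigma>" and b: "bval (Less (Var ''j'') (Var ''m'')) \<sigma>"
    have "last_out src u j \<le> w" if "j \<le> m" for u j using last_out_le[of src u j] assms(5) that by simp
    then show "runs w build_body \<sigma> (cost build_body) (\<lambda>\<tau>. I \<tau> \<and> m - var \<tau> ''j'' < m - var \<sigma> ''j'')"
      using I b assms(5) by (intro runs_wp) (auto simp: build_body_def I_def less_Suc_eq)
  qed
  then show ?thesis
    by (rule runs_weaken) (use assms in \<open>auto simp: I_def build_body_def\<close>)
qed

definition edge_step :: "nat \<Rightarrow> com" where
  "edge_step st =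
     Seq (Assign ''j'' (Minus (Var ''e'') (Const 1)))
    (Seq (Assign ''v'' (Arr ''dst'' (Var ''j'')))
    (Seq (Cond (Equal (Arr ''mark'' (Var ''j'')) (Const 0))
           (Cond (Less (Const 0) (Arr ''pos'' (Var ''v'')))
             (Cond (Less (Var ''far'') (Arr ''pos'' (Var ''v'')))
               (Assign ''far'' (Arr ''pos'' (Var ''v''))) Skip)
             (Cond (Equal (Arr ''vis'' (Var ''v'')) (Const st)) Skip
               (Seq (Store ''vis'' (Var ''v'') (Const st))
               (Seq (Store ''par'' (Var ''v'') (Var ''e''))
               (Seq (Store ''Q'' (Var ''r'') (Var ''v''))
                    (Assign ''r'' (Plus (Var ''r'') (Const 1))))))))
           Skip)
         (Assign ''e'' (Arr ''nxt'' (Var ''j'')))))"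

definition pop_step :: com where
  "pop_step = Seq (Assign ''e'' (Arr ''head'' (Arr ''Q'' (Var ''f''))))
                  (Assign ''f'' (Plus (Var ''f'') (Const 1)))"

definition next_step :: "nat \<Rightarrow> com" where
  "next_step st =
     Seq (Store ''F'' (Var ''i'') (Var ''far''))
    (Seq (Assign ''i'' (Plus (Var ''i'') (Const 1)))
         (Cond (Less (Var ''n'') (Var ''i'')) Skip
           (Seq (Store ''Q'' (Var ''r'') (Arr ''p'' (Var ''i'')))
           (Seq (Store ''vis'' (Arr ''p'' (Var ''i'')) (Const st))
                (Assign ''r'' (Plus (Var ''r'') (Const 1)))))))"

definition search_body :: "nat \<Rightarrow> com" where
  "search_body st = Cond (Less (Const 0) (Var ''e'')) (edge_step st)
     (Cond (Less (Var ''f'') (Var ''r'')) pop_step (next_step st))"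

definition search_loop :: "nat \<Rightarrow> com" where
  "search_loop st = While (Less (Var ''i'') (Plus (Var ''n'') (Const 1))) (search_body st)"

definition search_prog :: "nat \<Rightarrow> com" where
  "search_prog st = Seq (Seq (Assign ''far'' (Const 0)) (Seq (Assign ''e'' (Const 0)) (Seq (Assign ''f'' (Const 0))
     (Seq (Assign ''r'' (Const 0)) (Assign ''i'' (Minus (Var ''k'') (Const 1))))))) (search_loop st)"

context detour_search
begin

definition search_inv :: "state \<Rightarrow> bool" where
  "search_inv \<tau> \<longleftrightarrow> var \<tau> ''n'' = n \<and> arr \<tau> ''dst'' = dst \<and> arr \<tau> ''mark'' = mark \<and> arr \<tau> ''pos'' = pos \<and>
     arr \<tau> ''p'' = p \<and> arr \<tau> ''head'' = (\<lambda>u. last_out src u m) \<and>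
     (\<forall>j<m. arr \<tau> ''nxt'' j = last_out src (src j) j) \<and> (\<forall>v. arr \<tau> ''vis'' v \<le> st) \<and>
     queue_inv (var \<tau> ''e'') (var \<tau> ''f'') (var \<tau> ''r'') (var \<tau> ''i'') (var \<tau> ''far'')
       (arr \<tau> ''Q'') (arr \<tau> ''vis'') (arr \<tau> ''par'') (arr \<tau> ''F'')"

definition search_measure :: "state \<Rightarrow> nat" where
  "search_measure \<tau> = card (pending (arr \<tau> ''Q'') (var \<tau> ''f'') (var \<tau> ''e'')) +
     (n - var \<tau> ''f'') + (Suc n - var \<tau> ''i'')"

lemma wp_edge_step:
  assumes I: "search_inv \<sigma>" and e: "0 < var \<sigma> ''e''" and i: "var \<sigma> ''i'' \<le> n"
    and w: "m \<le> w" "n < w" "st \<le> w"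
  shows "wp w (edge_step st) (\<lambda>\<tau>. search_inv \<tau> \<and> search_measure \<tau> < search_measure \<sigma>) \<sigma>"
proof -
  define e f r i far Q vis par F where defs: "e = var \<sigma> ''e''" "f = var \<sigma> ''f''" "r = var \<sigma> ''r''" "i = var \<sigma> ''i''"
    "far = var \<sigma> ''far''" "Q = arr \<sigma> ''Q''" "vis = arr \<sigma> ''vis''" "par = arr \<sigma> ''par''" "F = arr \<sigma> ''F''"
  have queue_inv: "queue_inv e f r i far Q vis par F" using I by (simp add: search_inv_def defs)
  have e0: "0 < e" and i_n: "i \<le> n" using e i by (simp_all add: defs)
  note J = queue_invD[OF queue_inv] and bounds = queue_inv_bounds[OF queue_inv]
  define j v where "j = e - 1" and "v = dst j"
  have j: "j < m" "e = Suc j" using bounds(1) e0 by (auto simp: j_def)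
  have v: "v < n" using dst_less[OF j(1)] by (simp add: v_def)
  have posn: "pos v \<le> n"
  proof (cases "pos v = 0")
    case False
    then obtain a where "k \<le> a" "a \<le> n" "v = p a" using pos_D by blast
    then show ?thesis using pos_p by simp
  qed simp
  have nxt: "last_out src (src j) j \<le> w" using last_out_le[of src "src j" j] j w by simp
  note adv = queue_inv_advance[OF _ e0 i_n, folded j_def, folded v_def]
  have skip: "queue_inv (last_out src (src j) j) f r i far Q vis par F \<and>
      card (pending Q f (last_out src (src j) j)) < card (pending Q f e)"
    if "mark j = 0 \<Longrightarrow> (if pos v = 0 then vis v = st else pos v \<le> far)"
    using adv[OF queue_inv] that by blast
  have hit: "queue_inv (last_out src (src j) j) f r i (pos v) Q vis par F \<and>
      card (pending Q f (last_out src (src j) j)) < card (pending Q f e)"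
    if "mark j = 0" "0 < pos v" "far < pos v"
  proof -
    have "pos v \<in> hits (Suc i)" using queue_inv_hit[OF queue_inv e0 i_n, folded j_def, folded v_def] that by blast
    then have "queue_inv e f r i (pos v) Q vis par F" using queue_inv_far[OF queue_inv] that by simp
    moreover have "if pos v = 0 then vis v = st else pos v \<le> pos v" using that by simp
    ultimately show ?thesis using adv by blast
  qed
  have push: "queue_inv (last_out src (src j) j) f (Suc r) i far (Q(r := v)) (vis(v := st)) (par(v := e)) F \<and>
      card (pending (Q(r := v)) f (last_out src (src j) j)) < card (pending Q f e)"
    if "mark j = 0" "pos v = 0" "vis v \<noteq> st"
  proof -
    have *: "queue_inv e f (Suc r) i far (Q(r := v)) (vis(v := st)) (par(v := e)) F"
      using queue_inv_push[OF queue_inv e0 i_n, folded j_def, folded v_def] that by blast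
    have "pending (Q(r := v)) f e = pending Q f e" using J(1) J(9) e0 by (intro pending_upd) auto
    moreover have "if pos v = 0 then (vis(v := st)) v = st else pos v \<le> far" using that by simp
    ultimately show ?thesis using adv[OF *] by metis
  qed
  have r: "Suc r \<le> w" using bounds w by simp
  have S: "var \<sigma> ''n'' = n" "arr \<sigma> ''dst'' = dst" "arr \<sigma> ''mark'' = mark" "arr \<sigma> ''pos'' = pos"
     "arr \<sigma> ''p'' = p" "arr \<sigma> ''head'' = (\<lambda>u. last_out src u m)"
     "\<forall>j<m. arr \<sigma> ''nxt'' j = last_out src (src j) j" "\<forall>v. arr \<sigma> ''vis'' v \<le> st" using I by (simp_all add: search_inv_def)
  have N: "arr \<sigma> ''nxt'' j = last_out src (src j) j" using S(7) j by simp
  have je: "e - Suc 0 = j" by (simp add: j_def)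
  have jw: "j \<le> w" "v \<le> w" "pos v \<le> w" "e \<le> w" using j w v posn by auto
  show ?thesis
    unfolding edge_step_def search_inv_def search_measure_def
    using skip hit push r nxt jw w(3)
    by (simp add: S(1-7) S(8)[rule_format] S(8)[unfolded defs(7)[symmetric], rule_format] N defs[symmetric] je v_def[symmetric])
qed

lemma wp_pop_step:
  assumes I: "search_inv \<sigma>" and e: "var \<sigma> ''e'' = 0" and f: "var \<sigma> ''f'' < var \<sigma> ''r''"
    and w: "m \<le> w" "n < w"
  shows "wp w pop_step (\<lambda>\<tau>. search_inv \<tau> \<and> search_measure \<tau> < search_measure \<sigma>) \<sigma>"
proof -
  have queue_inv: "queue_inv 0 (var \<sigma> ''f'') (var \<sigma> ''r'') (var \<sigma> ''i'') (var \<sigma> ''far'')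
       (arr \<sigma> ''Q'') (arr \<sigma> ''vis'') (arr \<sigma> ''par'') (arr \<sigma> ''F'')"
    using I e by (simp add: search_inv_def)
  note pop = queue_inv_pop[OF queue_inv f]
  have "last_out src (arr \<sigma> ''Q'' (var \<sigma> ''f'')) m \<le> w" "Suc (var \<sigma> ''f'') \<le> w" "var \<sigma> ''f'' < n"
    using last_out_le[of src _ m] w queue_inv_bounds[OF queue_inv] f by (auto intro: le_trans)
  then show ?thesis
    using I pop e unfolding pop_step_def search_inv_def search_measure_def by simp
qed

lemma wp_next_step:
  assumes I: "search_inv \<sigma>" and e: "var \<sigma> ''e'' = 0" and f: "\<not> var \<sigma> ''f'' < var \<sigma> ''r''"
    and i: "var \<sigma> ''i'' \<le> n" and w: "m \<le> w" "n < w" "st \<le> w"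
  shows "wp w (next_step st) (\<lambda>\<tau>. search_inv \<tau> \<and> search_measure \<tau> < search_measure \<sigma>) \<sigma>"
proof -
  have "queue_inv (var \<sigma> ''e'') (var \<sigma> ''f'') (var \<sigma> ''r'') (var \<sigma> ''i'') (var \<sigma> ''far'')
       (arr \<sigma> ''Q'') (arr \<sigma> ''vis'') (arr \<sigma> ''par'') (arr \<sigma> ''F'')"
    using I by (simp add: search_inv_def)
  then have fr: "var \<sigma> ''f'' = var \<sigma> ''r''" and queue_inv: "queue_inv 0 (var \<sigma> ''r'') (var \<sigma> ''r'') (var \<sigma> ''i'') (var \<sigma> ''far'')
       (arr \<sigma> ''Q'') (arr \<sigma> ''vis'') (arr \<sigma> ''par'') (arr \<sigma> ''F'')"
    using queue_invD(1) e f by fastforce+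
  note next1 = queue_inv_next(1)[OF queue_inv i] and next2 = queue_inv_next(2)[OF queue_inv i]
  have ki: "k \<le> Suc (var \<sigma> ''i'')" using queue_invD(4)[OF queue_inv] by simp
  have b: "Suc (var \<sigma> ''i'') \<le> w" "var \<sigma> ''far'' \<le> w" using queue_inv_bounds[OF queue_inv] w i by auto
  have "Suc (var \<sigma> ''r'') \<le> w" "p (Suc (var \<sigma> ''i'')) \<le> w" if "var \<sigma> ''i'' < n"
    using queue_inv_bounds[OF queue_inv] w p_less[OF ki] that by auto
  moreover have "pending ((arr \<sigma> ''Q'')(var \<sigma> ''r'' := v)) (var \<sigma> ''r'') 0 = pending (arr \<sigma> ''Q'') (var \<sigma> ''r'') 0" for v
    by (rule pending_upd) auto
  moreover have "var \<sigma> ''i'' = n \<or> var \<sigma> ''i'' < n" using i by auto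
  ultimately show ?thesis
    using I next1 next2 e b w(3) i unfolding next_step_def search_inv_def search_measure_def by (auto simp: fr)
qed

lemma runs_search:
  assumes "var \<sigma> ''n'' = n" "arr \<sigma> ''dst'' = dst" "arr \<sigma> ''mark'' = mark" "arr \<sigma> ''pos'' = pos"
     "arr \<sigma> ''p'' = p" "var \<sigma> ''k'' = k" "arr \<sigma> ''head'' = (\<lambda>u. last_out src u m)"
     "\<forall>j<m. arr \<sigma> ''nxt'' j = last_out src (src j) j" "\<And>v. arr \<sigma> ''vis'' v < st"
    and w: "m \<le> w" "n < w" "st \<le> w"
  shows "runs w (search_prog st) \<sigma> (100 * (m + 2 * n + 2))
    (\<lambda>\<tau>. (\<exists>r far. queue_inv 0 r r (Suc n) far (arr \<tau> ''Q'') (arr \<tau> ''vis'') (arr \<tau> ''par'') (arr \<tau> ''F'')) \<and> (\<forall>v. arr \<tau> ''vis'' v \<le> st))"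
proof -
  let ?b = "Less (Var ''i'') (Plus (Var ''n'') (Const 1))"
  let ?R = "\<lambda>\<tau>. (\<exists>r far. queue_inv 0 r r (Suc n) far (arr \<tau> ''Q'') (arr \<tau> ''vis'') (arr \<tau> ''par'') (arr \<tau> ''F'')) \<and>
    (\<forall>v. arr \<tau> ''vis'' v \<le> st)"
  let ?c = "1 + bcost ?b + cost (search_body st)"
  have loop: "runs w (search_loop st) \<sigma>' (?c * (m + 2 * n + 1) + 1 + bcost ?b) ?R" if I: "search_inv \<sigma>'" for \<sigma>'
  proof -
    have "runs w (search_loop st) \<sigma>' (?c * search_measure \<sigma>' + 1 + bcost ?b) (\<lambda>\<tau>. search_inv \<tau> \<and> \<not> bval ?b \<tau>)"
      unfolding search_loop_def
    proof (rule runs_While[where I = search_inv and \<mu> = search_measure])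
      fix \<sigma> assume I: "search_inv \<sigma>" and b: "bval ?b \<sigma>"
      then have i: "var \<sigma> ''i'' \<le> n" by (simp add: search_inv_def)
      show "runs w (search_body st) \<sigma> (cost (search_body st)) (\<lambda>\<tau>. search_inv \<tau> \<and> search_measure \<tau> < search_measure \<sigma>)"
        using wp_edge_step[OF I _ i w] wp_pop_step[OF I _ _ w(1,2)] wp_next_step[OF I _ _ i w]
        by (intro runs_wp) (simp add: search_body_def)
    qed (rule I)
    then show ?thesis
    proof (rule runs_weaken)
      have "card (pending (arr \<sigma>' ''Q'') (var \<sigma>' ''f'') (var \<sigma>' ''e'')) \<le> card {..<m}"
        by (intro card_mono) (auto simp: pending_def)
      then have "search_measure \<sigma>' \<le> m + 2 * n + 1" by (simp add: search_measure_def)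
      then show "?c * search_measure \<sigma>' + 1 + bcost ?b \<le> ?c * (m + 2 * n + 1) + 1 + bcost ?b"
        by (intro add_mono mult_le_mono) auto
      fix \<tau> assume t: "search_inv \<tau> \<and> \<not> bval ?b \<tau>"
      then have queue_inv: "queue_inv (var \<tau> ''e'') (var \<tau> ''f'') (var \<tau> ''r'') (var \<tau> ''i'') (var \<tau> ''far'')
        (arr \<tau> ''Q'') (arr \<tau> ''vis'') (arr \<tau> ''par'') (arr \<tau> ''F'')" and n: "n < var \<tau> ''i''"
        by (simp_all add: search_inv_def)
      from queue_invD(14)[OF queue_inv] queue_invD(5)[OF queue_inv] n
      have "var \<tau> ''e'' = 0" "var \<tau> ''f'' = var \<tau> ''r''" "var \<tau> ''i'' = Suc n" by auto
      moreover have "\<forall>v. arr \<tau> ''vis'' v \<le> st" using t by (simp add: search_inv_def)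
      ultimately show "?R \<tau>" using queue_inv by auto
    qed
  qed
  have "wp w (Seq (Assign ''far'' (Const 0)) (Seq (Assign ''e'' (Const 0)) (Seq (Assign ''f'' (Const 0))
     (Seq (Assign ''r'' (Const 0)) (Assign ''i'' (Minus (Var ''k'') (Const 1))))))) search_inv \<sigma>"
    using assms(1-8) assms(9)[THEN less_imp_le] k w queue_inv_init[of "arr \<sigma> ''vis''"] assms(9)[THEN less_imp_neq]
    by (simp add: search_inv_def)
  from runs_Seq[OF runs_wp[OF this] loop]
  show ?thesis unfolding search_prog_def
    by (rule runs_weaken) (auto simp: search_body_def edge_step_def pop_step_def next_step_def)
qed

end

definition trace_body :: com where
  "trace_body =
     Seq (Assign ''j'' (Minus (Arr ''par'' (Var ''v'')) (Const 1)))
    (Seq (Store ''mark'' (Var ''j'') (Const 1))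
    (Seq (Assign ''v'' (Arr ''src'' (Var ''j'')))
    (Seq (Assign ''k'' (Minus (Var ''k'') (Const 1)))
    (Seq (Store ''p'' (Var ''k'') (Var ''v''))
    (Seq (Store ''pos'' (Var ''v'') (Var ''k''))
         (Store ''pe'' (Var ''k'') (Var ''j'')))))))"

definition trace_prog :: com where
  "trace_prog =
     Seq (Seq (Assign ''k'' (Var ''n'')) (Seq (Assign ''v'' (Var ''t''))
         (Seq (Store ''p'' (Var ''n'') (Var ''t'')) (Store ''pos'' (Var ''t'') (Var ''n'')))))
         (While (Neg (Equal (Var ''v'') (Var ''s''))) trace_body)"

definition traced :: "nat \<Rightarrow> nat \<Rightarrow> (nat \<Rightarrow> nat) \<Rightarrow> (nat \<Rightarrow> nat) \<Rightarrow> nat \<Rightarrow> nat \<Rightarrow> nat \<Rightarrow>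
    (nat \<Rightarrow> nat) \<Rightarrow> (nat \<Rightarrow> nat) \<Rightarrow> (nat \<Rightarrow> nat) \<Rightarrow> (nat \<Rightarrow> nat) \<Rightarrow> bool" where
  "traced n m src dst s t k p pos pe mark \<longleftrightarrow>
     0 < k \<and> k \<le> n \<and> p n = t \<and>
     (\<forall>a\<in>{k..n}. p a < n \<and> pos (p a) = a) \<and>
     (\<forall>a\<in>{k..<n}. pe a < m \<and> src (pe a) = p a \<and> dst (pe a) = p (Suc a)) \<and>
     (\<forall>v. pos v \<noteq> 0 \<longrightarrow> v = s \<or> v \<in> p ` {k..n}) \<and>
     (\<forall>j. mark j \<noteq> 0 \<longleftrightarrow> j \<in> pe ` {k..<n})"

lemma runs_trace:
  fixes idx :: "nat \<Rightarrow> nat"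
  assumes s: "var \<sigma> ''n'' = n" "var \<sigma> ''s'' = s" "var \<sigma> ''t'' = t" "arr \<sigma> ''src'' = src"
    "arr \<sigma> ''par'' = par" "arr \<sigma> ''mark'' = (\<lambda>_. 0)" "\<And>v. arr \<sigma> ''pos'' v \<noteq> 0 \<Longrightarrow> v = s"
    and t: "t \<in> V" and V: "V \<subseteq> {..<n}" and n: "0 < n"
    and par: "\<And>v. v \<in> V \<Longrightarrow> v \<noteq> s \<Longrightarrow> 0 < par v \<and> par v \<le> m \<and> dst (par v - 1) = v \<and>
        src (par v - 1) \<in> V \<and> idx (src (par v - 1)) < idx v"
    and w: "m \<le> w" "n < w"
  shows "runs w trace_prog \<sigma> (30 * n + 20)
    (\<lambda>\<tau>. traced n m src dst s t (var \<tau> ''k'') (arr \<tau> ''p'') (arr \<tau> ''pos'') (arr \<tau> ''pe'') (arr \<tau> ''mark'') \<and>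
       arr \<tau> ''p'' (var \<tau> ''k'') = s)"
proof -
  let ?b = "Neg (Equal (Var ''v'') (Var ''s''))"
  define I where "I = (\<lambda>\<tau> :: state. var \<tau> ''n'' = n \<and> var \<tau> ''s'' = s \<and> arr \<tau> ''src'' = src \<and>
    arr \<tau> ''par'' = par \<and> arr \<tau> ''p'' (var \<tau> ''k'') = var \<tau> ''v'' \<and>
    traced n m src dst s t (var \<tau> ''k'') (arr \<tau> ''p'') (arr \<tau> ''pos'') (arr \<tau> ''pe'') (arr \<tau> ''mark'') \<and>
    var \<tau> ''v'' \<in> V \<and> (\<forall>a\<in>{var \<tau> ''k''..n}. idx (var \<tau> ''v'') \<le> idx (arr \<tau> ''p'' a)))"
  have step: "wp w trace_body (\<lambda>\<tau>. I \<tau> \<and> var \<tau> ''k'' < var \<sigma> ''k'') \<sigma>" if I: "I \<sigma>" and b: "bval ?b \<sigma>" for \<sigma>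
  proof -
    define k p v pos pe mark where defs: "k = var \<sigma> ''k''" "p = arr \<sigma> ''p''" "v = var \<sigma> ''v''"
      "pos = arr \<sigma> ''pos''" "pe = arr \<sigma> ''pe''" "mark = arr \<sigma> ''mark''"
    define j u where "j = par v - 1" and "u = src j"
    have S: "var \<sigma> ''n'' = n" "var \<sigma> ''s'' = s" "arr \<sigma> ''src'' = src" "arr \<sigma> ''par'' = par"
      using I by (simp_all add: I_def)
    have pk: "p k = v" and vV: "v \<in> V" and idx: "\<forall>a\<in>{k..n}. idx v \<le> idx (p a)"
      and tr: "traced n m src dst s t k p pos pe mark" using I by (simp_all add: I_def defs)
    have "v \<noteq> s" using b S by (simp add: defs)
    from par[OF vV this] have par': "j < m" "dst j = v" "u \<in> V" "idx u < idx v"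
      by (auto simp: j_def u_def)
    have k: "0 < k" "k \<le> n" "p n = t" and p: "\<And>a. a \<in> {k..n} \<Longrightarrow> p a < n \<and> pos (p a) = a"
      using tr by (auto simp: traced_def)
    have up: "u \<noteq> p a" if "a \<in> {k..n}" for a using idx par'(4) that by fastforce
    have un: "u < n" using par'(3) V by auto
    have "card (insert u (p ` {k..n})) \<le> card {..<n}" using p un by (intro card_mono) auto
    moreover have "inj_on p {k..n}" by (metis inj_onI p)
    moreover have "u \<notin> p ` {k..n}" using up by blast
    ultimately have "Suc (Suc n - k) \<le> n" by (simp add: card_image)
    then have k2: "2 \<le> k" using k by simp
    define k' where "k' = k - 1"
    have kk: "k = Suc k'" "0 < k'" using k2 by (auto simp: k'_def)
    have sets: "{k'..n} = insert k' {k..n}" "{k'..<n} = insert k' {k..<n}" using kk k by auto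
    have upd: "(p(k' := u)) a = p a" if "a \<in> {k..n}" for a using that kk by auto
    have "traced n m src dst s t k' (p(k' := u)) (pos(u := k')) (pe(k' := j)) (mark(j := 1))"
      unfolding traced_def
    proof (intro conjI)
      show "0 < k'" "k' \<le> n" using kk k by auto
      show "(p(k' := u)) n = t" using kk k by auto
      show "\<forall>a\<in>{k'..n}. (p(k' := u)) a < n \<and> (pos(u := k')) ((p(k' := u)) a) = a"
        unfolding sets
      proof
        fix a assume "a \<in> insert k' {k..n}"
        then show "(p(k' := u)) a < n \<and> (pos(u := k')) ((p(k' := u)) a) = a"
          using p[of a] up[of a] un upd[of a] by (cases "a = k'") auto
      qed
      show "\<forall>a\<in>{k'..<n}. (pe(k' := j)) a < m \<and> src ((pe(k' := j)) a) = (p(k' := u)) a \<and>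
          dst ((pe(k' := j)) a) = (p(k' := u)) (Suc a)"
        unfolding sets using tr kk par' pk by (auto simp: traced_def u_def)
      show "\<forall>v. (pos(u := k')) v \<noteq> 0 \<longrightarrow> v = s \<or> v \<in> (p(k' := u)) ` {k'..n}"
      proof (intro allI impI)
        fix x assume "(pos(u := k')) x \<noteq> 0"
        then have "x = u \<or> pos x \<noteq> 0" by (auto split: if_splits)
        then have "x = u \<or> x = s \<or> x \<in> p ` {k..n}" using tr by (auto simp: traced_def)
        moreover have "p ` {k..n} \<subseteq> (p(k' := u)) ` {k'..n}" unfolding sets using upd by force
        moreover have "u \<in> (p(k' := u)) ` {k'..n}" unfolding sets by simp
        ultimately show "x = s \<or> x \<in> (p(k' := u)) ` {k'..n}" by blast
      qed
      have "(pe(k' := j)) ` {k..<n} = pe ` {k..<n}" using kk by (intro image_cong) auto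
      then have "(pe(k' := j)) ` {k'..<n} = insert j (pe ` {k..<n})"
        unfolding sets image_insert fun_upd_same by (rule arg_cong)
      then show "\<forall>x. (mark(j := 1)) x \<noteq> 0 \<longleftrightarrow> x \<in> (pe(k' := j)) ` {k'..<n}"
        using tr by (auto simp: traced_def)
    qed
    moreover have "\<forall>a\<in>{k'..n}. idx u \<le> idx ((p(k' := u)) a)"
      unfolding sets using upd idx par'(4) by fastforce
    moreover have "par v - Suc 0 = j" "k - Suc 0 = k'" by (simp_all add: j_def k'_def)
    moreover have "j \<le> w" "u \<le> w" "k' \<le> w" "1 \<le> w" "k' < k" using par' un w kk k by auto
    ultimately show ?thesis using S par'(3)
      by (simp add: trace_body_def I_def defs[symmetric] u_def[symmetric])
  qed
  have loop: "runs w (While ?b trace_body) \<sigma>' (30 * n + 10)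
    (\<lambda>\<tau>. I \<tau> \<and> \<not> bval ?b \<tau>)" if "I \<sigma>'" for \<sigma>'
  proof -
    have "runs w (While ?b trace_body) \<sigma>' ((1 + bcost ?b + cost trace_body) * var \<sigma>' ''k'' + 1 + bcost ?b)
      (\<lambda>\<tau>. I \<tau> \<and> \<not> bval ?b \<tau>)"
      using that by (rule runs_While) (rule runs_wp, rule step)
    moreover have "var \<sigma>' ''k'' \<le> n" using that by (simp add: I_def traced_def)
    ultimately show ?thesis by (elim runs_weaken) (auto simp: trace_body_def)
  qed
  have tn: "t < n" using t V by auto
  have "wp w (Seq (Assign ''k'' (Var ''n'')) (Seq (Assign ''v'' (Var ''t''))
         (Seq (Store ''p'' (Var ''n'') (Var ''t'')) (Store ''pos'' (Var ''t'') (Var ''n''))))) I \<sigma>"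
    using s t n tn w by (auto simp: I_def traced_def)
  from runs_Seq[OF runs_wp[OF this] loop]
  show ?thesis unfolding trace_prog_def
    by (rule runs_weaken) (auto simp: I_def)
qed


section \<open>Writing the maximal safe segments\<close>

text \<open>The words \<open>ws\<close> have been completed, and \<open>cur\<close> is the beginning of the next one.\<close>

definition emitted :: "(nat \<Rightarrow> nat) \<Rightarrow> (nat \<Rightarrow> nat) \<Rightarrow> nat \<Rightarrow> nat \<Rightarrow> nat list list \<Rightarrow> nat list \<Rightarrow> bool" where
  "emitted off out c q ws cur \<longleftrightarrow> length ws = c \<and> off 0 = 0 \<and> off c \<le> q \<and> map out [off c..<q] = cur \<and>
     (\<forall>x<c. off (Suc x) \<le> q \<and> map out [off x..<off (Suc x)] = ws ! x)"

lemma emitted_append: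
  assumes "emitted off out c q ws cur"
  shows "emitted off (out(q := x)) c (Suc q) ws (cur @ [x])"
proof -
  have "map (out(q := x)) [a..<b] = map out [a..<b]" if "b \<le> q" for a b using that by auto
  then show ?thesis using assms by (auto simp: emitted_def)
qed

lemma emitted_close:
  assumes "emitted off out c q ws cur"
  shows "emitted (off(Suc c := q)) out (Suc c) q (ws @ [cur]) []"
  using assms by (auto simp: emitted_def nth_append less_Suc_eq)

lemma output_words_emitted:
  assumes "emitted (arr \<sigma> ''off'') (arr \<sigma> ''out'') (var \<sigma> ''count'') q ws cur"
  shows "output_words \<sigma> = ws"
  using assms by (intro nth_equalityI) (auto simp: output_words_def emitted_def)

definition close_word :: com where
  "close_word = Seq (Assign ''count'' (Plus (Var ''count'') (Const 1))) (Store ''off'' (Var ''count'') (Var ''o''))"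

definition write_out :: "aexp \<Rightarrow> com" where
  "write_out e = Seq (Store ''out'' (Var ''o'') e) (Assign ''o'' (Plus (Var ''o'') (Const 1)))"

text \<open>\<open>link\<close> says whether the arc into \<open>p\<^sub>i\<close> is a bridge; then \<open>p\<^sub>i\<close> has already been written.\<close>

definition emit_step :: "bool \<Rightarrow> bool \<Rightarrow> com" where
  "emit_step tr nd =
     Seq (Cond (Less (Var ''i'') (Arr ''F'' (Minus (Var ''i'') (Const 1)))) Skip
       (Seq (Cond (Equal (Var ''link'') (Const 0)) (write_out (Arr ''p'' (Var ''i''))) Skip)
         (Cond (Conj (Less (Var ''i'') (Var ''n'')) (Neg (Less (Var ''i'') (Arr ''F'' (Var ''i'')))))
           (Seq (if tr then Cond (Conj (Equal (Var ''link'') (Const 1)) (Equal (Arr ''F'' (Var ''i'')) (Var ''i'')))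
                              (Seq close_word (write_out (Arr ''p'' (Var ''i'')))) Skip
                 else Skip)
           (Seq (if nd then Skip else write_out (Arr ''pe'' (Var ''i'')))
           (Seq (write_out (Arr ''p'' (Plus (Var ''i'') (Const 1))))
                (Assign ''link'' (Const 1)))))
           (Seq close_word (Assign ''link'' (Const 0))))))
     (Assign ''i'' (Plus (Var ''i'') (Const 1)))"

definition emit_prog :: "bool \<Rightarrow> bool \<Rightarrow> com" where
  "emit_prog tr nd = Seq (Assign ''i'' (Var ''k''))
     (While (Less (Var ''i'') (Plus (Var ''n'') (Const 1))) (emit_step tr nd))"

definition segment_word :: "bool \<Rightarrow> (nat \<Rightarrow> nat) \<Rightarrow> (nat \<Rightarrow> nat) \<Rightarrow> nat \<Rightarrow> nat \<Rightarrow> nat list" where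
  "segment_word nd p pe a b = p a # concat (map (\<lambda>i. if nd then [p (Suc i)] else [pe i, p (Suc i)]) [a..<b])"

lemma segment_word_refl: "segment_word nd p pe a a = [p a]"
  by (simp add: segment_word_def)

lemma segment_word_Suc: "a \<le> b \<Longrightarrow>
  segment_word nd p pe a (Suc b) = segment_word nd p pe a b @ (if nd then [p (Suc b)] else [pe b, p (Suc b)])"
  by (simp add: segment_word_def)

lemma last_segment_word: "a \<le> b \<Longrightarrow> last (segment_word nd p pe a b) = p b"
proof (cases b)
  case (Suc c)
  assume "a \<le> b"
  then have "a = b \<or> a \<le> c" using Suc by auto
  then show ?thesis using Suc by (auto simp: segment_word_refl segment_word_Suc)
qed (simp add: segment_word_refl)

locale emission = indexed_path G p k n for G :: "nat pair_pre_digraph" and p :: "nat \<Rightarrow> nat" and k n :: nat +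
  fixes F pe :: "nat \<Rightarrow> nat" and tr nd :: bool
  assumes F_articulation: "\<And>i. k \<le> i \<Longrightarrow> i \<le> n \<Longrightarrow> articulation i \<longleftrightarrow> F (i - 1) \<le> i"
    and F_bridge: "\<And>i. k \<le> i \<Longrightarrow> i < n \<Longrightarrow> bridge i \<longleftrightarrow> F i \<le> i"
    and F_returning: "\<And>i. k \<le> i \<Longrightarrow> i < n \<Longrightarrow> bridge i \<Longrightarrow> returning i \<longleftrightarrow> F i = i"
begin

definition progress :: "nat \<Rightarrow> nat \<Rightarrow> (nat \<times> nat) list \<Rightarrow> nat list \<Rightarrow> bool" where
  "progress i link ivs cur \<longleftrightarrow> k \<le> i \<and> i \<le> Suc n \<and> set ivs = {(a, b). maximal_segment tr a b \<and> b < i} \<and>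
     distinct (map snd ivs) \<and>
     (link = 0 \<and> cur = [] \<and> (k < i \<longrightarrow> i \<le> n \<longrightarrow> \<not> bridge (i - 1)) \<or>
      link = 1 \<and> k < i \<and> i \<le> n \<and> bridge (i - 1) \<and>
        (\<exists>a<i. safe_segment tr a i \<and> \<not> safe_segment tr (a - 1) i \<and> cur = segment_word nd p pe a i))"

lemma progress_init: "progress k 0 [] []"
  using k_le_l by (auto simp: progress_def maximal_segment_def safe_segment_def)

lemma maximal_segment_le: "maximal_segment tr a b \<Longrightarrow> k \<le> a \<and> a \<le> b \<and> b \<le> n"
  by (auto simp: maximal_segment_def safe_segment_def)

lemma maximal_segment_unique:
  assumes "maximal_segment tr a b" "maximal_segment tr a' b" shows "a = a'"
proof -
  have "\<not> a < a'" if "maximal_segment tr a b" "maximal_segment tr a' b" for a a'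
  proof
    assume "a < a'"
    have "safe_segment tr a b" "\<not> safe_segment tr (a' - 1) b" "a' \<le> b"
      using that maximal_segment_le[OF that(2)] unfolding maximal_segment_def by blast+
    moreover have "safe_segment tr (a' - 1) b" if "safe_segment tr a b" "a' \<le> b"
      by (rule safe_segment_mono[OF that(1)]) (use \<open>a < a'\<close> that(2) in auto)
    ultimately show False by blast
  qed
  with assms show ?thesis by (meson linorder_neqE_nat)
qed

lemma progress_close_set:
  assumes "set ivs = {(a, b). maximal_segment tr a b \<and> b < i}" "distinct (map snd ivs)" "maximal_segment tr a i"
  shows "set (ivs @ [(a, i)]) = {(a, b). maximal_segment tr a b \<and> b < Suc i}" "distinct (map snd (ivs @ [(a, i)]))"
  using assms maximal_segment_unique by (auto simp: less_Suc_eq)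

lemma progress_skip_set:
  assumes "set ivs = {(a, b). maximal_segment tr a b \<and> b < i}" "\<And>a. \<not> maximal_segment tr a i"
  shows "set ivs = {(a, b). maximal_segment tr a b \<and> b < Suc i}"
  using assms by (auto simp: less_Suc_eq)

lemma progress_not_articulation:
  assumes P: "progress i link ivs cur" and i: "i \<le> n" and "\<not> articulation i"
  shows "progress (Suc i) link ivs cur"
proof -
  have nb: "\<not> bridge i" using articulation_if_bridge assms(3) by blast
  have l: "link = 0" "cur = []" using P assms(3) articulation_Suc_if_bridge[of "i - 1"]
    by (auto simp: progress_def)
  have "\<not> maximal_segment tr a i" for a
    using assms(3) safe_segment_mono[of tr a i i i] by (auto simp: maximal_segment_def safe_segment_def)
  then have "set ivs = {(a, b). maximal_segment tr a b \<and> b < Suc i}"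
    using P progress_skip_set[of ivs i] unfolding progress_def by blast
  then show ?thesis using P i nb l unfolding progress_def by auto
qed

lemma progress_open:
  assumes P: "progress i link ivs cur" and i: "i \<le> n" and "articulation i"
  shows "\<exists>a\<le>i. safe_segment tr a i \<and> \<not> safe_segment tr (a - 1) i \<and>
    (if link = 0 then cur @ [p i] else cur) = segment_word nd p pe a i \<and> (link = 0 \<longrightarrow> a = i) \<and> (link = 1 \<longrightarrow> a < i)"
proof (cases "link = 0")
  case True
  then have c: "cur = []" "k < i \<longrightarrow> \<not> bridge (i - 1)" and k: "k \<le> i" using P i by (auto simp: progress_def)
  have "\<not> safe_segment tr (i - 1) i"
  proof
    assume "safe_segment tr (i - 1) i"
    then have "k \<le> i - 1" "bridge (i - 1)" using k k_pos by (auto simp: safe_segment_def split: if_splits)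
    then show False using c k_pos by auto
  qed
  moreover have "safe_segment tr i i" using assms k by (simp add: safe_segment_def)
  ultimately show ?thesis using True c by (intro exI[of _ i]) (simp add: segment_word_refl)
next
  case False
  then have l: "link = 1" using P by (auto simp: progress_def)
  then obtain a where "a < i" "safe_segment tr a i" "\<not> safe_segment tr (a - 1) i" "cur = segment_word nd p pe a i"
    using P unfolding progress_def by auto
  then show ?thesis using l by (intro exI[of _ a]) auto
qed

lemma progress_end:
  assumes P: "progress i link ivs cur" and i: "i \<le> n" and "articulation i" and nb: "\<not> (i < n \<and> bridge i)"
  shows "\<exists>a\<le>i. (if link = 0 then cur @ [p i] else cur) = segment_word nd p pe a i \<and>
    progress (Suc i) 0 (ivs @ [(a, i)]) []"
proof -
  obtain a where a: "a \<le> i" "safe_segment tr a i" "\<not> safe_segment tr (a - 1) i"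
    "(if link = 0 then cur @ [p i] else cur) = segment_word nd p pe a i"
    using progress_open[OF assms(1-3)] by blast
  have "\<not> safe_segment tr a (Suc i)" using nb a by (auto simp: safe_segment_def)
  then have "maximal_segment tr a i" using a by (simp add: maximal_segment_def)
  moreover have "set ivs = {(a, b). maximal_segment tr a b \<and> b < i}" "distinct (map snd ivs)" "k \<le> i"
    using P by (simp_all add: progress_def)
  ultimately have "progress (Suc i) 0 (ivs @ [(a, i)]) []"
    using progress_close_set[of ivs i a] i nb unfolding progress_def by auto
  with a show ?thesis by blast
qed

lemma progress_continue:
  assumes P: "progress i link ivs cur" and i: "i < n" and b: "bridge i"
    and nr: "\<not> (tr \<and> link = 1 \<and> returning i)"
  shows "progress (Suc i) 1 ivs ((if link = 0 then cur @ [p i] else cur) @ (if nd then [p (Suc i)] else [pe i, p (Suc i)]))"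
proof -
  have art: "articulation i" using articulation_if_bridge b by blast
  obtain a where a: "a \<le> i" "safe_segment tr a i" "\<not> safe_segment tr (a - 1) i"
    "(if link = 0 then cur @ [p i] else cur) = segment_word nd p pe a i" "link = 0 \<longrightarrow> a = i" "link = 1 \<longrightarrow> a < i"
    using progress_open[OF P less_imp_le[OF i] art] by blast
  have link: "link = 0 \<or> link = 1" and ki: "k \<le> i" using P by (auto simp: progress_def)
  have safe: "safe_segment tr a (Suc i)"
    using a b i nr link by (auto simp: safe_segment_def less_Suc_eq split: if_splits)
  have nsafe: "\<not> safe_segment tr (a - 1) (Suc i)"
  proof
    assume "safe_segment tr (a - 1) (Suc i)"
    then have "safe_segment tr (a - 1) i" by (rule safe_segment_mono) (use a(1) in auto)
    then show False using a(3) by blast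
  qed
  have "\<not> maximal_segment tr c i" for c
  proof
    assume m: "maximal_segment tr c i"
    then have c: "safe_segment tr c i" "\<not> safe_segment tr (c - 1) i" "\<not> safe_segment tr c (Suc i)"
      by (auto simp: maximal_segment_def)
    have "\<not> c < a"
    proof
      assume "c < a"
      then have "safe_segment tr (a - 1) i" by (intro safe_segment_mono[OF c(1)]) (use a(1) in auto)
      then show False using a(3) by blast
    qed
    moreover have "c \<le> i" using maximal_segment_le[OF m] by simp
    ultimately have "safe_segment tr c (Suc i)" using safe_segment_mono[OF safe, of c "Suc i"] by simp
    with c show False by blast
  qed
  then have "set ivs = {(a, b). maximal_segment tr a b \<and> b < Suc i}"
    using P progress_skip_set[of ivs i] unfolding progress_def by blast
  moreover have "\<exists>a<Suc i. safe_segment tr a (Suc i) \<and> \<not> safe_segment tr (a - 1) (Suc i) \<and>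
      segment_word nd p pe a' (Suc i) = segment_word nd p pe a (Suc i)" if "a' = a" for a'
    using a(1) safe nsafe that by (intro exI[of _ a]) simp
  ultimately show ?thesis
    using P i b ki unfolding progress_def a(4) segment_word_Suc[OF a(1), symmetric] by simp
qed

lemma progress_restart:
  assumes P: "progress i link ivs cur" and i: "i < n" and b: "bridge i"
    and r: "tr" "link = 1" "returning i"
  shows "\<exists>a\<le>i. cur = segment_word nd p pe a i \<and>
    progress (Suc i) 1 (ivs @ [(a, i)]) (p i # (if nd then [p (Suc i)] else [pe i, p (Suc i)]))"
proof -
  have art: "articulation i" using articulation_if_bridge b by blast
  obtain a where a: "a < i" "safe_segment tr a i" "\<not> safe_segment tr (a - 1) i" "cur = segment_word nd p pe a i"
    using P r(2) unfolding progress_def by auto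
  have ki: "k < i" using P r(2) unfolding progress_def by auto
  have "\<not> safe_segment tr c (Suc i)" if "c < i" for c
    using that r(1,3) by (auto simp: safe_segment_def)
  then have ns: "\<not> safe_segment tr a (Suc i)" "\<not> safe_segment tr (i - 1) (Suc i)" using a ki by auto
  then have "maximal_segment tr a i" using a by (simp add: maximal_segment_def)
  moreover have "set ivs = {(a, b). maximal_segment tr a b \<and> b < i}" "distinct (map snd ivs)"
    using P by (simp_all add: progress_def)
  ultimately have close: "set (ivs @ [(a, i)]) = {(a, b). maximal_segment tr a b \<and> b < Suc i}"
    "distinct (map snd (ivs @ [(a, i)]))"
    using progress_close_set[of ivs i a] by blast+
  have "safe_segment tr i (Suc i)" using i b ki by (auto simp: safe_segment_def)
  moreover have "p i # (if nd then [p (Suc i)] else [pe i, p (Suc i)]) = segment_word nd p pe i (Suc i)"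
    by (simp add: segment_word_def)
  ultimately have "\<exists>a<Suc i. safe_segment tr a (Suc i) \<and> \<not> safe_segment tr (a - 1) (Suc i) \<and>
      p i # (if nd then [p (Suc i)] else [pe i, p (Suc i)]) = segment_word nd p pe a (Suc i)"
    using ns(2) by (intro exI[of _ i]) simp
  then have "progress (Suc i) 1 (ivs @ [(a, i)]) (p i # (if nd then [p (Suc i)] else [pe i, p (Suc i)]))"
    using close i b ki unfolding progress_def by (simp del: set_append map_append)
  then show ?thesis using a(1,4) less_imp_le by blast
qed

definition output_ok :: "nat \<Rightarrow> nat \<Rightarrow> nat \<Rightarrow> nat \<Rightarrow> (nat \<Rightarrow> nat) \<Rightarrow> (nat \<Rightarrow> nat) \<Rightarrow> bool" where
  "output_ok i link c q out off \<longleftrightarrow> (\<exists>ivs cur. progress i link ivs cur \<and>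
     emitted off out c q (map (\<lambda>(a, b). segment_word nd p pe a b) ivs) cur)"

definition emit_inv :: "state \<Rightarrow> bool" where
  "emit_inv \<tau> \<longleftrightarrow> var \<tau> ''n'' = n \<and> arr \<tau> ''F'' = F \<and> arr \<tau> ''p'' = p \<and> arr \<tau> ''pe'' = pe \<and>
     var \<tau> ''o'' \<le> 3 * var \<tau> ''i'' \<and> var \<tau> ''count'' \<le> var \<tau> ''i'' \<and>
     output_ok (var \<tau> ''i'') (var \<tau> ''link'') (var \<tau> ''count'') (var \<tau> ''o'') (arr \<tau> ''out'') (arr \<tau> ''off'')"

lemma wp_emit_step:
  assumes I: "emit_inv \<sigma>" and i: "var \<sigma> ''i'' \<le> n" and w: "3 * n + 3 \<le> w"
    "\<And>a. k \<le> a \<Longrightarrow> a \<le> n \<Longrightarrow> p a \<le> w" "\<And>a. k \<le> a \<Longrightarrow> a < n \<Longrightarrow> pe a \<le> w"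
  shows "wp w (emit_step tr nd) (\<lambda>\<tau>. emit_inv \<tau> \<and> Suc n - var \<tau> ''i'' < Suc n - var \<sigma> ''i'') \<sigma>"
proof -
  define i link c q out off where defs: "i = var \<sigma> ''i''" "link = var \<sigma> ''link''" "c = var \<sigma> ''count''"
    "q = var \<sigma> ''o''" "out = arr \<sigma> ''out''" "off = arr \<sigma> ''off''"
  have S: "var \<sigma> ''n'' = n" "arr \<sigma> ''F'' = F" "arr \<sigma> ''p'' = p" "arr \<sigma> ''pe'' = pe" "q \<le> 3 * i" "c \<le> i"
    using I by (simp_all add: emit_inv_def defs)
  obtain ivs cur where P: "progress i link ivs cur"
    and E: "emitted off out c q (map (\<lambda>(a, b). segment_word nd p pe a b) ivs) cur"
    using I by (auto simp: emit_inv_def output_ok_def defs)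
  have ii: "k \<le> i" "i \<le> n" using P i by (auto simp: progress_def defs)
  have link: "link = 0 \<or> link = 1" using P by (auto simp: progress_def)
  define out1 q1 cur1 where "out1 = (if link = 0 then out(q := p i) else out)"
    and "q1 = (if link = 0 then Suc q else q)" and "cur1 = (if link = 0 then cur @ [p i] else cur)"
  have E1: "emitted off out1 c q1 (map (\<lambda>(a, b). segment_word nd p pe a b) ivs) cur1"
    using E emitted_append[OF E] by (simp add: out1_def q1_def cur1_def)
  define ext where "ext = (\<lambda>f x. if nd then f(x := p (Suc i)) else f(x := pe i, Suc x := p (Suc i)))"
  define len where "len = (if nd then 1 else 2 :: nat)"
  have ext: "emitted off' (ext f x) c' (x + len) ws (cur' @ (if nd then [p (Suc i)] else [pe i, p (Suc i)]))"
    if "emitted off' f c' x ws cur'" for off' f c' x ws cur'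
    using emitted_append[OF that, of "p (Suc i)"] emitted_append[OF emitted_append[OF that, of "pe i"], of "p (Suc i)"]
    by (auto simp: ext_def len_def)
  have art: "articulation i \<longleftrightarrow> \<not> i < F (i - Suc 0)" using F_articulation[OF ii] by auto
  have br: "bridge i \<longleftrightarrow> \<not> i < F i" if "i < n" using F_bridge[OF ii(1) that] by auto
  have g1: "output_ok (Suc i) link c q out off" if h: "i < F (i - Suc 0)"
    using progress_not_articulation[OF P ii(2)] E h art unfolding output_ok_def by blast
  have g2: "output_ok (Suc i) 0 (Suc c) q1 out1 (off(Suc c := q1))" if h: "\<not> i < F (i - Suc 0)" "i < n \<longrightarrow> i < F i"
  proof -
    obtain a where "cur1 = segment_word nd p pe a i" "progress (Suc i) 0 (ivs @ [(a, i)]) []"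
      using progress_end[OF P ii(2)] h art br unfolding cur1_def by blast
    moreover from this emitted_close[OF E1] have "emitted (off(Suc c := q1)) out1 (Suc c) q1
      (map (\<lambda>(a, b). segment_word nd p pe a b) (ivs @ [(a, i)])) []" by simp
    ultimately show ?thesis unfolding output_ok_def by blast
  qed
  have g3: "output_ok (Suc i) (Suc 0) c (q1 + len) (ext out1 q1) off"
    if h: "i < n" "\<not> i < F i" "\<not> (tr \<and> link = Suc 0 \<and> F i = i)"
  proof -
    have "progress (Suc i) 1 ivs (cur1 @ (if nd then [p (Suc i)] else [pe i, p (Suc i)]))"
      unfolding cur1_def using progress_continue[OF P h(1)] br F_returning[OF ii(1)] h by auto
    with ext[OF E1] show ?thesis unfolding output_ok_def by auto
  qed
  have g4: "output_ok (Suc i) (Suc 0) (Suc c) (Suc q + len) (ext (out(q := p i)) (Suc q)) (off(Suc c := q))"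
    if h: "i < n" "\<not> i < F i" tr "link = Suc 0" "F i = i"
  proof -
    have "bridge i" "returning i" "link = 1" using br F_returning[OF ii(1)] h by auto
    then obtain a where a: "cur = segment_word nd p pe a i"
      "progress (Suc i) 1 (ivs @ [(a, i)]) (p i # (if nd then [p (Suc i)] else [pe i, p (Suc i)]))"
      using progress_restart[OF P h(1) _ h(3)] by blast
    have "emitted (off(Suc c := q)) out (Suc c) q (map (\<lambda>(a, b). segment_word nd p pe a b) (ivs @ [(a, i)])) []"
      using emitted_close[OF E] a(1) by simp
    from ext[OF emitted_append[OF this, of "p i"]] a(2) show ?thesis
      unfolding output_ok_def by (intro exI[of _ "ivs @ [(a, i)]"] exI conjI) auto
  qed
  have bounds: "Suc (Suc (Suc q)) \<le> w" "Suc i \<le> w" "Suc c \<le> w" "1 \<le> w" using S(5,6) ii w(1) by auto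
  have len: "q1 + len \<le> 3 * i + 3" "Suc q + len \<le> 3 * i + 3" "q1 \<le> 3 * i + 3" "q1 \<le> w"
    using S(5) bounds by (auto simp: q1_def len_def)
  have pw: "p i \<le> w" "i < n \<Longrightarrow> p (Suc i) \<le> w" "i < n \<Longrightarrow> pe i \<le> w"
    using w(2)[of i] w(2)[of "Suc i"] w(3)[of i] ii by auto
  have pr: "n - i < Suc n - i" using ii by simp
  show ?thesis
    using link
  proof
    assume l: "link = 0"
    note g = g1[unfolded l] g2[unfolded q1_def out1_def, unfolded l, simplified]
      g3[unfolded q1_def out1_def ext_def len_def, unfolded l, simplified]
    show ?thesis
      using g bounds pr pw S l ii
      unfolding emit_step_def close_word_def write_out_def emit_inv_def
      by (cases nd; cases tr) (auto simp: defs[symmetric])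
  next
    assume l: "link = 1"
    note g = g1[unfolded l] g2[unfolded q1_def out1_def, unfolded l, simplified]
      g3[unfolded q1_def out1_def ext_def len_def, unfolded l, simplified]
      g4[unfolded q1_def out1_def ext_def len_def, unfolded l, simplified]
    show ?thesis
      using g bounds pr pw S l ii
      unfolding emit_step_def close_word_def write_out_def emit_inv_def
      by (cases nd; cases tr) (auto simp: defs[symmetric])
  qed
qed

lemma runs_emit:
  assumes s: "var \<sigma> ''n'' = n" "var \<sigma> ''k'' = k" "arr \<sigma> ''F'' = F" "arr \<sigma> ''p'' = p" "arr \<sigma> ''pe'' = pe"
    "var \<sigma> ''link'' = 0" "var \<sigma> ''count'' = 0" "var \<sigma> ''o'' = 0" "arr \<sigma> ''off'' = (\<lambda>_. 0)"
    and w: "3 * n + 3 \<le> w"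
    "\<And>a. k \<le> a \<Longrightarrow> a \<le> n \<Longrightarrow> p a \<le> w" "\<And>a. k \<le> a \<Longrightarrow> a < n \<Longrightarrow> pe a \<le> w"
  shows "runs w (emit_prog tr nd) \<sigma> (100 * n + 110) (\<lambda>\<tau>. \<exists>ivs. set ivs = {(a, b). maximal_segment tr a b} \<and>
    distinct (map snd ivs) \<and> output_words \<tau> = map (\<lambda>(a, b). segment_word nd p pe a b) ivs)"
proof -
  let ?b = "Less (Var ''i'') (Plus (Var ''n'') (Const 1))"
  let ?Q = "\<lambda>\<tau>. \<exists>ivs. set ivs = {(a, b). maximal_segment tr a b} \<and>
    distinct (map snd ivs) \<and> output_words \<tau> = map (\<lambda>(a, b). segment_word nd p pe a b) ivs"
  have loop: "runs w (While ?b (emit_step tr nd)) \<sigma>' (100 * (n + 1) + 6) ?Q" if I: "emit_inv \<sigma>'" for \<sigma>'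
  proof -
    have "runs w (While ?b (emit_step tr nd)) \<sigma>'
      ((1 + bcost ?b + cost (emit_step tr nd)) * (Suc n - var \<sigma>' ''i'') + 1 + bcost ?b) (\<lambda>\<tau>. emit_inv \<tau> \<and> \<not> bval ?b \<tau>)"
    proof (rule runs_While[where I = emit_inv and \<mu> = "\<lambda>\<tau>. Suc n - var \<tau> ''i''"])
      fix \<sigma> assume "emit_inv \<sigma>" "bval ?b \<sigma>"
      then show "runs w (emit_step tr nd) \<sigma> (cost (emit_step tr nd))
          (\<lambda>\<tau>. emit_inv \<tau> \<and> Suc n - var \<tau> ''i'' < Suc n - var \<sigma> ''i'')"
        using w by (intro runs_wp wp_emit_step) (auto simp: emit_inv_def)
    qed (rule I)
    then show ?thesis
    proof (rule runs_weaken)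
      have "1 + bcost ?b + cost (emit_step tr nd) \<le> 100"
        by (simp add: emit_step_def close_word_def write_out_def)
      then have "(1 + bcost ?b + cost (emit_step tr nd)) * (Suc n - var \<sigma>' ''i'') \<le> 100 * (n + 1)"
        by (rule mult_le_mono) simp
      then show "(1 + bcost ?b + cost (emit_step tr nd)) * (Suc n - var \<sigma>' ''i'') + 1 + bcost ?b \<le> 100 * (n + 1) + 6"
        by simp
      fix \<tau> assume t: "emit_inv \<tau> \<and> \<not> bval ?b \<tau>"
      then obtain ivs cur where P: "progress (var \<tau> ''i'') (var \<tau> ''link'') ivs cur"
        and E: "emitted (arr \<tau> ''off'') (arr \<tau> ''out'') (var \<tau> ''count'') (var \<tau> ''o'')
          (map (\<lambda>(a, b). segment_word nd p pe a b) ivs) cur"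
        by (auto simp: emit_inv_def output_ok_def)
      have "n < var \<tau> ''i''" using t by (simp add: emit_inv_def)
      then have "set ivs = {(a, b). maximal_segment tr a b}" "distinct (map snd ivs)"
        using P maximal_segment_le unfolding progress_def by fastforce+
      then show "?Q \<tau>" using output_words_emitted[OF E] by blast
    qed
  qed
  have "output_ok k 0 0 0 (arr \<sigma> ''out'') (\<lambda>_. 0)"
    unfolding output_ok_def using progress_init by (intro exI[of _ "[]"]) (simp add: emitted_def)
  then have "wp w (Assign ''i'' (Var ''k'')) emit_inv \<sigma>"
    using s w(1) k_le_l by (simp add: emit_inv_def)
  from runs_Seq[OF runs_wp[OF this] loop] show ?thesis
    unfolding emit_prog_def by (rule runs_weaken) auto
qed

end


section \<open>The complete program\<close>

definition edge_src :: "(nat \<times> nat) list \<Rightarrow> nat \<Rightarrow> nat" where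
  "edge_src es i = (if i < length es then fst (es ! i) else 0)"

definition edge_dst :: "(nat \<times> nat) list \<Rightarrow> nat \<Rightarrow> nat" where
  "edge_dst es i = (if i < length es then snd (es ! i) else 0)"

lemma edge_pair: "j < length es \<Longrightarrow> (edge_src es j, edge_dst es j) = es ! j"
  by (simp add: edge_src_def edge_dst_def)

definition init_prog :: com where
  "init_prog = Seq (Assign ''k'' (Var ''n''))
     (Seq (Store ''p'' (Var ''n'') (Var ''s'')) (Store ''pos'' (Var ''s'') (Var ''n'')))"

text \<open>
  The first search starts from the one-node path \<open>s\<close>, so that it visits everything reachable from \<open>s\<close>.
\<close>

definition list_safe :: "bool \<Rightarrow> bool \<Rightarrow> com" where
  "list_safe tr nd = Seq build_prog (Seq init_prog (Seq (search_prog 1)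
     (Cond (Equal (Arr ''vis'' (Var ''t'')) (Const 1))
       (Seq trace_prog (Seq (search_prog 2) (emit_prog tr nd))) Skip)))"

locale listed_digraph = pair_fin_digraph G for G :: "nat pair_pre_digraph" +
  fixes n :: nat and es :: "(nat \<times> nat) list" and s t :: nat
  assumes rep: "represents n es G" and s: "s \<in> pverts G" and t: "t \<in> pverts G"
begin

abbreviation "m \<equiv> length es"
abbreviation "src \<equiv> edge_src es"
abbreviation "dst \<equiv> edge_dst es"

lemma verts_eq: "pverts G = {..<n}" and distinct_es: "distinct es" and set_es: "set es = parcs G"
  using rep by (auto simp: represents_def)

lemma card_arcs: "card (parcs G) = m"
  using distinct_card[OF distinct_es] by (simp add: set_es)

lemma s_less: "s < n" and t_less: "t < n"
  using s t by (auto simp: verts_eq)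

lemma edge_less: "j < m \<Longrightarrow> src j < n" "j < m \<Longrightarrow> dst j < n"
  using in_arcsD1 in_arcsD2 nth_mem[of j es] edge_pair[of j es] unfolding set_es verts_eq
  by (metis lessThan_iff)+

lemma arc_index: "(u, v) \<in> parcs G \<longleftrightarrow> (\<exists>j<m. src j = u \<and> dst j = v)"
  unfolding set_es[symmetric] in_set_conv_nth
  by (metis edge_pair prod.inject)

lemma index_unique: "i < m \<Longrightarrow> j < m \<Longrightarrow> src i = src j \<Longrightarrow> dst i = dst j \<Longrightarrow> i = j"
  using distinct_es edge_pair[of i es] edge_pair[of j es] by (metis nth_eq_iff_index_eq)

lemma traced_indexed_path:
  assumes tr: "traced n m src dst s t k p pos pe mark" and pk: "p k = s"
  shows "indexed_path G p k n"
proof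
  show "0 < k" "k \<le> n" using tr by (auto simp: traced_def)
  show "inj_on p {k..n}" using tr unfolding traced_def by (metis inj_onI)
  show "p k \<in> pverts G" using pk s by simp
  show "(p a, p (Suc a)) \<in> parcs G" if "k \<le> a" "a < n" for a
    using tr that by (auto simp: traced_def arc_index)
qed

lemma traced_detour_search:
  assumes tr: "traced n m src dst s t k p pos pe mark" and pk: "p k = s"
  shows "detour_search n m src dst k p pos"
proof
  show "0 < k" "k \<le> n" using tr by (auto simp: traced_def)
  show "src j < n" "dst j < n" if "j < m" for j using edge_less that by auto
  show "p a < n" "pos (p a) = a" if "k \<le> a" "a \<le> n" for a using tr that by (auto simp: traced_def)
  show "\<exists>a\<ge>k. a \<le> n \<and> v = p a" if "pos v \<noteq> 0" for v
  proof -
    have "v = s \<or> v \<in> p ` {k..n}" using tr that by (auto simp: traced_def)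
    moreover have "k \<le> n" using tr by (simp add: traced_def)
    ultimately show ?thesis using pk by auto
  qed
qed

lemma traced_hits:
  assumes tr: "traced n m src dst s t k p pos pe mark" and pk: "p k = s" and i: "i \<le> Suc n"
  shows "detour_search.hits n m src dst k p pos mark i = indexed_path.detour_ends G p k n i"
proof -
  interpret P: indexed_path G p k n by (rule traced_indexed_path[OF tr pk])
  interpret D: detour_search n m src dst k p pos mark 2 by (rule traced_detour_search[OF tr pk])
  have pe: "pe a < m" "src (pe a) = p a" "dst (pe a) = p (Suc a)" if "k \<le> a" "a < n" for a
    using tr that by (auto simp: traced_def)
  have mark: "mark j \<noteq> 0 \<longleftrightarrow> (src j, dst j) \<in> P.path_arcs" if "j < m" for j
  proof -
    have "mark j \<noteq> 0 \<longleftrightarrow> (\<exists>a. k \<le> a \<and> a < n \<and> j = pe a)" using tr by (auto simp: traced_def)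
    also have "\<dots> \<longleftrightarrow> (\<exists>a. k \<le> a \<and> a < n \<and> src j = p a \<and> dst j = p (Suc a))"
      using pe index_unique[OF that] by metis
    also have "\<dots> \<longleftrightarrow> (src j, dst j) \<in> P.path_arcs"
      by (auto simp: P.path_arcs_def P.path_arc_def image_iff)
    finally show ?thesis .
  qed
  have pos: "pos v = 0 \<longleftrightarrow> v \<notin> p ` {k..n}" for v
  proof
    assume "pos v = 0"
    then show "v \<notin> p ` {k..n}" using D.pos_p P.k_pos by fastforce
  next
    assume "v \<notin> p ` {k..n}"
    then show "pos v = 0" using D.pos_D by fastforce
  qed
  have off: "D.off = P.off_path"
  proof (intro equalityI subrelI)
    fix u v assume "(u, v) \<in> D.off"
    then obtain j where "j < m" "mark j = 0" "pos (dst j) = 0" "u = src j" "v = dst j"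
      unfolding D.off_def by blast
    then show "(u, v) \<in> P.off_path" using mark[of j] pos[of v] by (auto simp: P.off_path_def arc_index)
  next
    fix u v assume "(u, v) \<in> P.off_path"
    then have uv: "(u, v) \<in> parcs G" "(u, v) \<notin> P.path_arcs" "v \<notin> p ` {k..n}" by (auto simp: P.off_path_def)
    then obtain j where "j < m" "src j = u" "dst j = v" by (auto simp: arc_index)
    then show "(u, v) \<in> D.off" using mark[of j] pos[of v] uv(2,3) unfolding D.off_def
      by (intro CollectI exI[of _ j]) auto
  qed
  show ?thesis
  proof (intro equalityI subsetI)
    fix b assume "b \<in> D.hits i"
    then obtain j a where *: "b = pos (dst j)" "k \<le> a" "a < i" "(p a, src j) \<in> P.off_path\<^sup>*" "j < m" "mark j = 0"
      "pos (dst j) \<noteq> 0" unfolding D.hits_def off by blast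
    then obtain c where c: "k \<le> c" "c \<le> n" "dst j = p c" using D.pos_D by blast
    then have "b = c" using * D.pos_p by simp
    moreover have "(src j, p c) \<in> parcs G - P.path_arcs" using * mark[of j] c by (auto simp: arc_index)
    ultimately show "b \<in> P.detour_ends i" unfolding P.detour_ends_def using * c by auto
  next
    fix b assume "b \<in> P.detour_ends i"
    then obtain a u where *: "k \<le> b" "b \<le> n" "k \<le> a" "a < i" "(p a, u) \<in> P.off_path\<^sup>*"
      "(u, p b) \<in> parcs G" "(u, p b) \<notin> P.path_arcs" unfolding P.detour_ends_def by auto
    then obtain j where j: "j < m" "src j = u" "dst j = p b" by (auto simp: arc_index)
    have "mark j = 0" using mark[OF j(1)] j * by auto
    moreover have "pos (dst j) = b" using D.pos_p * j by simp
    ultimately show "b \<in> D.hits i" unfolding D.hits_def off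
      using * j i P.k_pos by (intro CollectI exI[of _ j] exI[of _ a]) auto
  qed
qed

lemma traced_emission:
  assumes tr: "traced n m src dst s t k p pos pe mark" and pk: "p k = s"
    and F: "\<And>i. k - 1 \<le> i \<Longrightarrow> i \<le> n \<Longrightarrow> detour_search.max_hit n m src dst k p pos mark (Suc i) (F i)"
  shows "emission G p k n F"
proof -
  interpret P: indexed_path G p k n by (rule traced_indexed_path[OF tr pk])
  interpret D: detour_search n m src dst k p pos mark 2 by (rule traced_detour_search[OF tr pk])
  have le: "(\<forall>b\<in>P.detour_ends (Suc i). b \<le> x) \<longleftrightarrow> F i \<le> x" if "k - 1 \<le> i" "i \<le> n" for i x
    using F[OF that] traced_hits[OF tr pk, of "Suc i"] that unfolding D.max_hit_def by fastforce
  show ?thesis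
  proof
    show "P.articulation i \<longleftrightarrow> F (i - 1) \<le> i" if "k \<le> i" "i \<le> n" for i
      using le[of "i - 1" i] that P.k_pos unfolding P.articulation_def by simp
    show br: "P.bridge i \<longleftrightarrow> F i \<le> i" if "k \<le> i" "i < n" for i
      using le[of i i] that unfolding P.bridge_def by simp
    show "P.returning i \<longleftrightarrow> F i = i" if "k \<le> i" "i < n" "P.bridge i" for i
    proof -
      have "F i \<le> i" using br that by blast
      then show ?thesis using F[of i] traced_hits[OF tr pk, of "Suc i"] that P.k_pos
        unfolding D.max_hit_def P.returning_def by fastforce
    qed
  qed
qed

lemma encode_segment:
  assumes tr: "traced n m src dst s t k p pos pe mark" and pk: "p k = s" and ab: "k \<le> a" "a \<le> b" "b \<le> n"
  shows "encode_walk es (indexed_path.segment p a b) = segment_word False p pe a b"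
proof -
  interpret P: indexed_path G p k n by (rule traced_indexed_path[OF tr pk])
  show ?thesis using ab(2,3)
  proof (induction b rule: dec_induct)
    case base
    show ?case by (simp add: P.segment_def P.segment_arcs_def encode_walk_def segment_word_def)
  next
    case (step b)
    have "P.segment a (Suc b) = P.segment a b @ [Edge (P.path_arc b), Node (p (Suc b))]"
      using step by (simp add: P.segment_def P.segment_arcs_def walk_seq_append P.path_arc_def)
    moreover have "(THE j. j < m \<and> es ! j = P.path_arc b) = pe b"
    proof (rule the_equality)
      have pe: "pe b < m" "src (pe b) = p b" "dst (pe b) = p (Suc b)"
        using tr step ab by (auto simp: traced_def)
      then show "pe b < m \<and> es ! pe b = P.path_arc b"
        using edge_pair[of "pe b" es] by (simp add: P.path_arc_def)
      then show "j = pe b" if "j < m \<and> es ! j = P.path_arc b" for j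
        using that distinct_es by (metis nth_eq_iff_index_eq)
    qed
    ultimately show ?case using step by (simp add: encode_walk_def segment_word_Suc)
  qed
qed

definition cands :: "bool \<Rightarrow> nat item list set" where
  "cands tr = (if tr then st_trails else st_paths) G s t"

definition listing :: "bool \<Rightarrow> bool \<Rightarrow> nat list set" where
  "listing tr nd = (if nd then encode_node_seq es ` maximal_safe_node_seqs G (cands tr)
     else encode_walk es ` maximal_safe_walks G (cands tr))"

lemma cands_awalk: "P \<in> cands tr \<Longrightarrow> \<exists>q. awalk s q t"
  by (auto simp: cands_def st_trails_def st_paths_def trail_def split: if_splits)

lemma listing_segments:
  assumes tr: "traced n m src dst s t k p pos pe mark" and pk: "p k = s"
    and ivs: "set ivs = {(a, b). indexed_path.maximal_segment G p k n trl a b}" "distinct (map snd ivs)"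
    and ws: "ws = map (\<lambda>(a, b). segment_word nd p pe a b) ivs"
  shows "cands trl \<noteq> {} \<and> distinct ws \<and> set ws = listing trl nd"
proof -
  interpret P: indexed_path G p k n by (rule traced_indexed_path[OF tr pk])
  have pn: "p n = t" using tr by (simp add: traced_def)
  have cands: "cands trl = P.candidates trl" by (simp add: cands_def P.candidates_def pk pn)
  have le: "k \<le> a \<and> a \<le> b \<and> b \<le> n" if "P.maximal_segment trl a b" for a b
    using that by (auto simp: P.maximal_segment_def P.safe_segment_def)
  have pairs: "{f a b | a b. R a b} = (\<lambda>(a, b). f a b) ` {(a, b). R a b}" for f :: "nat \<Rightarrow> nat \<Rightarrow> 'z" and R
    by auto
  have "cands trl \<noteq> {}" using P.segment_candidate cands by blast
  moreover have "distinct ws"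
  proof -
    have "map last ws = map p (map snd ivs)"
      unfolding ws map_map using le ivs(1) by (intro map_cong refl) (auto simp: last_segment_word)
    moreover have "inj_on p (set (map snd ivs))"
      by (rule inj_on_subset[OF P.inj_p]) (use ivs(1) le in force)
    ultimately have "distinct (map last ws)" using ivs(2) by (metis distinct_map)
    then show ?thesis by (simp add: distinct_map)
  qed
  moreover have "set ws = listing trl nd"
  proof (cases nd)
    case True
    have w: "segment_word True p pe a b = map p [a..<Suc b]" if "a \<le> b" for a b
      using that by (induction b rule: dec_induct) (auto simp: segment_word_refl segment_word_Suc)
    have "set ws = (\<lambda>(a, b). map p [a..<Suc b]) ` {(a, b). P.maximal_segment trl a b}"
      unfolding ws set_map ivs(1) using True le w by (intro image_cong refl) auto
    then show ?thesis using True
      unfolding listing_def cands P.maximal_safe_node_seqs_segments encode_node_seq_def pairs by (simp del: upt_Suc)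
  next
    case False
    have "set ws = (\<lambda>(a, b). encode_walk es (P.segment a b)) ` {(a, b). P.maximal_segment trl a b}"
      unfolding ws set_map ivs(1) using False le encode_segment[OF tr pk] by (intro image_cong refl) auto
    then show ?thesis using False
      unfolding listing_def cands P.maximal_safe_walks_eq pairs
      by (simp add: image_image case_prod_beta)
  qed
  ultimately show ?thesis by blast
qed

lemma runs_list_safe:
  assumes w: "3 * n + 3 \<le> w" "m \<le> w"
  shows "runs w (list_safe tr nd) (input_state n es s t) (221 * m + 530 * n + 600)
    (\<lambda>\<tau>. if cands tr = {} then output_words \<tau> = []
         else distinct (output_words \<tau>) \<and> set (output_words \<tau>) = listing tr nd)"
    (is "runs w _ ?\<sigma>0 _ ?Q")
proof -
  define base where "base = (\<lambda>\<sigma> :: state. var \<sigma> ''n'' = n \<and> var \<sigma> ''s'' = s \<and> var \<sigma> ''t'' = t \<and>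
    arr \<sigma> ''src'' = src \<and> arr \<sigma> ''dst'' = dst \<and> var \<sigma> ''link'' = 0 \<and> var \<sigma> ''count'' = 0 \<and> var \<sigma> ''o'' = 0 \<and>
    arr \<sigma> ''off'' = (\<lambda>_. 0) \<and> arr \<sigma> ''head'' = (\<lambda>u. last_out src u m) \<and>
    (\<forall>j<m. arr \<sigma> ''nxt'' j = last_out src (src j) j))"
  have n: "0 < n" using s_less by simp
  have build: "runs w build_prog ?\<sigma>0 (21 * m + 4)
    (\<lambda>\<sigma>. base \<sigma> \<and> arr \<sigma> ''mark'' = (\<lambda>_. 0) \<and> arr \<sigma> ''pos'' = (\<lambda>_. 0) \<and> arr \<sigma> ''vis'' = (\<lambda>_. 0))"
  proof -
    have "runs w build_prog ?\<sigma>0 (21 * m + 4) (\<lambda>\<tau>. arr \<tau> ''head'' = (\<lambda>u. last_out src u m) \<and>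
      (\<forall>j<m. arr \<tau> ''nxt'' j = last_out src (src j) j))"
      by (rule runs_build) (use w in \<open>auto simp: input_state_def edge_src_def fun_eq_iff\<close>)
    from runs_frame[OF this] show ?thesis
      by (rule runs_weaken) (auto simp: base_def build_prog_def build_body_def input_state_def edge_src_def edge_dst_def fun_eq_iff)
  qed
  define start where "start = (\<lambda>\<sigma> :: state. base \<sigma> \<and> arr \<sigma> ''mark'' = (\<lambda>_. 0) \<and> arr \<sigma> ''pos'' = (\<lambda>_. 0)(s := n) \<and>
    var \<sigma> ''k'' = n \<and> arr \<sigma> ''p'' n = s)"
  have init: "runs w init_prog \<sigma> 8 (\<lambda>\<sigma>. start \<sigma> \<and> arr \<sigma> ''vis'' = (\<lambda>_. 0))"
    if "base \<sigma> \<and> arr \<sigma> ''mark'' = (\<lambda>_. 0) \<and> arr \<sigma> ''pos'' = (\<lambda>_. 0) \<and> arr \<sigma> ''vis'' = (\<lambda>_. 0)" for \<sigma>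
  proof -
    have "wp w init_prog (\<lambda>\<sigma>. start \<sigma> \<and> arr \<sigma> ''vis'' = (\<lambda>_. 0)) \<sigma>"
      using that w s_less by (simp add: init_prog_def start_def base_def)
    from runs_wp[OF this] show ?thesis by (rule runs_weaken) (simp_all add: init_prog_def)
  qed
  define reached where "reached = (\<lambda>\<sigma> :: state. start \<sigma> \<and> (\<forall>v. arr \<sigma> ''vis'' v \<le> 1) \<and>
    (\<exists>r far. detour_search.queue_inv n m src dst n (arr \<sigma> ''p'') ((\<lambda>_. 0)(s := n)) (\<lambda>_. 0) 1 0 r r (Suc n) far
       (arr \<sigma> ''Q'') (arr \<sigma> ''vis'') (arr \<sigma> ''par'') (arr \<sigma> ''F'')))"
  have D1: "detour_search n m src dst n p ((\<lambda>_. 0)(s := n))" if "p n = s" for p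
    by unfold_locales (use n edge_less s_less that in \<open>auto split: if_splits\<close>)
  have search1: "runs w (search_prog 1) \<sigma> (100 * (m + 2 * n + 2)) reached"
    if \<sigma>: "start \<sigma> \<and> arr \<sigma> ''vis'' = (\<lambda>_. 0)" for \<sigma>
  proof -
    interpret D: detour_search n m src dst n "arr \<sigma> ''p''" "(\<lambda>_. 0)(s := n)" "\<lambda>_. 0" 1
      using \<sigma> by (intro D1) (simp add: start_def)
    have "runs w (search_prog 1) \<sigma> (100 * (m + 2 * n + 2)) (\<lambda>\<tau>. (\<exists>r far. D.queue_inv 0 r r (Suc n) far (arr \<tau> ''Q'')
      (arr \<tau> ''vis'') (arr \<tau> ''par'') (arr \<tau> ''F'')) \<and> (\<forall>v. arr \<tau> ''vis'' v \<le> 1))"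
      by (rule D.runs_search) (use \<sigma> w n in \<open>auto simp: start_def base_def\<close>)
    from runs_frame[OF this] show ?thesis
    proof (rule runs_weaken)
      fix \<tau> :: state assume "((\<exists>r far. D.queue_inv 0 r r (Suc n) far (arr \<tau> ''Q'')
        (arr \<tau> ''vis'') (arr \<tau> ''par'') (arr \<tau> ''F'')) \<and> (\<forall>v. arr \<tau> ''vis'' v \<le> 1)) \<and>
        (\<forall>x. x \<notin> assigned_vars (search_prog 1) \<longrightarrow> var \<tau> x = var \<sigma> x) \<and>
        (\<forall>a. a \<notin> stored_arrays (search_prog 1) \<longrightarrow> arr \<tau> a = arr \<sigma> a)"
      then show "reached \<tau>" using \<sigma> unfolding reached_def start_def base_def
        by (simp add: search_prog_def search_loop_def search_body_def edge_step_def pop_step_def next_step_def)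
    qed simp
  qed
  have no_cand: "cands tr = {}" if R: "reached \<sigma>" and vis: "arr \<sigma> ''vis'' t \<noteq> 1" for \<sigma>
  proof (rule ccontr)
    assume "cands tr \<noteq> {}"
    then obtain q where q: "awalk s q t" using cands_awalk by blast
    define p where "p = arr \<sigma> ''p''"
    have pn: "p n = s" using R by (simp add: reached_def start_def p_def)
    interpret D: detour_search n m src dst n p "(\<lambda>_. 0)(s := n)" "\<lambda>_. 0" 1
      using pn by (rule D1)
    obtain r far Q vis par F where queue_inv: "D.queue_inv 0 r r (Suc n) far Q vis par F" "vis = arr \<sigma> ''vis''"
      using R by (auto simp: reached_def p_def)
    have "(s, v) \<in> D.off\<^sup>*" if "awalk u q v" "(s, u) \<in> D.off\<^sup>*" for u v
      using that
    proof (induction q arbitrary: u)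
      case Nil
      then show ?case by (simp add: awalk_Nil_iff)
    next
      case (Cons e q)
      obtain x where e: "e = (u, x)" "(u, x) \<in> parcs G" "awalk x q v"
        using Cons.prems(1) by (cases e) (auto simp: awalk_Cons_iff)
      have "(s, x) \<in> D.off\<^sup>*"
      proof (cases "x = s")
        case False
        from e(2) obtain j where "j < m" "src j = u" "dst j = x" by (auto simp: arc_index)
        then have "(u, x) \<in> D.off" unfolding D.off_def using False by (intro CollectI exI[of _ j]) auto
        with Cons.prems(2) show ?thesis by (rule rtrancl_into_rtrancl)
      qed simp
      then show ?case using Cons.IH e(3) by blast
    qed
    from this[OF q] have "t \<in> Q ` {..<r}" using D.queue_inv_closed(1)[OF queue_inv(1), of n t] pn by simp
    then show False using D.queue_invD(6)[OF queue_inv(1)] vis queue_inv(2) by simp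
  qed
  have found: "runs w (Seq trace_prog (Seq (search_prog 2) (emit_prog tr nd))) \<sigma> (30 * n + 20 + (100 * (m + 2 * n + 2) + (100 * n + 110))) ?Q"
    if R: "reached \<sigma>" and vis: "arr \<sigma> ''vis'' t = 1" for \<sigma>
  proof -
    define p1 where "p1 = arr \<sigma> ''p''"
    have pn: "p1 n = s" using R by (simp add: reached_def start_def p1_def)
    interpret D: detour_search n m src dst n p1 "(\<lambda>_. 0)(s := n)" "\<lambda>_. 0" 1
      using pn by (rule D1)
    define Q par where "Q = arr \<sigma> ''Q''" and "par = arr \<sigma> ''par''"
    obtain r far F where queue_inv: "D.queue_inv 0 r r (Suc n) far Q (arr \<sigma> ''vis'') par F"
      using R by (auto simp: reached_def p1_def Q_def par_def)
    note J = D.queue_invD[OF queue_inv]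
    define V idx where "V = Q ` {..<r}" and "idx = inv_into {..<r} Q"
    have idx: "idx (Q x) = x" if "x < r" for x using J(2) that by (simp add: idx_def inv_into_f_f)
    have par: "0 < par v \<and> par v \<le> m \<and> dst (par v - 1) = v \<and> src (par v - 1) \<in> V \<and> idx (src (par v - 1)) < idx v"
      if v: "v \<in> V" "v \<noteq> s" for v
    proof -
      obtain x where x: "x < r" "v = Q x" using v by (auto simp: V_def)
      then obtain y where y: "y < x" "0 < par v" "par v \<le> m" "dst (par v - 1) = v" "src (par v - 1) = Q y"
        using J(13) v(2) by auto
      then have "y < r" using x by simp
      then show ?thesis using y x idx by (auto simp: V_def)
    qed
    define tracedst where "tracedst = (\<lambda>\<tau> :: state. base \<tau> \<and> (\<forall>v. arr \<tau> ''vis'' v \<le> 1) \<and>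
      traced n m src dst s t (var \<tau> ''k'') (arr \<tau> ''p'') (arr \<tau> ''pos'') (arr \<tau> ''pe'') (arr \<tau> ''mark'') \<and>
      arr \<tau> ''p'' (var \<tau> ''k'') = s)"
    have "runs w trace_prog \<sigma> (30 * n + 20)
      (\<lambda>\<tau>. traced n m src dst s t (var \<tau> ''k'') (arr \<tau> ''p'') (arr \<tau> ''pos'') (arr \<tau> ''pe'') (arr \<tau> ''mark'') \<and>
       arr \<tau> ''p'' (var \<tau> ''k'') = s)"
    proof (rule runs_trace[where V = V and idx = idx and par = par])
      show "t \<in> V" using J(6) vis by (simp add: V_def)
      show "V \<subseteq> {..<n}" using J(3) by (simp add: V_def)
      show "\<And>v. arr \<sigma> ''pos'' v \<noteq> 0 \<Longrightarrow> v = s" using R by (auto simp: reached_def start_def split: if_splits)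
    qed (use R w n par in \<open>auto simp: reached_def start_def base_def par_def\<close>)
    from runs_frame[OF this] have trace: "runs w trace_prog \<sigma> (30 * n + 20) tracedst"
    proof (rule runs_weaken)
      fix \<tau> :: state assume "(traced n m src dst s t (var \<tau> ''k'') (arr \<tau> ''p'') (arr \<tau> ''pos'') (arr \<tau> ''pe'') (arr \<tau> ''mark'') \<and>
        arr \<tau> ''p'' (var \<tau> ''k'') = s) \<and> (\<forall>x. x \<notin> assigned_vars trace_prog \<longrightarrow> var \<tau> x = var \<sigma> x) \<and>
        (\<forall>a. a \<notin> stored_arrays trace_prog \<longrightarrow> arr \<tau> a = arr \<sigma> a)"
      then show "tracedst \<tau>" using R unfolding reached_def start_def base_def tracedst_def
        by (simp add: trace_prog_def trace_body_def)
    qed simp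
    have rest: "runs w (Seq (search_prog 2) (emit_prog tr nd)) \<sigma>' (100 * (m + 2 * n + 2) + (100 * n + 110)) ?Q"
      if T: "tracedst \<sigma>'" for \<sigma>'
    proof -
      define k p pos pe mark where defs: "k = var \<sigma>' ''k''" "p = arr \<sigma>' ''p''" "pos = arr \<sigma>' ''pos''"
        "pe = arr \<sigma>' ''pe''" "mark = arr \<sigma>' ''mark''"
      have tr: "traced n m src dst s t k p pos pe mark" and pk: "p k = s"
        and b: "base \<sigma>'" and v1: "\<forall>v. arr \<sigma>' ''vis'' v \<le> 1" using T by (auto simp: tracedst_def defs)
      interpret D2: detour_search n m src dst k p pos mark 2 by (rule traced_detour_search[OF tr pk])
      have "runs w (search_prog 2) \<sigma>' (100 * (m + 2 * n + 2)) (\<lambda>\<tau>. (\<exists>r far. D2.queue_inv 0 r r (Suc n) far (arr \<tau> ''Q'')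
        (arr \<tau> ''vis'') (arr \<tau> ''par'') (arr \<tau> ''F'')) \<and> (\<forall>v. arr \<tau> ''vis'' v \<le> 2))"
        by (rule D2.runs_search) (use b v1 w n in \<open>auto simp: base_def defs le_imp_less_Suc numeral_2_eq_2\<close>)
      note runs_Seq[OF runs_frame[OF this]]
      moreover have "runs w (emit_prog tr nd) \<tau> (100 * n + 110) ?Q"
        if fr: "((\<exists>r far. D2.queue_inv 0 r r (Suc n) far (arr \<tau> ''Q'') (arr \<tau> ''vis'') (arr \<tau> ''par'') (arr \<tau> ''F'')) \<and>
          (\<forall>v. arr \<tau> ''vis'' v \<le> 2)) \<and> (\<forall>x. x \<notin> assigned_vars (search_prog 2) \<longrightarrow> var \<tau> x = var \<sigma>' x) \<and>
          (\<forall>a. a \<notin> stored_arrays (search_prog 2) \<longrightarrow> arr \<tau> a = arr \<sigma>' a)" for \<tau>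
      proof -
        obtain r far where inv2: "D2.queue_inv 0 r r (Suc n) far (arr \<tau> ''Q'') (arr \<tau> ''vis'') (arr \<tau> ''par'') (arr \<tau> ''F'')"
          using fr by blast
        have F: "D2.max_hit (Suc i) (arr \<tau> ''F'' i)" if "k - 1 \<le> i" "i \<le> n" for i
          using D2.queue_invD(12)[OF inv2] that by simp
        interpret X: emission G p k n "arr \<tau> ''F''" pe tr nd by (rule traced_emission[OF tr pk F])
        have st: "var \<tau> ''n'' = n" "var \<tau> ''k'' = k" "arr \<tau> ''p'' = p" "arr \<tau> ''pe'' = pe"
          "var \<tau> ''link'' = 0" "var \<tau> ''count'' = 0" "var \<tau> ''o'' = 0" "arr \<tau> ''off'' = (\<lambda>_. 0)"
          using fr b by (simp_all add: base_def defs search_prog_def search_loop_def search_body_def edge_step_def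
              pop_step_def next_step_def)
        have bounds: "p a \<le> w" if "k \<le> a" "a \<le> n" for a using D2.p_less[OF that] w by simp
        have bounds': "pe a \<le> w" if "k \<le> a" "a < n" for a
        proof -
          have "pe a < m" using tr that by (simp add: traced_def)
          then show ?thesis using w by simp
        qed
        show ?thesis
        proof (rule runs_weaken[OF X.runs_emit])
          fix \<tau>' :: state assume "\<exists>ivs. set ivs = {(a, b). X.maximal_segment tr a b} \<and> distinct (map snd ivs) \<and>
            output_words \<tau>' = map (\<lambda>(a, b). segment_word nd p pe a b) ivs"
          then obtain ivs where "set ivs = {(a, b). X.maximal_segment tr a b}" "distinct (map snd ivs)"
            "output_words \<tau>' = map (\<lambda>(a, b). segment_word nd p pe a b) ivs" by blast
          from listing_segments[OF \<open>traced n m src dst s t k p pos pe mark\<close> pk this] show "?Q \<tau>'" by simp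
        qed (use st bounds bounds' w in simp_all)
      qed
      ultimately show ?thesis by blast
    qed
    from runs_Seq[OF trace rest] show ?thesis .
  qed
  have final: "runs w (Cond (Equal (Arr ''vis'' (Var ''t'')) (Const 1))
       (Seq trace_prog (Seq (search_prog 2) (emit_prog tr nd))) Skip) \<sigma>
       (1 + bcost (Equal (Arr ''vis'' (Var ''t'')) (Const 1)) + (30 * n + 20 + (100 * (m + 2 * n + 2) + (100 * n + 110)))) ?Q"
    if R: "reached \<sigma>" for \<sigma>
  proof (rule runs_Cond)
    have st: "var \<sigma> ''t'' = t" "var \<sigma> ''count'' = 0" using R by (simp_all add: reached_def start_def base_def)
    show "runs w (Seq trace_prog (Seq (search_prog 2) (emit_prog tr nd))) \<sigma>
      (30 * n + 20 + (100 * (m + 2 * n + 2) + (100 * n + 110))) ?Q"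
      if "bval (Equal (Arr ''vis'' (Var ''t'')) (Const 1)) \<sigma>" using found[OF R] that st by simp
    show "runs w Skip \<sigma> (30 * n + 20 + (100 * (m + 2 * n + 2) + (100 * n + 110))) ?Q"
      if "\<not> bval (Equal (Arr ''vis'' (Var ''t'')) (Const 1)) \<sigma>"
    proof -
      have "wp w Skip ?Q \<sigma>" using no_cand[OF R] that st by (simp add: output_words_def)
      from runs_wp[OF this] show ?thesis by (rule runs_weaken) auto
    qed
  qed
  note runs_Seq[OF build runs_Seq[OF init runs_Seq[OF search1 final]]]
  then show ?thesis unfolding list_safe_def by (rule runs_weaken) auto
qed

end

lemma lists_in_linear_time_list_safe:
  assumes sol: "\<And>G n es s t. listed_digraph G n es s t \<Longrightarrow>
    cand G s t = listed_digraph.cands G s t tr \<and>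
    encode es ` sol G (cand G s t) = listed_digraph.listing G es s t tr nd"
  shows "lists_in_linear_time cand sol encode (list_safe tr nd)"
  unfolding lists_in_linear_time_def Let_def
proof (rule exI[of _ 2000], intro allI impI)
  fix G :: "nat pair_pre_digraph" and n es s t
  assume "pair_fin_digraph G" "represents n es G" "s \<in> pverts G" "t \<in> pverts G"
  then interpret listed_digraph G n es s t
    by (intro listed_digraph.intro listed_digraph_axioms.intro)
  let ?w = "2000 * (card (parcs G) + n)"
  have "0 < n" using s_less by simp
  then have w: "3 * n + 3 \<le> ?w" "m \<le> ?w" "221 * m + 530 * n + 600 \<le> ?w" by (simp_all add: card_arcs)
  from runs_list_safe[OF w(1,2), of tr nd] obtain k \<tau> where
    *: "exec ?w (list_safe tr nd) (input_state n es s t) k \<tau>" "k \<le> 221 * m + 530 * n + 600"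
    "if cands tr = {} then output_words \<tau> = []
         else distinct (output_words \<tau>) \<and> set (output_words \<tau>) = listing tr nd"
    unfolding runs_def by blast
  have eq: "cand G s t = cands tr" "encode es ` sol G (cand G s t) = listing tr nd"
    using sol[OF listed_digraph_axioms] by blast+
  show "\<exists>k \<tau>. exec ?w (list_safe tr nd) (input_state n es s t) k \<tau> \<and> k \<le> ?w \<and>
    (if cand G s t = {} then output_words \<tau> = []
     else distinct (output_words \<tau>) \<and> set (output_words \<tau>) = encode es ` sol G (cand G s t))"
    unfolding eq(2) unfolding eq(1)
    using * w(3) by (intro exI[of _ k] exI[of _ \<tau>] conjI) auto
qed

theorem theorem1:
  shows "(\<exists>prog. lists_in_linear_time st_paths maximal_safe_walks encode_walk prog) \<and>
         (\<exists>prog. lists_in_linear_time st_trails maximal_safe_walks encode_walk prog) \<and>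
         (\<exists>prog. lists_in_linear_time st_paths maximal_safe_node_seqs encode_node_seq prog) \<and>
         (\<exists>prog. lists_in_linear_time st_trails maximal_safe_node_seqs encode_node_seq prog)"
proof (intro conjI)
  note defs = listed_digraph.cands_def listed_digraph.listing_def
  show "\<exists>prog. lists_in_linear_time st_paths maximal_safe_walks encode_walk prog"
    by (rule exI, rule lists_in_linear_time_list_safe[of _ False _ _ False]) (simp add: defs)
  show "\<exists>prog. lists_in_linear_time st_trails maximal_safe_walks encode_walk prog"
    by (rule exI, rule lists_in_linear_time_list_safe[of _ True _ _ False]) (simp add: defs)
  show "\<exists>prog. lists_in_linear_time st_paths maximal_safe_node_seqs encode_node_seq prog"
    by (rule exI, rule lists_in_linear_time_list_safe[of _ False _ _ True]) (simp add: defs)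
  show "\<exists>prog. lists_in_linear_time st_trails maximal_safe_node_seqs encode_node_seq prog"
    by (rule exI, rule lists_in_linear_time_list_safe[of _ True _ _ True]) (simp add: defs)
qed

end
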